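(* Let $P$ be a finite poset and, for each prime $p$, let $R_p=\mathcal{R}_{\mathbb{F}_p}[\mathcal{I}(P)]$ be the Hibi ring associated to $P$ over $\mathbb{F}_p$. Suppose that the rings $R_p$ are $\omega^{(-1)}$-level and not Gorenstein. Then $$\lim_{p\to\infty} cx_F(R_p)=\#\{v\in P : v \text{ does not lie in any maximal chain of } P \text{ of minimal length}\},$$ where the limit is over primes $p$.
   Context: Hibi rings: a poset ideal of $P$ is a subset $I\subseteq P$ such that $y\in I$ and $x\le y$ imply $x\in I$; $\mathcal{I}(P)$ is the set of all poset ideals (including $\varnothing$). For a field $K$ and a finite poset $P$, the Hibi ring $R=\mathcal{R}_K[\mathcal{I}(P)]$ is the $K$-subalgebra of $K[t,x_v : v\in P]$ generated by the monomials $x_I:=t\prod_{v\in I}x_v$, $I\in\mathcal{I}(P)$. It is a normal toric ring, graded by the degree in $t$. A chain is a totally ordered subset; a maximal chain "of minimal length" is a maximal chain of $P$ whose number of elements is smallest among all maximal chains of $P$. $\omega^{(-1)}$-level: let $\omega$ be the canonical module of $R$, realized as the ideal of $R$ spanned by the monomials whose exponent vectors lie in the relative interior of the cone generated by the exponent vectors of monomials of $R$. Put $\omega^{(-1)}=\operatorname{Hom}_R(\omega,R)$, identified with $\{f\in\operatorname{Frac}(R): f\omega\subseteq R\}$; it is spanned over $K$ by Laurent monomials in $t$ and the $x_v$, and is graded by the exponent of $t$. $R$ is called $\omega^{(-1)}$-level if $\omega^{(-1)}$ is generated over $R$ by elements of one single degree. Frobenius complexity: for an $F$-finite ring $R$ of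 characteristic $p>0$, let $\mathcal{C}^e(R)$ be the set of $p^{-e}$-linear maps, i.e. additive maps $\psi:R\to R$ with $\psi(r^{p^e}m)=r\psi(m)$, and let $\mathcal{C}(R)=\bigoplus_{e\ge 0}\mathcal{C}^e(R)$, an $\mathbb{N}$-graded (noncommutative) ring under composition, with $\mathcal{C}^0(R)=R$. For an $\mathbb{N}$-graded ring $A=\bigoplus_e A_e$, let $G_e(A)$ be the subring generated by the elements of degree $\le e$, let $G_{-1}(A)=A_0$, and let $c_e(A)$ be the minimal number of homogeneous generators of $A_e/(G_{e-1}(A))_e$ over $A_0$. Here generation over $A_0$ is as an $A_0$-$A_0$-bimodule; for $A=\mathcal{C}(R)$ this amounts to generation under $\psi\mapsto\psi(r\,\cdot\,)$, $r\in R$. The Frobenius complexity of $R$ is $$cx_F(R)=\inf\{\alpha\in\mathbb{R}_{>0}: c_e(\mathcal{C}(R))=\mathcal{O}(p^{\alpha e})\text{ as } e\to\infty\}.$$ *)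

theory Defs
  imports
    "HOL-Analysis.Analysis"
    "HOL-Number_Theory.Residues"
    "HOL-Algebra.Generated_Rings"
    "HOL-Algebra.Ring_Divisibility"
begin

section \<open>Posets\<close>

text \<open>A finite poset is a subset \<open>P\<close> of a type of class \<open>finite\<close> together with a relation \<open>r\<close>
  such that \<open>partial_order_on P r\<close>; \<open>(x, y) \<in> r\<close> means \<open>x \<le> y\<close>.\<close>

definition poset_ideals :: "'v set \<Rightarrow> ('v \<times> 'v) set \<Rightarrow> 'v set set" where
  "poset_ideals P r = {I. I \<subseteq> P \<and> (\<forall>x y. y \<in> I \<and> (x, y) \<in> r \<longrightarrow> x \<in> I)}"

definition maximal_chains :: "'v set \<Rightarrow> ('v \<times> 'v) set \<Rightarrow> 'v set set" where
  "maximal_chains P r = {C. pred_on.maxchain P (\<lambda>x y. (x, y) \<in> r) C}"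

definition minimal_length_maximal_chains :: "'v set \<Rightarrow> ('v \<times> 'v) set \<Rightarrow> 'v set set" where
  "minimal_length_maximal_chains P r =
     {C \<in> maximal_chains P r. \<forall>D \<in> maximal_chains P r. card C \<le> card D}"


section \<open>Polynomial rings in several variables\<close>

text \<open>The polynomial ring over \<open>K\<close> in the variables indexed by \<open>V\<close>. A polynomial is its
  coefficient function on exponent vectors.\<close>

definition mpoly_ring ::
    "('k, 'm) ring_scheme \<Rightarrow> 'i::finite set \<Rightarrow> (nat ^ 'i \<Rightarrow> 'k) ring" where
  "mpoly_ring K V =
     \<lparr>carrier = {f. (\<forall>m. f m \<in> carrier K) \<and> finite {m. f m \<noteq> \<zero>\<^bsub>K\<^esub>} \<and>
                    (\<forall>m. f m \<noteq> \<zero>\<^bsub>K\<^esub> \<longrightarrow> (\<forall>i. m $ i \<noteq> 0 \<longrightarrow> i \<in> V))},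
      monoid.mult = (\<lambda>f g m. \<Oplus>\<^bsub>K\<^esub>ab\<in>{ab. fst ab + snd ab = m}. f (fst ab) \<otimes>\<^bsub>K\<^esub> g (snd ab)),
      one = (\<lambda>m. if m = 0 then \<one>\<^bsub>K\<^esub> else \<zero>\<^bsub>K\<^esub>),
      zero = (\<lambda>m. \<zero>\<^bsub>K\<^esub>),
      add = (\<lambda>f g m. f m \<oplus>\<^bsub>K\<^esub> g m)\<rparr>"

definition mterm ::
    "('k, 'm) ring_scheme \<Rightarrow> 'k \<Rightarrow> nat ^ 'i::finite \<Rightarrow> (nat ^ 'i \<Rightarrow> 'k)" where
  "mterm K c m = (\<lambda>m'. if m' = m then c else \<zero>\<^bsub>K\<^esub>)"


section \<open>Hibi rings\<close>

text \<open>The variable \<open>t\<close> has index \<open>None\<close>, the variable \<open>x\<^sub>v\<close> has index \<open>Some v\<close>.\<close>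

definition hibi_exponent :: "'v::finite set \<Rightarrow> nat ^ 'v option" where
  "hibi_exponent I = (\<chi> i. case i of None \<Rightarrow> 1 | Some v \<Rightarrow> if v \<in> I then 1 else 0)"

definition hibi_ambient_ring ::
    "('k, 'm) ring_scheme \<Rightarrow> 'v::finite set \<Rightarrow> (nat ^ 'v option \<Rightarrow> 'k) ring" where
  "hibi_ambient_ring K P = mpoly_ring K (insert None (Some ` P))"

definition hibi_ring ::
    "('k, 'm) ring_scheme \<Rightarrow> 'v::finite set \<Rightarrow> ('v \<times> 'v) set \<Rightarrow> (nat ^ 'v option \<Rightarrow> 'k) ring"
  where
  "hibi_ring K P r =
     (hibi_ambient_ring K P)
       \<lparr>carrier := generate_ring (hibi_ambient_ring K P)
          ((\<lambda>c. mterm K c 0) ` carrier K \<union>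
           (\<lambda>I. mterm K \<one>\<^bsub>K\<^esub> (hibi_exponent I)) ` poset_ideals P r)\<rparr>"

definition hibi_monomials ::
    "('k, 'm) ring_scheme \<Rightarrow> 'v::finite set \<Rightarrow> ('v \<times> 'v) set \<Rightarrow> (nat ^ 'v option) set" where
  "hibi_monomials K P r = {m. mterm K \<one>\<^bsub>K\<^esub> m \<in> carrier (hibi_ring K P r)}"

definition real_exponent :: "nat ^ 'i::finite \<Rightarrow> real ^ 'i" where
  "real_exponent m = (\<chi> i. real (m $ i))"

definition hibi_cone ::
    "('k, 'm) ring_scheme \<Rightarrow> 'v::finite set \<Rightarrow> ('v \<times> 'v) set \<Rightarrow> (real ^ 'v option) set" where
  "hibi_cone K P r = convex_cone hull (real_exponent ` hibi_monomials K P r)"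

text \<open>The canonical module, as an ideal. The \<open>K\<close>-span of a set of monomials consists of the
  polynomials all of whose monomials belong to that set.\<close>

definition hibi_omega ::
    "('k, 'm) ring_scheme \<Rightarrow> 'v::finite set \<Rightarrow> ('v \<times> 'v) set \<Rightarrow> (nat ^ 'v option \<Rightarrow> 'k) set"
  where
  "hibi_omega K P r =
     {f \<in> carrier (hibi_ambient_ring K P). \<forall>m. f m \<noteq> \<zero>\<^bsub>K\<^esub> \<longrightarrow>
        m \<in> hibi_monomials K P r \<and> real_exponent m \<in> rel_interior (hibi_cone K P r)}"

definition t_homogeneous ::
    "('k, 'm) ring_scheme \<Rightarrow> int \<Rightarrow> (nat ^ 'v::finite option \<Rightarrow> 'k) \<Rightarrow> bool" where
  "t_homogeneous K d f \<longleftrightarrow> (\<forall>m. f m \<noteq> \<zero>\<^bsub>K\<^esub> \<longrightarrow> int (m $ None) = d)"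


section \<open>Modules of homomorphisms\<close>

definition ideal_module :: "('a, 'm) ring_scheme \<Rightarrow> 'a set \<Rightarrow> ('a, 'a) module" where
  "ideal_module R I =
     \<lparr>carrier = I, monoid.mult = (\<otimes>\<^bsub>R\<^esub>), one = \<one>\<^bsub>R\<^esub>, zero = \<zero>\<^bsub>R\<^esub>, add = (\<oplus>\<^bsub>R\<^esub>),
      smult = (\<otimes>\<^bsub>R\<^esub>)\<rparr>"

definition module_homs ::
    "('a, 'm) ring_scheme \<Rightarrow> ('a, 'b, 'n) module_scheme \<Rightarrow> ('a, 'c, 'o) module_scheme
       \<Rightarrow> ('b \<Rightarrow> 'c) set" where
  "module_homs R M N =
     {\<phi> \<in> carrier M \<rightarrow>\<^sub>E carrier N.
        (\<forall>x \<in> carrier M. \<forall>y \<in> carrier M. \<phi> (x \<oplus>\<^bsub>M\<^esub> y) = \<phi> x \<oplus>\<^bsub>N\<^esub> \<phi> y) \<and>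
        (\<forall>a \<in> carrier R. \<forall>x \<in> carrier M. \<phi> (a \<odot>\<^bsub>M\<^esub> x) = a \<odot>\<^bsub>N\<^esub> \<phi> x)}"

text \<open>The fields \<open>mult\<close> and \<open>one\<close> of a \<open>module\<close> record play no role for modules.\<close>

definition hom_module ::
    "('a, 'm) ring_scheme \<Rightarrow> ('a, 'b, 'n) module_scheme \<Rightarrow> ('a, 'c, 'o) module_scheme
       \<Rightarrow> ('a, 'b \<Rightarrow> 'c) module" where
  "hom_module R M N =
     \<lparr>carrier = module_homs R M N, monoid.mult = undefined, one = undefined,
      zero = (\<lambda>x\<in>carrier M. \<zero>\<^bsub>N\<^esub>),
      add = (\<lambda>\<phi> \<psi>. \<lambda>x\<in>carrier M. \<phi> x \<oplus>\<^bsub>N\<^esub> \<psi> x),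
      smult = (\<lambda>a \<phi>. \<lambda>x\<in>carrier M. a \<odot>\<^bsub>N\<^esub> \<phi> x)\<rparr>"


section \<open>The level condition\<close>

text \<open>\<open>hibi_omega_inv\<close> is \<open>Hom\<^sub>R(\<omega>, R)\<close>. When a homomorphism is identified with the element \<open>f\<close> of
  \<open>Frac(R)\<close> by which it multiplies, \<open>f\<close> is homogeneous with \<open>t\<close>-exponent \<open>d\<close> exactly if the
  homomorphism raises \<open>t\<close>-degrees by \<open>d\<close>; the integer \<open>d\<close> may be negative.\<close>

definition hibi_omega_inv ::
    "('k, 'm) ring_scheme \<Rightarrow> 'v::finite set \<Rightarrow> ('v \<times> 'v) set \<Rightarrow>
     (nat ^ 'v option \<Rightarrow> 'k, (nat ^ 'v option \<Rightarrow> 'k) \<Rightarrow> (nat ^ 'v option \<Rightarrow> 'k)) module" where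
  "hibi_omega_inv K P r =
     (let R = hibi_ring K P r
      in hom_module R (ideal_module R (hibi_omega K P r)) (ideal_module R (carrier R)))"

definition hibi_omega_inv_degree ::
    "('k, 'm) ring_scheme \<Rightarrow> 'v::finite set \<Rightarrow> ('v \<times> 'v) set \<Rightarrow> int \<Rightarrow>
     ((nat ^ 'v option \<Rightarrow> 'k) \<Rightarrow> (nat ^ 'v option \<Rightarrow> 'k)) set" where
  "hibi_omega_inv_degree K P r d =
     {\<phi> \<in> carrier (hibi_omega_inv K P r).
        \<forall>j. \<forall>w \<in> hibi_omega K P r. t_homogeneous K j w \<longrightarrow> t_homogeneous K (j + d) (\<phi> w)}"

definition generates_module ::
    "('a, 'm) ring_scheme \<Rightarrow> ('a, 'b, 'n) module_scheme \<Rightarrow> 'b set \<Rightarrow> bool" where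
  "generates_module R M S \<longleftrightarrow>
     S \<subseteq> carrier M \<and> (\<forall>N. submodule N R M \<and> S \<subseteq> N \<longrightarrow> N = carrier M)"

definition hibi_omega_inv_level ::
    "('k, 'm) ring_scheme \<Rightarrow> 'v::finite set \<Rightarrow> ('v \<times> 'v) set \<Rightarrow> bool" where
  "hibi_omega_inv_level K P r \<longleftrightarrow>
     (\<exists>d. \<exists>S \<subseteq> hibi_omega_inv_degree K P r d.
        generates_module (hibi_ring K P r) (hibi_omega_inv K P r) S)"


section \<open>Gorenstein rings\<close>

definition localization_rel ::
    "('a, 'm) ring_scheme \<Rightarrow> 'a set \<Rightarrow> (('a \<times> 'a) \<times> ('a \<times> 'a)) set" where
  "localization_rel R S =
     {((a, s), (b, t)). a \<in> carrier R \<and> s \<in> S \<and> b \<in> carrier R \<and> t \<in> S \<and>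
        (\<exists>u \<in> S. u \<otimes>\<^bsub>R\<^esub> (t \<otimes>\<^bsub>R\<^esub> a) = u \<otimes>\<^bsub>R\<^esub> (s \<otimes>\<^bsub>R\<^esub> b))}"

definition fraction_class :: "('a, 'm) ring_scheme \<Rightarrow> 'a set \<Rightarrow> 'a \<Rightarrow> 'a \<Rightarrow> ('a \<times> 'a) set" where
  "fraction_class R S a s = localization_rel R S `` {(a, s)}"

definition localization :: "('a, 'm) ring_scheme \<Rightarrow> 'a set \<Rightarrow> ('a \<times> 'a) set ring" where
  "localization R S =
     \<lparr>carrier = (carrier R \<times> S) // localization_rel R S,
      monoid.mult = (\<lambda>X Y. \<Union>(a, s)\<in>X. \<Union>(b, t)\<in>Y. fraction_class R S (a \<otimes>\<^bsub>R\<^esub> b) (s \<otimes>\<^bsub>R\<^esub> t)),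
      one = fraction_class R S \<one>\<^bsub>R\<^esub> \<one>\<^bsub>R\<^esub>,
      zero = fraction_class R S \<zero>\<^bsub>R\<^esub> \<one>\<^bsub>R\<^esub>,
      add = (\<lambda>X Y. \<Union>(a, s)\<in>X. \<Union>(b, t)\<in>Y.
               fraction_class R S (a \<otimes>\<^bsub>R\<^esub> t \<oplus>\<^bsub>R\<^esub> b \<otimes>\<^bsub>R\<^esub> s) (s \<otimes>\<^bsub>R\<^esub> t))\<rparr>"

text \<open>Injectivity is stated in Baer's form, extension of homomorphisms from ideals, because one
  cannot quantify over the modules of all types.\<close>

definition injective_module ::
    "('a, 'm) ring_scheme \<Rightarrow> ('a, 'b, 'n) module_scheme \<Rightarrow> bool" where
  "injective_module R M \<longleftrightarrow> module R M \<and>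
     (\<forall>J. ideal J R \<longrightarrow>
        (\<forall>h \<in> module_homs R (ideal_module R J) M.
           \<exists>g \<in> module_homs R (ideal_module R (carrier R)) M. \<forall>a \<in> J. g a = h a))"

text \<open>A finite injective resolution \<open>0 \<rightarrow> R \<rightarrow> E\<^sub>0 \<rightarrow> E\<^sub>1 \<rightarrow> \<dots> \<rightarrow> E\<^sub>n \<rightarrow> 0\<close> of a Noetherian ring as a
  module over itself. The minimal one has terms of cardinality at most the maximum of that of \<open>R\<close>
  and \<open>\<aleph>\<^sub>0\<close>, so carriers in the type \<open>nat \<Rightarrow> 'a\<close> are no restriction.\<close>

definition finite_self_injective_dimension :: "('a, 'm) ring_scheme \<Rightarrow> bool" where
  "finite_self_injective_dimension R \<longleftrightarrow>
     (\<exists>(n::nat) (E :: nat \<Rightarrow> ('a, nat \<Rightarrow> 'a) module) \<epsilon> \<delta>.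
        (\<forall>i. injective_module R (E i)) \<and>
        (\<forall>i>n. carrier (E i) = {\<zero>\<^bsub>E i\<^esub>}) \<and>
        \<epsilon> \<in> module_homs R (ideal_module R (carrier R)) (E 0) \<and>
        (\<forall>i. \<delta> i \<in> module_homs R (E i) (E (Suc i))) \<and>
        inj_on \<epsilon> (carrier R) \<and>
        \<epsilon> ` carrier R = {x \<in> carrier (E 0). \<delta> 0 x = \<zero>\<^bsub>E 1\<^esub>} \<and>
        (\<forall>i. \<delta> i ` carrier (E i) =
               {x \<in> carrier (E (Suc i)). \<delta> (Suc i) x = \<zero>\<^bsub>E (Suc (Suc i))\<^esub>}))"

definition gorenstein_ring :: "('a, 'm) ring_scheme \<Rightarrow> bool" where
  "gorenstein_ring R \<longleftrightarrow> cring R \<and> noetherian_ring R \<and>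
     (\<forall>Q. primeideal Q R \<longrightarrow>
        finite_self_injective_dimension (localization R (carrier R - Q)))"


section \<open>Frobenius complexity\<close>

definition frobenius_maps :: "nat \<Rightarrow> ('a, 'm) ring_scheme \<Rightarrow> nat \<Rightarrow> ('a \<Rightarrow> 'a) set" where
  "frobenius_maps p R e =
     {\<psi> \<in> carrier R \<rightarrow>\<^sub>E carrier R.
        (\<forall>x \<in> carrier R. \<forall>y \<in> carrier R. \<psi> (x \<oplus>\<^bsub>R\<^esub> y) = \<psi> x \<oplus>\<^bsub>R\<^esub> \<psi> y) \<and>
        (\<forall>a \<in> carrier R. \<forall>x \<in> carrier R. \<psi> ((a [^]\<^bsub>R\<^esub> (p ^ e)) \<otimes>\<^bsub>R\<^esub> x) = a \<otimes>\<^bsub>R\<^esub> \<psi> x)}"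

text \<open>Elements of the direct sum are sequences whose \<open>e\<close>-th entry is \<open>p\<^sup>-\<^sup>e\<close>-linear.\<close>

definition cartier_algebra :: "nat \<Rightarrow> ('a, 'm) ring_scheme \<Rightarrow> (nat \<Rightarrow> 'a \<Rightarrow> 'a) ring" where
  "cartier_algebra p R =
     \<lparr>carrier = {f. (\<forall>e. f e \<in> frobenius_maps p R e) \<and>
                    finite {e. f e \<noteq> (\<lambda>x\<in>carrier R. \<zero>\<^bsub>R\<^esub>)}},
      monoid.mult = (\<lambda>f g e. \<lambda>x\<in>carrier R. \<Oplus>\<^bsub>R\<^esub>i\<in>{..e}. f i (g (e - i) x)),
      one = (\<lambda>e. \<lambda>x\<in>carrier R. if e = 0 then x else \<zero>\<^bsub>R\<^esub>),
      zero = (\<lambda>e. \<lambda>x\<in>carrier R. \<zero>\<^bsub>R\<^esub>),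
      add = (\<lambda>f g e. \<lambda>x\<in>carrier R. f e x \<oplus>\<^bsub>R\<^esub> g e x)\<rparr>"

definition cartier_component :: "nat \<Rightarrow> ('a, 'm) ring_scheme \<Rightarrow> nat \<Rightarrow> (nat \<Rightarrow> 'a \<Rightarrow> 'a) set" where
  "cartier_component p R e =
     {f \<in> carrier (cartier_algebra p R). \<forall>i. i \<noteq> e \<longrightarrow> f i = (\<lambda>x\<in>carrier R. \<zero>\<^bsub>R\<^esub>)}"

text \<open>In the following, \<open>C e\<close> is the degree \<open>e\<close> component of the graded ring \<open>A\<close>, and
  \<open>generated_below A C e\<close> is \<open>G\<^bsub>e-1\<^esub>(A)\<close>.\<close>

definition generated_below :: "('a, 'm) ring_scheme \<Rightarrow> (nat \<Rightarrow> 'a set) \<Rightarrow> nat \<Rightarrow> 'a set" where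
  "generated_below A C e = (if e = 0 then C 0 else generate_ring A (\<Union>i<e. C i))"

definition sub_bimodule :: "('a, 'm) ring_scheme \<Rightarrow> 'a set \<Rightarrow> 'a set \<Rightarrow> bool" where
  "sub_bimodule A B N \<longleftrightarrow> subgroup N (add_monoid A) \<and>
     (\<forall>b \<in> B. \<forall>x \<in> N. b \<otimes>\<^bsub>A\<^esub> x \<in> N \<and> x \<otimes>\<^bsub>A\<^esub> b \<in> N)"

text \<open>The classes of the elements of \<open>S\<close> generate the quotient of \<open>C e\<close> by the degree \<open>e\<close> part of
  \<open>G\<^bsub>e-1\<^esub>(A)\<close> if and only if no proper subbimodule of \<open>C e\<close> contains \<open>S\<close> and that part.\<close>

definition generates_modulo_lower ::
    "('a, 'm) ring_scheme \<Rightarrow> (nat \<Rightarrow> 'a set) \<Rightarrow> nat \<Rightarrow> 'a set \<Rightarrow> bool" where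
  "generates_modulo_lower A C e S \<longleftrightarrow> S \<subseteq> C e \<and>
     (\<forall>N. sub_bimodule A (C 0) N \<and> N \<subseteq> C e \<and> generated_below A C e \<inter> C e \<subseteq> N \<and> S \<subseteq> N \<longrightarrow> N = C e)"

definition complexity_sequence :: "('a, 'm) ring_scheme \<Rightarrow> (nat \<Rightarrow> 'a set) \<Rightarrow> nat \<Rightarrow> enat" where
  "complexity_sequence A C e =
     (INF S\<in>{S. finite S \<and> generates_modulo_lower A C e S}. enat (card S))"

definition frobenius_complexity :: "nat \<Rightarrow> ('a, 'm) ring_scheme \<Rightarrow> ereal" where
  "frobenius_complexity p R =
     (INF \<alpha>\<in>{\<alpha>::real. \<alpha> > 0 \<and>
        (\<exists>B::real. \<forall>\<^sub>F e in sequentially.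
           ereal_of_enat (complexity_sequence (cartier_algebra p R) (cartier_component p R) e)
             \<le> ereal (B * real p powr (\<alpha> * real e)))}. ereal \<alpha>)"

end

theory Submission
  imports Defs "HOL-Library.Poly_Mapping"
begin

text \<open>
  Adjoin to \<open>P\<close> a least element, carrying the variable \<open>t\<close>, and a greatest element, where all
  exponents are \<open>0\<close>. A Laurent monomial is then an integer function \<open>x\<close> on the extended poset that
  vanishes at the top. The Hibi ring \<open>R\<close> is spanned by the order reversing functions, and the
  divisorial power \<open>\<omega>\<^sup>(\<^sup>-\<^sup>n\<^sup>)\<close> of the canonical module by the set \<open>omega_neg n\<close> of functions with
  \<open>x u \<ge> x v - n\<close> for every cover \<open>u < v\<close>.

  With \<open>q = p ^ e\<close>, every \<open>p\<^sup>-\<^sup>e\<close>-linear map is a combination of the maps that send the monomial of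
  exponent \<open>m\<close> to that of exponent \<open>(m + a) / q\<close> (and to \<open>0\<close> if this is not integral), where \<open>a\<close>
  ranges over \<open>omega_neg (q - 1)\<close>. Multiplication by ring elements adds exponents of \<open>R\<close> to \<open>a\<close>, and
  the composite of the maps of \<open>b\<close> and \<open>c\<close> is the map of \<open>p ^ j * b + c\<close> if \<open>c\<close> belongs to degree \<open>j\<close>.
  So \<open>c\<^sub>e\<close> counts the minimal generators \<open>a\<close> of \<open>omega_neg (q - 1)\<close> that are not of the form
  \<open>p ^ i * b + c\<close> with \<open>b\<close> and \<open>c\<close> of lower degrees; this is used through the two estimates
  \<open>complexity_upper\<close> and \<open>complexity_lower\<close>.

  If \<open>R\<close> is \<open>\<omega>\<^sup>(\<^sup>-\<^sup>1\<^sup>)\<close>-level, all minimal generators of \<open>omega_neg n\<close> have the least possible degree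
  \<open>-n\<close> times the length of a shortest chain from bottom to top, because division with remainder
  writes each element of \<open>omega_neg n\<close> as a sum of \<open>n\<close> elements of \<open>omega_neg 1\<close>. The value of such a
  generator at an element of a shortest maximal chain is forced, while each of the remaining \<open>N\<close>
  elements of \<open>P\<close> has \<open>O(n)\<close> possible values. Hence \<open>c\<^sub>e = O(q ^ N)\<close>, which bounds the complexity by
  \<open>N\<close> for every \<open>p\<close>.

  For the lower bound consider generators \<open>a\<close> of degree \<open>q - 1\<close> whose base \<open>p\<close> digits, at every
  position below the leading one, increase along the order on the free elements. In a decomposition
  \<open>a = p ^ i * b + c\<close> the summand \<open>c\<close> rises by at most \<open>p ^ i - 1\<close> at each cover, and since its residues
  modulo \<open>p ^ i\<close> increase along a chain of free elements, its quotients by \<open>p ^ i\<close> cannot grow on such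
  a chain. Between forced elements \<open>u\<close> and \<open>w\<close> with a free element in between, however, levelness makes
  \<open>c\<close> rise by at least \<open>2 * (p ^ i - 1)\<close>. So no such \<open>a\<close> decomposes. There are at least
  \<open>s ^ (N * (e - 1))\<close> of them with \<open>s\<close> about \<open>p\<close> divided by a constant, and the complexity is at least
  \<open>N * ln s / ln p\<close>, which tends to \<open>N\<close>.
\<close>

section \<open>Exponents of the divisorial powers of the canonical module\<close>

locale bounded_poset =
  fixes H :: "'h set" and le :: "'h \<Rightarrow> 'h \<Rightarrow> bool" (infix "\<unlhd>" 50) and bot top :: 'h
  assumes finite_H: "finite H"
    and le_in: "x \<unlhd> y \<Longrightarrow> x \<in> H \<and> y \<in> H"
    and le_refl: "x \<in> H \<Longrightarrow> x \<unlhd> x"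
    and le_antisym: "x \<unlhd> y \<Longrightarrow> y \<unlhd> x \<Longrightarrow> x = y"
    and le_trans: "x \<unlhd> y \<Longrightarrow> y \<unlhd> z \<Longrightarrow> x \<unlhd> z"
    and bot_le: "x \<in> H \<Longrightarrow> bot \<unlhd> x"
    and le_top: "x \<in> H \<Longrightarrow> x \<unlhd> top"
    and bot_in: "bot \<in> H" and top_in: "top \<in> H" and bot_neq_top: "bot \<noteq> top"
begin

definition cov :: "('h \<times> 'h) set" where
  "cov = {(u, v). u \<unlhd> v \<and> u \<noteq> v \<and> (\<forall>z. u \<unlhd> z \<and> z \<unlhd> v \<longrightarrow> z = u \<or> z = v)}"

definition height :: "'h \<Rightarrow> nat" where "height x = card {y. y \<unlhd> x}"

lemma finite_down: "finite {y. y \<unlhd> x}"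
  using finite_H le_in by (metis (no_types, lifting) finite_subset mem_Collect_eq subsetI)

lemma height_less: "u \<unlhd> v \<Longrightarrow> u \<noteq> v \<Longrightarrow> height u < height v"
proof -
  assume uv: "u \<unlhd> v" "u \<noteq> v"
  have "v \<in> {y. y \<unlhd> v}" "v \<notin> {y. y \<unlhd> u}" using uv le_antisym le_refl le_in by auto
  moreover have "{y. y \<unlhd> u} \<subseteq> {y. y \<unlhd> v}" using uv le_trans by auto
  ultimately have "{y. y \<unlhd> u} \<subset> {y. y \<unlhd> v}" by blast
  then show ?thesis unfolding height_def by (intro psubset_card_mono finite_down)
qed

lemma height_le_card: "height x \<le> card H"
  unfolding height_def using le_in finite_H by (intro card_mono) auto

lemma height_pos: "x \<in> H \<Longrightarrow> 1 \<le> height x"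
  unfolding height_def using le_refl finite_down[of x] card_gt_0_iff[of "{y. y \<unlhd> x}"] by fastforce

lemma covD: "(u, v) \<in> cov \<Longrightarrow> u \<unlhd> v \<and> u \<noteq> v \<and> u \<in> H \<and> v \<in> H"
  unfolding cov_def using le_in by auto

lemma upper_cover: assumes "u \<unlhd> v" "u \<noteq> v" shows "\<exists>w. (u, w) \<in> cov \<and> w \<unlhd> v"
proof -
  let ?Z = "{w. u \<unlhd> w \<and> u \<noteq> w \<and> w \<unlhd> v}"
  have "v \<in> ?Z" using assms le_in le_refl by auto
  then obtain w where w: "w \<in> ?Z" "\<forall>y. y \<in> ?Z \<longrightarrow> height w \<le> height y"
    using ex_has_least_nat[of "\<lambda>w. w \<in> ?Z" v height] by blast
  have "(u, w) \<in> cov" unfolding cov_def using w le_trans height_less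
    by (smt (verit) case_prodI linorder_not_less mem_Collect_eq)
  then show ?thesis using w by auto
qed

lemma lower_cover: assumes "u \<unlhd> v" "u \<noteq> v" shows "\<exists>w. u \<unlhd> w \<and> (w, v) \<in> cov"
proof -
  let ?Z = "{w. u \<unlhd> w \<and> w \<noteq> v \<and> w \<unlhd> v}"
  have "u \<in> ?Z" using assms le_in le_refl by auto
  moreover have "\<forall>y. y \<in> ?Z \<longrightarrow> height y \<le> card H" using height_le_card by auto
  ultimately obtain w where w: "w \<in> ?Z" "\<forall>y. y \<in> ?Z \<longrightarrow> height y \<le> height w"
    using Lattices_Big.ex_has_greatest_nat[of "\<lambda>w. w \<in> ?Z" u height "Suc (card H)"]
    by (metis (no_types, lifting) less_Suc_eq_le)
  have "(w, v) \<in> cov" unfolding cov_def using w le_trans height_less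
    by (smt (verit) case_prodI linorder_not_less mem_Collect_eq)
  then show ?thesis using w by auto
qed

lemma path_height: "(u, v) \<in> cov ^^ k \<Longrightarrow> height u + k \<le> height v"
proof (induction k arbitrary: v)
  case (Suc k)
  then obtain y where "(u, y) \<in> cov ^^ k" "(y, v) \<in> cov" by auto
  with Suc.IH[of y] covD[of y v] height_less[of y v] show ?case by auto
qed simp

lemma le_path: "u \<unlhd> v \<Longrightarrow> \<exists>k. (u, v) \<in> cov ^^ k"
proof (induction "height v" arbitrary: v rule: less_induct)
  case less
  show ?case
  proof (cases "u = v")
    case True
    then have "(u, v) \<in> cov ^^ 0" by simp
    then show ?thesis by blast
  next
    case False
    then obtain w where w: "u \<unlhd> w" "(w, v) \<in> cov" using lower_cover less by blast
    then obtain k where "(u, w) \<in> cov ^^ k" using less(1)[of w] covD height_less by blast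
    then have "(u, v) \<in> cov ^^ Suc k" using w by auto
    then show ?thesis by blast
  qed
qed

text \<open>The exponents of \<open>\<omega>\<^sup>(\<^sup>-\<^sup>n\<^sup>)\<close>: every facet functional
  \<open>x u - x v\<close> of a cover is at least \<open>-n\<close>. The case \<open>n = 0\<close>
  gives the ring and \<open>n = -1\<close> its canonical module.\<close>
definition omega_neg :: "int \<Rightarrow> ('h \<Rightarrow> int) set" where
  "omega_neg n = {x. x top = 0 \<and> (\<forall>h. h \<notin> H \<longrightarrow> x h = 0) \<and> (\<forall>u v. (u, v) \<in> cov \<longrightarrow> x v - n \<le> x u)}"

definition dist_top :: "'h \<Rightarrow> nat" where "dist_top v = (LEAST k. (v, top) \<in> cov ^^ k)"
definition dist_bot :: "'h \<Rightarrow> nat" where "dist_bot v = (LEAST k. (bot, v) \<in> cov ^^ k)"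

text \<open>The number of covers in a shortest saturated chain from bottom to top, one more than the
  cardinality of a shortest maximal chain of \<open>P\<close>.\<close>
definition rank :: int where "rank = int (dist_top bot)"
definition lo :: "'h \<Rightarrow> int" where "lo v = (if v \<in> H then - int (dist_top v) else 0)"

text \<open>On elements of \<open>omega_neg 1\<close> of least degree, the value at \<open>v\<close> lies
  between \<open>lo v\<close> and \<open>up v\<close>; walking down from the top gives the one
  bound, walking up from the bottom the other.\<close>
definition up :: "'h \<Rightarrow> int" where "up v = int (dist_bot v) - rank"
definition forced :: "'h set" where
  "forced = {v \<in> H. dist_bot v + dist_top v = dist_top bot}"
definition free :: "'h set" where "free = H - forced"

text \<open>The elements of least degree: along a shortest chain the value at the bottom cannot be below
  \<open>-n * rank\<close>.\<close>
definition min_gens :: "int \<Rightarrow> ('h \<Rightarrow> int) set" where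
  "min_gens n = {x \<in> omega_neg n. x bot = - n * rank}"

lemma dist_top_path: "v \<in> H \<Longrightarrow> (v, top) \<in> cov ^^ dist_top v"
  unfolding dist_top_def using le_path[OF le_top] by (meson LeastI_ex)
lemma dist_bot_path: "v \<in> H \<Longrightarrow> (bot, v) \<in> cov ^^ dist_bot v"
  unfolding dist_bot_def using le_path[OF bot_le] by (meson LeastI_ex)
lemma dist_top_le: "(v, top) \<in> cov ^^ k \<Longrightarrow> dist_top v \<le> k"
  unfolding dist_top_def by (rule Least_le)
lemma dist_bot_le: "(bot, v) \<in> cov ^^ k \<Longrightarrow> dist_bot v \<le> k"
  unfolding dist_bot_def by (rule Least_le)

lemma path_append: "(u, v) \<in> cov ^^ i \<Longrightarrow> (v, w) \<in> cov ^^ j \<Longrightarrow> (u, w) \<in> cov ^^ (i + j)"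
  by (metis relcomp.relcompI relpow_add)

lemma dist_sum: "v \<in> H \<Longrightarrow> dist_top bot \<le> dist_bot v + dist_top v"
  using dist_top_le path_append dist_top_path dist_bot_path by blast

lemma dist_top_le_card: "v \<in> H \<Longrightarrow> dist_top v \<le> card H"
  using path_height[OF dist_top_path] height_le_card[of top] by fastforce
lemma dist_bot_le_card: "v \<in> H \<Longrightarrow> dist_bot v \<le> card H"
  using path_height[OF dist_bot_path] height_le_card[of v] by fastforce

lemma dist_top_cov: "(u, v) \<in> cov \<Longrightarrow> dist_top u \<le> Suc (dist_top v)"
  by (meson covD dist_top_le dist_top_path relpow_Suc_I2)
lemma dist_bot_cov: "(u, v) \<in> cov \<Longrightarrow> dist_bot v \<le> Suc (dist_bot u)"
  by (meson covD dist_bot_le dist_bot_path relpow_Suc_I)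
lemma dist_top_top: "dist_top top = 0" using dist_top_le[of top 0] by simp
lemma dist_bot_bot: "dist_bot bot = 0" using dist_bot_le[of bot 0] by simp
lemma dist_bot_top: "dist_bot top = dist_top bot" unfolding dist_top_def dist_bot_def ..

lemma bot_forced: "bot \<in> forced" unfolding forced_def using bot_in dist_bot_bot by simp
lemma top_forced: "top \<in> forced" unfolding forced_def using top_in dist_top_top dist_bot_top by simp

lemma forced_up: "v \<in> forced \<Longrightarrow> up v = lo v"
  unfolding forced_def up_def lo_def rank_def by auto
lemma free_up: "v \<in> free \<Longrightarrow> lo v < up v"
  unfolding free_def forced_def up_def lo_def rank_def using dist_sum by fastforce
lemma lo_cov: "(u, v) \<in> cov \<Longrightarrow> lo v - 1 \<le> lo u"
  unfolding lo_def using covD dist_top_cov by fastforce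
lemma up_cov: "(u, v) \<in> cov \<Longrightarrow> up v - 1 \<le> up u"
  unfolding up_def using dist_bot_cov by fastforce
lemma lo_nonpos: "lo v \<le> 0" unfolding lo_def by simp
lemma lo_neg: "v \<in> H \<Longrightarrow> v \<noteq> top \<Longrightarrow> lo v \<le> -1"
  unfolding lo_def using dist_top_path[of v] by (cases "dist_top v") auto
lemma lo_ge: "- int (card H) \<le> lo v" unfolding lo_def using dist_top_le_card by simp
lemma lo_top: "lo top = 0" unfolding lo_def using dist_top_top by simp
lemma lo_bot: "lo bot = - rank" unfolding lo_def rank_def using bot_in by simp

lemma lo_mult_mem: "0 \<le> n \<Longrightarrow> (\<lambda>v. n * lo v) \<in> min_gens n"
proof -
  assume n: "0 \<le> n"
  have "n * lo v - n \<le> n * lo u" if "(u, v) \<in> cov" for u v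
    using mult_left_mono[OF lo_cov[OF that] n] by (simp add: algebra_simps)
  then show ?thesis unfolding min_gens_def omega_neg_def using lo_top lo_bot by (auto simp: lo_def)
qed

lemma omega_neg_path:
  assumes "x \<in> omega_neg n" "(u, v) \<in> cov ^^ k" shows "x v - n * int k \<le> x u"
  using assms(2)
proof (induction k arbitrary: v)
  case (Suc k)
  then obtain y where "(u, y) \<in> cov ^^ k" "(y, v) \<in> cov" by auto
  with Suc.IH[of y] assms(1) show ?case unfolding omega_neg_def by (fastforce simp: algebra_simps)
qed simp

lemma omega_neg_lo: assumes "x \<in> omega_neg n" "v \<in> H" shows "n * lo v \<le> x v"
  using omega_neg_path[OF assms(1) dist_top_path[OF assms(2)]] assms
  unfolding omega_neg_def lo_def by auto

lemma min_gens_up: assumes "x \<in> min_gens n" "v \<in> H" shows "x v \<le> n * up v"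
  using omega_neg_path[OF _ dist_bot_path[OF assms(2)], of x n] assms
  unfolding min_gens_def up_def by (auto simp: algebra_simps)

lemma min_gens_forced: "x \<in> min_gens n \<Longrightarrow> v \<in> forced \<Longrightarrow> x v = n * lo v"
  using min_gens_up[of x n v] omega_neg_lo[of x n v] forced_up[of v]
  unfolding min_gens_def forced_def by auto

lemma omega_neg_0_mono: "x \<in> omega_neg 0 \<Longrightarrow> u \<unlhd> v \<Longrightarrow> x v \<le> x u"
  using le_path[of u v] omega_neg_path[of x 0 u v] by auto

lemma omega_neg_0_nonneg: "x \<in> omega_neg 0 \<Longrightarrow> 0 \<le> x h"
  using omega_neg_0_mono[of x h top] le_top[of h] unfolding omega_neg_def by force

lemma omega_neg_add: "x \<in> omega_neg m \<Longrightarrow> y \<in> omega_neg n \<Longrightarrow> (\<lambda>h. x h + y h) \<in> omega_neg (m + n)"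
  unfolding omega_neg_def by fastforce

lemma omega_neg_0_bot: assumes "s \<in> omega_neg 0" "s bot = 0" shows "s = (\<lambda>_. 0)"
proof
  fix h show "s h = 0"
    using assms omega_neg_0_mono[of s bot h] omega_neg_0_nonneg[of s h] bot_le[of h]
    unfolding omega_neg_def by force
qed

text \<open>An element of least degree is a minimal generator over the ring, because an order reversing
  function that vanishes at the bottom is zero.\<close>
lemma min_gens_minimal:
  assumes "a \<in> min_gens n" "b \<in> omega_neg n" "s \<in> omega_neg 0" "\<And>h. a h = b h + s h"
  shows "s = (\<lambda>_. 0)"
proof (rule omega_neg_0_bot[OF assms(3)])
  have "n * lo bot \<le> b bot" by (rule omega_neg_lo[OF assms(2) bot_in])
  then show "s bot = 0" using assms(4)[of bot] assms(1) lo_bot omega_neg_0_nonneg[OF assms(3), of bot]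
    unfolding min_gens_def by auto
qed

text \<open>The combinatorial content of levelness: \<open>\<omega>\<^sup>(\<^sup>-\<^sup>1\<^sup>)\<close>
  is generated by its elements of least degree. No other degree can occur, since those elements
  are minimal generators.\<close>
definition level :: bool where
  "level \<longleftrightarrow> (\<forall>a\<in>omega_neg 1. \<exists>b\<in>min_gens 1. \<exists>s\<in>omega_neg 0. \<forall>h. a h = b h + s h)"

text \<open>After division by \<open>n + 1\<close> and rounding down the rise at a cover is at most
  \<open>1\<close>. The rest is in \<open>omega_neg n\<close>, because the remainder does not
  increase at a cover where the quotient rises.\<close>
lemma omega_neg_split:
  assumes "a \<in> omega_neg (int (Suc n))"
  shows "\<exists>b\<in>omega_neg (int n). \<exists>c\<in>omega_neg 1. \<forall>h. a h = b h + c h"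
proof -
  define N where "N = int (Suc n)"
  have N: "N > 0" "int n = N - 1" unfolding N_def by auto
  define c where "c h = a h div N" for h
  define b where "b h = a h - c h" for h
  have dm: "a h = N * c h + a h mod N" "0 \<le> a h mod N" "a h mod N < N" for h
    using N unfolding c_def by auto
  have c: "c v - 1 \<le> c u" "b v - int n \<le> b u" if "(u, v) \<in> cov" for u v
  proof -
    have *: "a v - N \<le> a u" using assms that unfolding omega_neg_def N_def by auto
    then have "(a v - N) div N \<le> a u div N" by (rule zdiv_mono1[OF _ N(1)])
    moreover have "(a v - N) div N = a v div N - 1" using N(1) div_add_self2[of N "a v - N"] by auto
    ultimately show c1: "c v - 1 \<le> c u" unfolding c_def by simp
    consider "c u \<ge> c v + 1" | "c u = c v" | "c u = c v - 1" using c1 by linarith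
    then show "b v - int n \<le> b u"
    proof cases
      case 1
      then have "(N - 1) * (c v + 1) \<le> (N - 1) * c u" using N by (intro mult_left_mono) auto
      then have "N * c v - c v + N - 1 \<le> N * c u - c u" by (simp add: algebra_simps)
      then show ?thesis unfolding b_def N using dm[of u] dm[of v] N(1) by linarith
    next
      case 2 
      then have "N * c u = N * c v" by simp
      then show ?thesis unfolding b_def N using dm[of u] dm[of v] 2 by linarith
    next
      case 3 
      have "N * c u = N * c v - N" unfolding 3 by (simp add: algebra_simps)
      then show ?thesis unfolding b_def N using dm[of u] dm[of v] 3 * by linarith
    qed
  qed
  have "b \<in> omega_neg (int n)" "c \<in> omega_neg 1"
    using c assms unfolding omega_neg_def by (auto simp: b_def c_def)
  then show ?thesis unfolding b_def by force
qed

lemma min_gens_add: "x \<in> min_gens m \<Longrightarrow> y \<in> min_gens n \<Longrightarrow> (\<lambda>h. x h + y h) \<in> min_gens (m + n)"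
  unfolding min_gens_def using omega_neg_add by (auto simp: algebra_simps)

lemma level_generates:
  assumes level "a \<in> omega_neg (int n)"
  shows "\<exists>b\<in>min_gens (int n). \<exists>s\<in>omega_neg 0. \<forall>h. a h = b h + s h"
  using assms(2)
proof (induction n arbitrary: a)
  case 0
  have "(\<lambda>_. 0) \<in> min_gens 0" unfolding min_gens_def omega_neg_def by auto
  then show ?case using 0 by force
next
  case (Suc n)
  obtain b c where bc: "b \<in> omega_neg (int n)" "c \<in> omega_neg 1" "\<forall>h. a h = b h + c h"
    using omega_neg_split[OF Suc.prems] by blast
  obtain b1 s1 where 1: "b1 \<in> min_gens (int n)" "s1 \<in> omega_neg 0" "\<forall>h. b h = b1 h + s1 h"
    using Suc.IH[OF bc(1)] by blast
  obtain b2 s2 where 2: "b2 \<in> min_gens 1" "s2 \<in> omega_neg 0" "\<forall>h. c h = b2 h + s2 h"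
    using assms(1) bc(2) unfolding level_def by blast
  have "(\<lambda>h. b1 h + b2 h) \<in> min_gens (int (Suc n))" using min_gens_add[OF 1(1) 2(1)] by (simp add: add.commute)
  moreover have "(\<lambda>h. s1 h + s2 h) \<in> omega_neg 0" using omega_neg_add[OF 1(2) 2(2)] by simp
  moreover have "\<forall>h. a h = (b1 h + b2 h) + (s1 h + s2 h)" using bc(3) 1(3) 2(3) by simp
  ultimately show ?case by (metis (no_types, lifting))
qed

text \<open>The function that is \<open>-2\<close> below \<open>u\<close>, \<open>0\<close> above
  \<open>w\<close> and \<open>-1\<close> on the elements that are neither lies in \<open>omega_neg
  1\<close>: a cover cannot jump by \<open>2\<close>, since \<open>v\<close> would lie strictly
  inside it. By levelness it is an order reversing function added to an element of least degree,
  and the latter has the values \<open>lo u\<close> and \<open>lo w\<close>.\<close>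
lemma level_gap:
  assumes level "u \<in> forced" "w \<in> forced" "u \<unlhd> v" "v \<unlhd> w" "v \<noteq> u" "v \<noteq> w"
  shows "lo u + 2 \<le> lo w"
proof -
  define a :: "'h \<Rightarrow> int" where
    "a z = (if z \<in> H then (if z \<unlhd> u then 0 else 1) + (if w \<unlhd> z then 1 else 0) - 2 else 0)" for z
  have wu: "\<not> w \<unlhd> u" using assms le_trans le_antisym by blast
  have uw: "u \<in> H" "w \<in> H" using assms le_in by auto
  have "\<not> top \<unlhd> u" using wu le_trans[of w top u] le_top[OF uw(2)] by blast
  then have top: "a top = 0" unfolding a_def using top_in le_top uw by simp
  have "a y - 1 \<le> a x" if "(x, y) \<in> cov" for x y
  proof -
    have xy: "x \<unlhd> y" "x \<in> H" "y \<in> H" using covD that by auto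
    have "\<not> (x \<unlhd> u \<and> w \<unlhd> y)"
    proof
      assume "x \<unlhd> u \<and> w \<unlhd> y"
      then have "x \<unlhd> v" "v \<unlhd> y" using assms le_trans by blast+
      then have "v = x \<or> v = y" using that unfolding cov_def by auto
      then show False using \<open>x \<unlhd> u \<and> w \<unlhd> y\<close> assms le_antisym by blast
    qed
    moreover have "x \<unlhd> u" if "y \<unlhd> u" using that xy le_trans by blast
    moreover have "w \<unlhd> y" if "w \<unlhd> x" using that xy le_trans by blast
    ultimately show ?thesis unfolding a_def using xy by auto
  qed
  then have "a \<in> omega_neg 1" unfolding omega_neg_def using top by (auto simp: a_def)
  then obtain b s where bs: "b \<in> min_gens 1" "s \<in> omega_neg 0" "\<forall>h. a h = b h + s h"
    using assms(1) unfolding level_def by blast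
  have "s w \<le> s u" using omega_neg_0_mono[OF bs(2)] assms le_trans by blast
  moreover have "b u = lo u" "b w = lo w" using min_gens_forced[OF bs(1)] assms by auto
  moreover have "a u = -2" "a w = 0" unfolding a_def using uw wu le_refl by auto
  ultimately show ?thesis using bs(3) by (smt (verit))
qed

text \<open>Only the values on the free elements are undetermined, and each of them is bounded by \<open>n *
  card H\<close> in absolute value.\<close>
lemma min_gens_card:
  assumes "0 \<le> n"
  shows "finite (min_gens n)" "card (min_gens n) \<le> nat (2 * n * int (card H) + 1) ^ card free"
proof -
  let ?I = "{- n * int (card H) .. n * int (card H)}"
  let ?f = "\<lambda>x. restrict x free"
  have inj: "inj_on ?f (min_gens n)"
  proof (rule inj_onI, rule ext)
    fix x y h assume xy: "x \<in> min_gens n" "y \<in> min_gens n" "?f x = ?f y"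
    show "x h = y h"
    proof (cases "h \<in> free")
      case True then show ?thesis using xy(3) by (metis restrict_apply')
    next
      case False
      then show ?thesis using xy(1,2) min_gens_forced[OF xy(1), of h] min_gens_forced[OF xy(2), of h]
        unfolding free_def by (cases "h \<in> H") (auto simp: min_gens_def omega_neg_def)
    qed
  qed
  have bd: "x h \<in> ?I" if "x \<in> min_gens n" "h \<in> H" for x h
  proof -
    have "n * lo h \<le> x h" using omega_neg_lo that unfolding min_gens_def by auto
    moreover have "x h \<le> n * up h" using min_gens_up that by auto
    moreover have "n * (- int (card H)) \<le> n * lo h" using lo_ge assms by (intro mult_left_mono) auto
    moreover have "n * up h \<le> n * int (card H)"
      using dist_bot_le_card[OF that(2)] assms unfolding up_def rank_def by (intro mult_left_mono) auto
    ultimately show ?thesis by auto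
  qed
  have "free \<subseteq> H" unfolding free_def by auto
  then have sub: "?f ` min_gens n \<subseteq> free \<rightarrow>\<^sub>E ?I" using bd by (intro image_subsetI) (simp add: PiE_def Pi_def subset_iff)
  have fin: "finite free" unfolding free_def using finite_H by auto
  have finE: "finite (free \<rightarrow>\<^sub>E ?I)" using fin by (intro finite_PiE) auto
  show "finite (min_gens n)" using finite_imageD[OF finite_subset[OF sub finE] inj] .
  have "card (min_gens n) = card (?f ` min_gens n)" using card_image[OF inj] by simp
  also have "\<dots> \<le> card (free \<rightarrow>\<^sub>E ?I)" by (rule card_mono[OF finE sub])
  also have "\<dots> = nat (2 * n * int (card H) + 1) ^ card free" using fin by (simp add: card_PiE algebra_simps)
  finally show "card (min_gens n) \<le> nat (2 * n * int (card H) + 1) ^ card free" .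
qed

end

section \<open>Facets, duality and saturated chains\<close>

context bounded_poset begin

text \<open>The height function of the poset with the cover \<open>u < v\<close> contracted. It is constant
  on this cover and increases on all others, so its negative lies in the relative interior of the
  facet.\<close>
definition facet_height :: "'h \<Rightarrow> 'h \<Rightarrow> 'h \<Rightarrow> int" where
  "facet_height u v x = int (card {y. y \<unlhd> x \<or> u \<unlhd> x \<and> y \<unlhd> v})"

lemma facet_height_eq:
  assumes "(u, v) \<in> cov" shows "facet_height u v u = facet_height u v v"
proof -
  have "{y. y \<unlhd> u \<or> u \<unlhd> u \<and> y \<unlhd> v} = {y. y \<unlhd> v}" using covD[OF assms] le_refl le_trans by blast
  moreover have "{y. y \<unlhd> v \<or> u \<unlhd> v \<and> y \<unlhd> v} = {y. y \<unlhd> v}" by blast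
  ultimately show ?thesis unfolding facet_height_def by simp
qed

text \<open>The down-set grows strictly from \<open>x\<close> to \<open>y\<close>, because otherwise
  \<open>u \<le> x < y \<le> v\<close>, and \<open>u < v\<close> is a cover.\<close>
lemma facet_height_less:
  assumes "(u, v) \<in> cov" "(x, y) \<in> cov" "(x, y) \<noteq> (u, v)"
  shows "facet_height u v x + 1 \<le> facet_height u v y"
proof -
  let ?D = "\<lambda>x. {y. y \<unlhd> x \<or> u \<unlhd> x \<and> y \<unlhd> v}"
  have xy: "x \<unlhd> y" "x \<noteq> y" "y \<in> H" using covD assms by auto
  have "y \<notin> ?D x"
  proof
    assume "y \<in> ?D x"
    then have "u \<unlhd> x" "y \<unlhd> v" using xy le_antisym by blast+
    then have "u \<unlhd> y" "x \<unlhd> v" using xy le_trans by blast+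
    then have "x = u \<or> x = v" "y = u \<or> y = v" using assms(1) \<open>u \<unlhd> x\<close> \<open>y \<unlhd> v\<close> unfolding cov_def by auto
    then show False using xy assms covD le_antisym by blast
  qed
  moreover have "?D x \<subseteq> ?D y" using xy le_trans by blast
  moreover have "y \<in> ?D y" using xy le_refl by blast
  moreover have "finite (?D y)" using finite_down[of y] finite_down[of v]
    by (intro finite_subset[of "?D y" "{z. z \<unlhd> y} \<union> {z. z \<unlhd> v}"]) auto
  ultimately show ?thesis unfolding facet_height_def by (smt (verit) psubset_card_mono psubset_eq of_nat_less_iff)
qed

text \<open>A large multiple of a point in the interior of the facet, corrected by the indicator of the
  elements above \<open>v\<close>. The vectors obtained from this for \<open>d = 1\<close> and
  \<open>d = -1\<close> detect the facet of the cover \<open>u < v\<close>.\<close>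
lemma ex_slopes:
  fixes K d :: int
  assumes "(u, v) \<in> cov" "0 \<le> K"
  shows "\<exists>x. x top = 0 \<and> (\<forall>h. h \<notin> H \<longrightarrow> x h = 0) \<and> x u = x v + d \<and>
     (\<forall>y z. (y, z) \<in> cov \<longrightarrow> (y, z) \<noteq> (u, v) \<longrightarrow> x z + K \<le> x y)"
proof -
  define M where "M = K + \<bar>d\<bar>"
  define g where "g x = M * facet_height u v x + (if v \<unlhd> x then d else 0)" for x
  define x where "x h = (if h \<in> H then g top - g h else 0)" for h
  have uv: "\<not> v \<unlhd> u" "v \<unlhd> v" "u \<in> H" "v \<in> H" using covD[OF assms(1)] le_antisym le_refl by auto
  have "x z + K \<le> x y" if yz: "(y, z) \<in> cov" "(y, z) \<noteq> (u, v)" for y z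
  proof -
    have "M * (facet_height u v y + 1) \<le> M * facet_height u v z"
      using facet_height_less[OF assms(1) yz] assms(2) unfolding M_def by (intro mult_left_mono) auto
    moreover have "v \<unlhd> y \<Longrightarrow> v \<unlhd> z" using covD[OF yz(1)] le_trans by blast
    ultimately have "g y + K \<le> g z" unfolding g_def using M_def by (auto simp: algebra_simps)
    then show ?thesis unfolding x_def using covD[OF yz(1)] by auto
  qed
  moreover have "x u = x v + d" unfolding x_def g_def using uv facet_height_eq[OF assms(1)] by simp
  moreover have "x top = 0" unfolding x_def by simp
  ultimately show ?thesis unfolding x_def by (intro exI[of _ x]) (auto simp: x_def)
qed

definition lattice :: "('h \<Rightarrow> int) set" where
  "lattice = {x. x top = 0 \<and> (\<forall>h. h \<notin> H \<longrightarrow> x h = 0)}"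
definition interior_vecs :: "('h \<Rightarrow> int) set" where "interior_vecs = omega_neg (-1)"

lemma ex_cov: "\<exists>u v. (u, v) \<in> cov"
  using upper_cover[OF bot_le[OF top_in] bot_neq_top] by blast

lemma ex_steep: assumes "0 \<le> K"
  shows "\<exists>x\<in>lattice. \<forall>y z. (y, z) \<in> cov \<longrightarrow> x z + K \<le> x y"
proof -
  obtain u v where uv: "(u, v) \<in> cov" using ex_cov by blast
  obtain x where x: "x top = 0" "\<forall>h. h \<notin> H \<longrightarrow> x h = 0" "x u = x v + K"
    "\<And>y z. (y, z) \<in> cov \<Longrightarrow> (y, z) \<noteq> (u, v) \<Longrightarrow> x z + K \<le> x y"
    using ex_slopes[OF uv assms, of K] by blast
  have "x z + K \<le> x y" if "(y, z) \<in> cov" for y z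
    using x(3) x(4)[OF that] by (cases "(y, z) = (u, v)") auto
  then show ?thesis using x(1,2) unfolding lattice_def by blast
qed

lemma cov_finite: "finite cov"
  by (rule finite_subset[of _ "H \<times> H"]) (use finite_H covD in auto)

lemma bounded_on_covers: "\<exists>K::int. 0 \<le> K \<and> (\<forall>u v. (u, v) \<in> cov \<longrightarrow> \<bar>x u - x v\<bar> \<le> K)"
proof -
  let ?S = "(\<lambda>(u, v). \<bar>x u - x v :: int\<bar>) ` cov"
  have "finite ?S" using cov_finite by simp
  have "\<bar>x u - x v\<bar> \<le> Max ?S" if "(u, v) \<in> cov" for u v
    using Max_ge[OF \<open>finite ?S\<close>] that by force
  moreover have "0 \<le> Max ?S" using calculation ex_cov abs_ge_zero order_trans by blast
  ultimately show ?thesis by blast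
qed

text \<open>Adding a sufficiently steep function makes every integer function order reversing, so the
  exponents of the ring generate the whole lattice.\<close>
lemma lattice_diff: assumes "x \<in> lattice"
  shows "\<exists>s\<in>omega_neg 0. \<exists>t\<in>omega_neg 0. \<forall>h. x h = s h - t h"
proof -
  obtain K where K: "0 \<le> K" "\<And>u v. (u, v) \<in> cov \<Longrightarrow> \<bar>x u - x v\<bar> \<le> K" using bounded_on_covers by blast
  obtain t where t: "t \<in> lattice" "\<And>y z. (y, z) \<in> cov \<Longrightarrow> t z + K \<le> t y" using ex_steep[OF K(1)] by blast
  have "t \<in> omega_neg 0" "(\<lambda>h. x h + t h) \<in> omega_neg 0"
    using t K assms unfolding omega_neg_def lattice_def by (fastforce)+
  then show ?thesis by force
qed

text \<open>The monomial map of exponent \<open>a\<close> has to send the ring into itself. If the facet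
  functional of a cover is at most \<open>-q\<close> on \<open>a\<close>, a vector with value
  \<open>-1\<close> on this facet and large values on all others is a quotient \<open>(m + a) /
  q\<close> outside the ring.\<close>
lemma frobenius_support:
  assumes "a \<in> lattice" "1 \<le> q"
  shows "a \<in> omega_neg (q - 1) \<longleftrightarrow>
     (\<forall>m\<in>omega_neg 0. \<forall>n\<in>lattice. (\<forall>h. q * n h = m h + a h) \<longrightarrow> n \<in> omega_neg 0)" (is "_ \<longleftrightarrow> ?R")
proof
  assume a: "a \<in> omega_neg (q - 1)"
  show ?R
  proof (intro ballI impI)
    fix m n assume mn: "m \<in> omega_neg 0" "n \<in> lattice" "\<forall>h. q * n h = m h + a h"
    have "n v \<le> n u" if "(u, v) \<in> cov" for u v
    proof (rule ccontr)
      assume "\<not> n v \<le> n u"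
      then have "q * (n u + 1) \<le> q * n v" using assms(2) by (intro mult_left_mono) auto
      moreover have "m v \<le> m u" "a v - (q - 1) \<le> a u" using mn(1) a that unfolding omega_neg_def by auto
      ultimately show False using mn(3) by (auto simp: algebra_simps)
    qed
    then show "n \<in> omega_neg 0" using mn(2) unfolding omega_neg_def lattice_def by auto
  qed
next
  assume R: ?R
  show "a \<in> omega_neg (q - 1)"
  proof (rule ccontr)
    assume "a \<notin> omega_neg (q - 1)"
    then obtain u v where uv: "(u, v) \<in> cov" "a u - a v \<le> - q"
      using assms(1) unfolding omega_neg_def lattice_def by force
    obtain K where K: "0 \<le> K" "\<And>u v. (u, v) \<in> cov \<Longrightarrow> \<bar>a u - a v\<bar> \<le> K" using bounded_on_covers by blast
    obtain n where n: "n \<in> lattice" "n u = n v - 1"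
       "\<And>y z. (y, z) \<in> cov \<Longrightarrow> (y, z) \<noteq> (u, v) \<Longrightarrow> n z + K \<le> n y"
      using ex_slopes[OF uv(1) K(1), of "-1"] unfolding lattice_def by auto
    define m where "m h = q * n h - a h" for h
    have "m z \<le> m y" if "(y, z) \<in> cov" for y z
    proof (cases "(y, z) = (u, v)")
      case True
      moreover have "q * n u = q * n v - q" unfolding n(2) by (simp add: algebra_simps)
      ultimately show ?thesis using uv(2) unfolding m_def by auto
    next
      case False
      have "1 * (n y - n z) \<le> q * (n y - n z)" using n(3)[OF that False] K assms(2) by (intro mult_right_mono) auto
      then show ?thesis using n(3)[OF that False] K(2)[OF that] unfolding m_def by (auto simp: algebra_simps)
    qed
    then have "m \<in> omega_neg 0" using n(1) assms(1) unfolding omega_neg_def lattice_def m_def by auto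
    then have "n \<in> omega_neg 0" using R n(1) unfolding m_def by auto
    then show False using uv n(2) unfolding omega_neg_def by force
  qed
qed

text \<open>The same duality for \<open>Hom(\<omega>, R)\<close>, tested on an interior vector with value
  \<open>1\<close> on the given facet.\<close>
lemma omega_inverse_support:
  assumes "a \<in> lattice"
  shows "a \<in> omega_neg 1 \<longleftrightarrow> (\<forall>w\<in>interior_vecs. (\<lambda>h. w h + a h) \<in> omega_neg 0)"
proof
  assume "a \<in> omega_neg 1" then show "\<forall>w\<in>interior_vecs. (\<lambda>h. w h + a h) \<in> omega_neg 0"
    unfolding interior_vecs_def using omega_neg_add by fastforce
next
  assume R: "\<forall>w\<in>interior_vecs. (\<lambda>h. w h + a h) \<in> omega_neg 0"
  have "a v - 1 \<le> a u" if uv: "(u, v) \<in> cov" for u v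
  proof -
    obtain w where w: "w \<in> lattice" "w u = w v + 1"
       "\<And>y z. (y, z) \<in> cov \<Longrightarrow> (y, z) \<noteq> (u, v) \<Longrightarrow> w z + 1 \<le> w y"
      using ex_slopes[OF uv, of 1 1] unfolding lattice_def by auto
    have "w \<in> interior_vecs" unfolding interior_vecs_def omega_neg_def using w unfolding lattice_def by fastforce
    then show ?thesis using R w(2) uv unfolding omega_neg_def by force
  qed
  then show "a \<in> omega_neg 1" using assms unfolding lattice_def omega_neg_def by auto
qed

text \<open>Chains from \<open>u\<close> to \<open>v\<close> that cannot be refined. With \<open>u =
  bot\<close> and \<open>v = top\<close> these are the maximal chains of the poset.\<close>
definition saturated :: "'h \<Rightarrow> 'h \<Rightarrow> 'h set \<Rightarrow> bool" where
  "saturated u v C \<longleftrightarrow> u \<in> C \<and> v \<in> C \<and> (\<forall>x\<in>C. u \<unlhd> x \<and> x \<unlhd> v) \<and> (\<forall>x\<in>C. \<forall>y\<in>C. x \<unlhd> y \<or> y \<unlhd> x) \<and>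
     (\<forall>z. u \<unlhd> z \<and> z \<unlhd> v \<and> (\<forall>x\<in>C. x \<unlhd> z \<or> z \<unlhd> x) \<longrightarrow> z \<in> C)"

lemma saturatedD:
  assumes "saturated u v C"
  shows "u \<in> C" "v \<in> C" "x \<in> C \<Longrightarrow> u \<unlhd> x" "x \<in> C \<Longrightarrow> x \<unlhd> v"
    "x \<in> C \<Longrightarrow> y \<in> C \<Longrightarrow> x \<unlhd> y \<or> y \<unlhd> x"
    "u \<unlhd> z \<Longrightarrow> z \<unlhd> v \<Longrightarrow> (\<And>x. x \<in> C \<Longrightarrow> x \<unlhd> z \<or> z \<unlhd> x) \<Longrightarrow> z \<in> C"
  using assms unfolding saturated_def by blast+

lemma saturated_subset: "saturated u v C \<Longrightarrow> C \<subseteq> H"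
  using saturatedD(3)[of u v C] le_in by (meson subsetI)

lemma saturated_finite: "saturated u v C \<Longrightarrow> finite C"
  by (rule finite_subset[OF saturated_subset finite_H])

lemma saturated_cov: assumes "(u, v) \<in> cov" shows "saturated u v {u, v}"
proof -
  have "\<forall>z. u \<unlhd> z \<and> z \<unlhd> v \<longrightarrow> z = u \<or> z = v" using assms unfolding cov_def by simp
  then show ?thesis unfolding saturated_def using covD[OF assms] le_refl[of u] le_refl[of v] by simp
qed

lemma saturated_join:
  assumes "saturated u w C" "saturated w v D"
  shows "saturated u v (C \<union> D)" "card (C \<union> D) + 1 = card C + card D"
proof -
  have le: "x \<unlhd> y" if "x \<in> C" "y \<in> D" for x y
    using saturatedD(4)[OF assms(1) that(1)] saturatedD(3)[OF assms(2) that(2)] by (rule le_trans)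
  note C = saturatedD[OF assms(1)] and D = saturatedD[OF assms(2)]
  have "x = w" if "x \<in> C" "x \<in> D" for x using le_antisym[OF C(4)[OF that(1)] D(3)[OF that(2)]] .
  then have "C \<inter> D = {w}" using C(2) D(1) by blast
  moreover have "finite C" "finite D" using assms saturated_finite by auto
  ultimately show "card (C \<union> D) + 1 = card C + card D" using card_Un_Int[of C D] by simp
  have uw: "u \<unlhd> w" "w \<unlhd> v" "w \<in> C" "w \<in> D" using C(2,3) D(1,4) by auto
  have "z \<in> C \<union> D" if z: "u \<unlhd> z" "z \<unlhd> v" "\<forall>x\<in>C \<union> D. x \<unlhd> z \<or> z \<unlhd> x" for z
  proof (cases "z \<unlhd> w")
    case True then show ?thesis using z C(6)[of z] by blast
  next
    case False
    then have "w \<unlhd> z" using z(3) uw by blast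
    then show ?thesis using z D(6)[of z] by blast
  qed
  moreover have "\<forall>x\<in>C \<union> D. u \<unlhd> x \<and> x \<unlhd> v" using C(3,4) D(3,4) uw le_trans by (metis UnE)
  moreover have "\<forall>x\<in>C \<union> D. \<forall>y\<in>C \<union> D. x \<unlhd> y \<or> y \<unlhd> x" using C(5) D(5) le by (metis UnE)
  ultimately show "saturated u v (C \<union> D)" using C(1) D(2) unfolding saturated_def by simp
qed

lemma path_saturated: assumes "u \<in> H" shows "(u, v) \<in> cov ^^ k \<Longrightarrow> \<exists>C. saturated u v C \<and> card C = Suc k"
proof (induction k arbitrary: v)
  case 0
  have "\<forall>z. u \<unlhd> z \<and> z \<unlhd> u \<and> (\<forall>x\<in>{u}. x \<unlhd> z \<or> z \<unlhd> x) \<longrightarrow> z \<in> {u}"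
    using le_antisym[of _ u] by (metis singletonI)
  moreover have "u = v" using 0 by simp
  ultimately have "saturated u v {u}" unfolding saturated_def using le_refl[OF assms] by simp
  then show ?case by (intro exI[of _ "{u}"]) simp
next
  case (Suc k)
  then obtain y where y: "(u, y) \<in> cov ^^ k" "(y, v) \<in> cov" by auto
  then obtain C where C: "saturated u y C" "card C = Suc k" using Suc.IH by blast
  have "card {y, v} = 2" using covD[OF y(2)] by simp
  then show ?case using saturated_join[OF C(1) saturated_cov[OF y(2)]] C(2)
    by (intro exI[of _ "C \<union> {y, v}"]) simp
qed

text \<open>Successive elements of a saturated chain form covers: an element strictly in between would be
  comparable with the whole chain.\<close>
lemma saturated_path:
  assumes "saturated a b C"
  shows "x \<in> C \<Longrightarrow> y \<in> C \<Longrightarrow> x \<unlhd> y \<Longrightarrow> (x, y) \<in> cov ^^ card {c \<in> C. x \<unlhd> c \<and> c \<unlhd> y \<and> c \<noteq> y}"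
proof (induction "height y" arbitrary: y rule: less_induct)
  case less
  have fin: "finite C" using assms saturated_finite by auto
  show ?case
  proof (cases "x = y")
    case True then have "{c \<in> C. x \<unlhd> c \<and> c \<unlhd> y \<and> c \<noteq> y} = {}" using le_antisym by blast
    then show ?thesis using True by (metis card.empty pair_in_Id_conv relpow.simps(1))
  next
    case False
    let ?Z = "\<lambda>c. c \<in> C \<and> c \<unlhd> y \<and> c \<noteq> y"
    have "?Z x" using less False by auto
    moreover have "\<forall>c. ?Z c \<longrightarrow> height c < Suc (card H)" using height_le_card less_Suc_eq_le by auto
    ultimately obtain z where z: "?Z z" "\<forall>c. ?Z c \<longrightarrow> height c \<le> height z"
      using Lattices_Big.ex_has_greatest_nat[of ?Z x height "Suc (card H)"] by blast
    have below: "c \<unlhd> z" if "?Z c" for c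
      using that z height_less[of z c] saturatedD(5)[OF assms, of c z] by (metis linorder_not_less)
    have zy: "(z, y) \<in> cov" unfolding cov_def
    proof (clarsimp, intro conjI allI impI)
      show "z \<unlhd> y" "z \<noteq> y" using z by auto
      fix d assume d: "z \<unlhd> d \<and> d \<unlhd> y"
      have "c \<unlhd> d \<or> d \<unlhd> c" if "c \<in> C" for c
      proof (cases "?Z c")
        case True then show ?thesis using below d le_trans by blast
      next
        case False
        then have "y \<unlhd> c" using that less.prems saturatedD(5)[OF assms, of c y] le_refl le_in by blast
        then show ?thesis using d le_trans by blast
      qed
      moreover have "a \<unlhd> d" "d \<unlhd> b"
        using saturatedD(3)[OF assms, of z] saturatedD(4)[OF assms, of y] d z less.prems le_trans by blast+
      ultimately have "d \<in> C" using saturatedD(6)[OF assms, of d] by blast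
      then show "d = z \<or> d = y" using d below le_antisym by blast
    qed
    have "(x, z) \<in> cov ^^ card {c \<in> C. x \<unlhd> c \<and> c \<unlhd> z \<and> c \<noteq> z}"
      using less(1)[of z] height_less z less below \<open>?Z x\<close> by blast
    then have "(x, y) \<in> cov ^^ Suc (card {c \<in> C. x \<unlhd> c \<and> c \<unlhd> z \<and> c \<noteq> z})" using zy by auto
    moreover have "{c \<in> C. x \<unlhd> c \<and> c \<unlhd> y \<and> c \<noteq> y} = insert z {c \<in> C. x \<unlhd> c \<and> c \<unlhd> z \<and> c \<noteq> z}"
      using below z \<open>?Z x\<close> le_trans le_antisym by blast
    ultimately show ?thesis using fin by simp
  qed
qed

lemma saturated_bot_top:
  assumes "saturated bot top C" "v \<in> C"
  shows "dist_bot v + dist_top v + 1 \<le> card C"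
proof -
  have fin: "finite C" and CH: "C \<subseteq> H" using assms saturated_finite saturated_subset by auto
  let ?A = "{c \<in> C. bot \<unlhd> c \<and> c \<unlhd> v \<and> c \<noteq> v}" and ?B = "{c \<in> C. v \<unlhd> c \<and> c \<unlhd> top \<and> c \<noteq> top}"
  have b: "bot \<in> C" "top \<in> C" using saturatedD[OF assms(1)] by auto
  have "dist_bot v \<le> card ?A" "dist_top v \<le> card ?B"
    using saturated_path[OF assms(1) b(1) assms(2)] saturated_path[OF assms(1) assms(2) b(2)]
      dist_bot_le dist_top_le bot_le le_top assms(2) CH by blast+
  moreover have "?A \<inter> ?B = {}" using le_antisym by blast
  then have "card ?A + card ?B = card (?A \<union> ?B)" using fin by (intro card_Un_disjoint[symmetric]) auto
  moreover have "card (?A \<union> ?B) < card C" using b fin CH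
    by (intro psubset_card_mono) (use le_top assms(2) le_antisym in blast)+
  ultimately show ?thesis by linarith
qed

lemma forced_saturated:
  assumes "v \<in> H"
  shows "\<exists>C. saturated bot top C \<and> v \<in> C \<and> card C = dist_bot v + dist_top v + 1"
proof -
  obtain C where C: "saturated bot v C" "card C = Suc (dist_bot v)"
    using path_saturated[OF bot_in dist_bot_path[OF assms]] by blast
  obtain D where D: "saturated v top D" "card D = Suc (dist_top v)"
    using path_saturated[OF assms dist_top_path[OF assms]] by blast
  have "v \<in> C" using saturatedD[OF C(1)] by simp
  then show ?thesis using saturated_join[OF C(1) D(1)] C(2) D(2) by (intro exI[of _ "C \<union> D"]) auto
qed

text \<open>Free elements are those outside all shortest maximal chains, because an element \<open>v\<close>
  lies on a saturated chain with \<open>dist_bot v + dist_top v\<close> covers, and on no shorter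
  one.\<close>
lemma free_iff:
  "v \<in> free \<longleftrightarrow> v \<in> H \<and> (\<forall>C. saturated bot top C \<and> (\<forall>D. saturated bot top D \<longrightarrow> card C \<le> card D) \<longrightarrow> v \<notin> C)"
proof -
  obtain C0 where C0: "saturated bot top C0" "card C0 = dist_top bot + 1"
    using forced_saturated[OF bot_in] dist_bot_bot by auto
  have min: "dist_top bot + 1 \<le> card D" if "saturated bot top D" for D
    using saturated_bot_top[OF that, of bot] saturatedD(1)[OF that] dist_bot_bot by auto
  have "v \<in> forced \<longleftrightarrow> (\<exists>C. saturated bot top C \<and> (\<forall>D. saturated bot top D \<longrightarrow> card C \<le> card D) \<and> v \<in> C)"
  proof
    assume v: "v \<in> forced"
    then obtain C where "saturated bot top C" "v \<in> C" "card C = dist_top bot + 1"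
      using forced_saturated[of v] unfolding forced_def by auto
    then show "\<exists>C. saturated bot top C \<and> (\<forall>D. saturated bot top D \<longrightarrow> card C \<le> card D) \<and> v \<in> C"
      using min by (intro exI[of _ C]) auto
  next
    assume "\<exists>C. saturated bot top C \<and> (\<forall>D. saturated bot top D \<longrightarrow> card C \<le> card D) \<and> v \<in> C"
    then obtain C where C: "saturated bot top C" "card C \<le> card C0" "v \<in> C" using C0 by blast
    then have "v \<in> H" using saturated_subset by blast
    then show "v \<in> forced" using saturated_bot_top[OF C(1,3)] C(2) C0(2) dist_sum[of v] unfolding forced_def by auto
  qed
  then show ?thesis unfolding free_def forced_def by auto
qed

end

section \<open>Exponents that do not decompose\<close>

text \<open>Numbers with \<open>J\<close> base \<open>p\<close> digits, all of them in the interval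
  \<open>[t * s, (t + 1) * s)\<close>. It is stated for the residues modulo \<open>p ^ i\<close>,
  which is the form needed to compare residues for different \<open>t\<close>.\<close>
definition band_digits :: "nat \<Rightarrow> nat \<Rightarrow> nat \<Rightarrow> nat \<Rightarrow> nat set" where
  "band_digits p s t J = {y. y < p ^ J \<and>
     (\<forall>i\<in>{1..J}. t * s * p ^ (i - 1) \<le> y mod p ^ i \<and> y mod p ^ i < (t + 1) * s * p ^ (i - 1))}"

lemma finite_band_digits: "finite (band_digits p s t J)"
  by (rule finite_subset[of _ "{..<p ^ J}"]) (auto simp: band_digits_def)

lemma card_band_digits:
  assumes "(t + 1) * s \<le> p" "0 < p"
  shows "s ^ J \<le> card (band_digits p s t J)"
proof (induction J)
  case 0
  have "band_digits p s t 0 = {0}" unfolding band_digits_def by auto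
  then show ?case by simp
next
  case (Suc J)
  let ?f = "\<lambda>(d, y). (t * s + d) * p ^ J + y"
  have inj: "inj_on ?f ({..<s} \<times> band_digits p s t J)"
  proof (rule inj_onI)
    fix a a' assume a: "a \<in> {..<s} \<times> band_digits p s t J" "a' \<in> {..<s} \<times> band_digits p s t J" "?f a = ?f a'"
    obtain d y d' y' where ay: "a = (d, y)" "a' = (d', y')" by fastforce
    have y: "y \<in> band_digits p s t J" "y' \<in> band_digits p s t J"
      and eq: "(t * s + d) * p ^ J + y = (t * s + d') * p ^ J + y'"
      using a unfolding ay by auto
    have lt: "y < p ^ J" "y' < p ^ J" using y unfolding band_digits_def by auto
    have "t * s + d = ((t * s + d) * p ^ J + y) div p ^ J" using lt assms(2) by simp
    also have "\<dots> = t * s + d'" unfolding eq using lt assms(2) by simp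
    finally show "a = a'" using eq ay by simp
  qed
  have sub: "?f ` ({..<s} \<times> band_digits p s t J) \<subseteq> band_digits p s t (Suc J)"
  proof
    fix x assume "x \<in> ?f ` ({..<s} \<times> band_digits p s t J)"
    then obtain d y where d: "d \<in> {..<s}" and y: "y \<in> band_digits p s t J" and x: "x = (t * s + d) * p ^ J + y"
      by auto
    let ?z = "(t * s + d) * p ^ J + y"
    have lt: "y < p ^ J" using y unfolding band_digits_def by auto
    have "?z < (t * s + d + 1) * p ^ J" using lt by simp
    also have "\<dots> \<le> (t + 1) * s * p ^ J" using d by (intro mult_right_mono) auto
    finally have z: "?z < (t + 1) * s * p ^ J" .
    also have "\<dots> \<le> p * p ^ J" using assms by (intro mult_right_mono) auto
    finally have zp: "?z < p ^ Suc J" by simp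
    have "t * s * p ^ (i - 1) \<le> ?z mod p ^ i \<and> ?z mod p ^ i < (t + 1) * s * p ^ (i - 1)"
      if i: "i \<in> {1..Suc J}" for i
    proof (cases "i = Suc J")
      case True
      then show ?thesis using z zp by (simp add: algebra_simps)
    next
      case False
      then have iJ: "i \<in> {1..J}" using i by auto
      then have "p ^ i dvd p ^ J" by (intro le_imp_power_dvd) auto
      then have "?z mod p ^ i = y mod p ^ i" by (metis dvd_mult mod_mult_self4 dvd_def mult.commute)
      then show ?thesis using y iJ unfolding band_digits_def by auto
    qed
    then show "x \<in> band_digits p s t (Suc J)" using zp x unfolding band_digits_def by blast
  qed
  have "s ^ Suc J \<le> s * card (band_digits p s t J)" using Suc.IH by simp
  also have "\<dots> = card (?f ` ({..<s} \<times> band_digits p s t J))"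
    using card_image[OF inj] by (simp add: card_cartesian_product)
  also have "\<dots> \<le> card (band_digits p s t (Suc J))" by (rule card_mono[OF finite_band_digits sub])
  finally show ?case .
qed

context bounded_poset begin

text \<open>The leading digit \<open>int k * (lo v + up v) - height v\<close> puts the point near the middle
  of the polytope of generators, \<open>k\<close> being about \<open>p / 2\<close>; the height is
  subtracted to make the inequalities strict on covers where both \<open>lo\<close> and
  \<open>up\<close> rise by \<open>1\<close>. The digits \<open>y v\<close> remain arbitrary.\<close>
definition witness :: "nat \<Rightarrow> nat \<Rightarrow> nat \<Rightarrow> ('h \<Rightarrow> nat) \<Rightarrow> 'h \<Rightarrow> int" where
  "witness p k J y v = (if v \<in> free
     then int p ^ J * (int k * (lo v + up v) - int (height v)) + int (y v)
     else (int p ^ Suc J - 1) * lo v)"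

lemma witness_mem:
  assumes p: "p = 2 * k + 1" and k: "2 * card H + 1 \<le> k"
    and y: "\<And>v. v \<in> free \<Longrightarrow> y v < p ^ J"
  shows "witness p k J y \<in> min_gens (int p ^ Suc J - 1)"
proof -
  define Q where "Q = int p ^ J"
  define n where "n = int p ^ Suc J - 1"
  define T where "T v = int k * (lo v + up v) - int (height v)" for v
  define c where "c = int (card H)"
  have Q: "1 \<le> Q" unfolding Q_def using p by simp
  have pk: "int p = 2 * int k + 1" using p by simp
  have kc: "2 * c + 1 \<le> int k" using k unfolding c_def by simp
  have n: "n = int p * Q - 1" "0 \<le> n" unfolding n_def Q_def using p by auto
  have x: "witness p k J y v = (if v \<in> free then Q * T v + int (y v) else n * lo v)" for v
    unfolding witness_def Q_def n_def T_def by simp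
  have yQ: "int (y v) \<le> Q - 1" if "v \<in> free" for v
    using y[OF that] unfolding Q_def by (metis of_nat_less_iff of_nat_power zle_diff1_eq)
  have hc: "int (height v) \<le> c" for v using height_le_card unfolding c_def by simp
  have "witness p k J y v - n \<le> witness p k J y u" if uv: "(u, v) \<in> cov" for u v
  proof -
    have H: "u \<in> H" "v \<in> H" "height u < height v" "u \<noteq> top"
      using covD[OF uv] height_less le_top[of v] le_antisym by auto
    have lov: "lo v - 1 \<le> lo u" "up v - 1 \<le> up u" using lo_cov up_cov uv by auto
    consider "u \<in> free" "v \<in> free" | "u \<notin> free" "v \<in> free" | "u \<in> free" "v \<notin> free" | "u \<notin> free" "v \<notin> free"
      by blast
    then show ?thesis
    proof cases
      case 1
      have "int k * (lo v + up v - 2) \<le> int k * (lo u + up u)" using lov by (intro mult_left_mono) auto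
      then have "1 - int p \<le> T u - T v" unfolding T_def using H pk by (simp add: algebra_simps)
      then have "Q * (1 - int p) \<le> Q * (T u - T v)" using Q by (intro mult_left_mono) auto
      then show ?thesis using 1 yQ[of v] unfolding x n by (simp add: algebra_simps)
    next
      case 2
      then have "u \<in> forced" using H unfolding free_def by auto
      then have "lo v + up v \<le> 2 * (lo u + 1) - 1" using lov forced_up[of u] free_up[OF 2(2)] by simp
      then have "int k * (lo v + up v) \<le> int k * (2 * (lo u + 1) - 1)" by (intro mult_left_mono) auto
      then have "T v + 1 \<le> int p * (lo u + 1)"
        unfolding T_def pk using lo_ge[of u] kc unfolding c_def by (simp add: algebra_simps)
      then have "Q * (T v + 1) \<le> Q * (int p * (lo u + 1))" using Q by (intro mult_left_mono) auto
      moreover have "lo u + 1 \<le> 0" using lo_neg H by fastforce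
      ultimately show ?thesis using 2 yQ[of v] unfolding x n by (simp add: algebra_simps)
    next
      case 3
      then have "v \<in> forced" using H unfolding free_def by auto
      then have "2 * (lo v - 1) + 1 \<le> lo u + up u" using lov forced_up[of v] free_up[OF 3(1)] by simp
      then have "int k * (2 * (lo v - 1) + 1) \<le> int k * (lo u + up u)" by (intro mult_left_mono) auto
      then have "int p * (lo v - 1) + c + 1 \<le> T u"
        unfolding T_def pk using lo_nonpos[of v] kc hc[of u] by (simp add: algebra_simps)
      then have "Q * (int p * (lo v - 1) + c + 1) \<le> Q * T u" using Q by (intro mult_left_mono) auto
      moreover have "1 * (c + 1) \<le> Q * (c + 1)" using Q unfolding c_def by (intro mult_right_mono) auto
      ultimately show ?thesis using 3 lo_ge[of v] unfolding x n c_def[symmetric] by (simp add: algebra_simps)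
    next
      case 4
      have "n * (lo v - 1) \<le> n * lo u" using lov n by (intro mult_left_mono) auto
      then show ?thesis using 4 unfolding x by (simp add: algebra_simps)
    qed
  qed
  moreover have "top \<notin> free" "bot \<notin> free" unfolding free_def using top_forced bot_forced by auto
  moreover have "lo h = 0" "h \<notin> free" if "h \<notin> H" for h using that unfolding lo_def free_def by auto
  ultimately show ?thesis unfolding min_gens_def omega_neg_def n_def[symmetric] using x lo_top lo_bot by auto
qed

text \<open>Comparing degrees shows that \<open>c\<close> also has the least degree, so its values on forced
  elements are known. Start from a cover \<open>u < v1\<close> with \<open>u\<close> forced and
  \<open>v1\<close> a minimal free element. The quotient \<open>c div p ^ i\<close> is at most
  \<open>lo u\<close> at \<open>v1\<close>, and the increasing residues keep it there on all free
  elements reached from \<open>v1\<close> by covers. At the first forced element \<open>w\<close>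
  this contradicts \<open>lo w \<ge> lo u + 2\<close>.\<close>
lemma witness_indecomposable:
  assumes level and free: "free \<noteq> {}"
    and p: "0 < p" and s: "card H \<le> s" and i: "1 \<le> i" "i \<le> J"
    and y: "\<And>v. v \<in> free \<Longrightarrow> y v \<in> band_digits p s (height v) J"
    and b: "b \<in> omega_neg (int p ^ (Suc J - i) - 1)" and c: "c \<in> omega_neg (int p ^ i - 1)"
    and eq: "\<And>h. witness p k J y h = int p ^ i * b h + c h"
  shows False
proof -
  define m where "m = int p ^ i"
  have m: "0 < m" unfolding m_def using p by simp
  have bot: "bot \<notin> free" using bot_forced unfolding free_def by simp
  have pe: "int p ^ Suc J = m * int p ^ (Suc J - i)" unfolding m_def using i by (simp flip: power_add)
  have "c bot \<le> - (m - 1) * rank"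
  proof -
    have "- (int p ^ (Suc J - i) - 1) * rank \<le> b bot" using omega_neg_lo[OF b bot_in] lo_bot by (simp add: algebra_simps)
    then have "m * (- (int p ^ (Suc J - i) - 1) * rank) \<le> m * b bot" using m by (intro mult_left_mono) auto
    moreover have "witness p k J y bot = - (int p ^ Suc J - 1) * rank"
      unfolding witness_def using bot lo_bot by (simp add: algebra_simps)
    ultimately show ?thesis using eq[of bot] unfolding pe m_def[symmetric] by (simp add: algebra_simps)
  qed
  moreover have "- (m - 1) * rank \<le> c bot" using omega_neg_lo[OF c bot_in] lo_bot unfolding m_def by (simp add: algebra_simps)
  ultimately have cmin: "c \<in> min_gens (m - 1)" using c unfolding min_gens_def m_def by auto
  define r where "r v = int (y v mod p ^ i)" for v
  define z where "z v = c v div m" for v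
  have cz: "c v = m * z v + r v" if "v \<in> free" for v
  proof -
    have "m dvd int p ^ J" unfolding m_def using i by (intro le_imp_power_dvd) auto
    then have "witness p k J y v mod m = int (y v) mod m"
      using that unfolding witness_def by (auto elim!: dvdE simp: mult.assoc)
    moreover have "witness p k J y v mod m = c v mod m" unfolding eq m_def by simp
    ultimately have "c v mod m = r v" unfolding r_def m_def by (simp add: of_nat_mod)
    then show ?thesis unfolding z_def by (metis mult_div_mod_eq)
  qed
  have r_lt: "r v < m" for v unfolding r_def m_def using p
    by (metis mod_less_divisor of_nat_less_iff of_nat_power zero_less_power)
  have band: "int (height v * s * p ^ (i - 1)) \<le> r v" "r v < int ((height v + 1) * s * p ^ (i - 1))"
    if "v \<in> free" for v
    using y[OF that] i unfolding band_digits_def r_def by (auto simp del: of_nat_mult of_nat_add)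
  have r_mono: "r u < r v" if uv: "u \<in> free" "v \<in> free" "u \<unlhd> v" "u \<noteq> v" for u v
  proof -
    have "(height u + 1) * s * p ^ (i - 1) \<le> height v * s * p ^ (i - 1)"
      using height_less[OF uv(3,4)] by (intro mult_right_mono) auto
    then have "int ((height u + 1) * s * p ^ (i - 1)) \<le> int (height v * s * p ^ (i - 1))"
      by (simp only: of_nat_le_iff)
    then show ?thesis using band[OF uv(1)] band[OF uv(2)] by linarith
  qed
  have r_ge: "int (card H) \<le> r v" if "v \<in> free" for v
  proof -
    have "1 * card H * 1 \<le> height v * s * p ^ (i - 1)"
      using height_pos[of v] that s p unfolding free_def by (intro mult_mono) auto
    then have "int (card H) \<le> int (height v * s * p ^ (i - 1))" by (simp only: of_nat_le_iff)
    then show ?thesis using band(1)[OF that] by linarith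
  qed
  have step: "c v \<le> c u + m - 1" if "(u, v) \<in> cov" for u v
    using c that unfolding omega_neg_def m_def by force
  obtain v0 where v0: "v0 \<in> free" using free by auto
  obtain v1 where v1: "v1 \<in> free" "\<And>w. w \<in> free \<Longrightarrow> height v1 \<le> height w"
    using ex_has_least_nat[of "\<lambda>w. w \<in> free" v0 height] v0 by blast
  have "v1 \<in> H" "v1 \<noteq> bot" using v1(1) bot unfolding free_def by auto
  then obtain u where u: "(u, v1) \<in> cov" using lower_cover[of bot v1] bot_le by auto
  have uH: "u \<in> H" "u \<unlhd> v1" "u \<noteq> v1" using covD[OF u] by auto
  have "u \<notin> free" using v1(2)[of u] height_less[OF uH(2,3)] by auto
  then have uf: "u \<in> forced" using uH unfolding free_def by auto
  have cu: "c u = (m - 1) * lo u" by (rule min_gens_forced[OF cmin uf])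
  \<comment> \<open>a maximal free element above \<open>v1\<close> where the quotient is still small\<close>
  let ?Z = "\<lambda>v. v \<in> free \<and> v1 \<unlhd> v \<and> z v \<le> lo u"
  have "z v1 \<le> lo u"
  proof (rule ccontr)
    assume "\<not> z v1 \<le> lo u"
    then have "m * (lo u + 1) \<le> m * z v1" using m by (intro mult_left_mono) auto
    then show False using step[OF u] cu cz[OF v1(1)] r_ge[OF v1(1)] lo_ge[of u] by (simp add: algebra_simps)
  qed
  then have "?Z v1" using v1 le_refl[OF \<open>v1 \<in> H\<close>] by simp
  moreover have "\<forall>v. ?Z v \<longrightarrow> height v < Suc (card H)" using height_le_card less_Suc_eq_le by auto
  ultimately obtain v where v: "?Z v" "\<forall>w. ?Z w \<longrightarrow> height w \<le> height v"
    using Lattices_Big.ex_has_greatest_nat[of ?Z v1 height "Suc (card H)"] by blast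
  have "v \<in> H" "v \<noteq> top" using v(1) top_forced unfolding free_def by auto
  then obtain w where w: "(v, w) \<in> cov" using upper_cover[of v top] le_top by blast
  have vw: "v \<unlhd> w" "v \<noteq> w" "w \<in> H" using covD[OF w] by auto
  have "m * z v \<le> m * lo u" using v(1) m by (intro mult_left_mono) auto
  then have cw: "c w \<le> m * lo u + r v + m - 1" using step[OF w] cz[of v] v(1) by linarith
  show False
  proof (cases "w \<in> free")
    case True
    have "z w \<le> lo u"
    proof (rule ccontr)
      assume "\<not> z w \<le> lo u"
      then have "m * (lo u + 1) \<le> m * z w" using m by (intro mult_left_mono) auto
      then show False using cw cz[OF True] r_mono[OF _ True vw(1,2)] v(1) by (simp add: algebra_simps)
    qed
    moreover have "v1 \<unlhd> w" using v(1) vw le_trans by blast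
    ultimately have "height w \<le> height v" using v(2) True by blast
    then show False using height_less[OF vw(1,2)] by simp
  next
    case False
    then have wf: "w \<in> forced" using vw unfolding free_def by auto
    have "v1 \<unlhd> w" using v(1) vw le_trans by blast
    moreover have "v1 \<noteq> w" using v1(1) False by auto
    ultimately have "lo u + 2 \<le> lo w" using level_gap[OF assms(1) uf wf uH(2)] uH(3) by auto
    then have "m * (lo u + 2) \<le> m * lo w" using m by (intro mult_left_mono) auto
    then show False using cw min_gens_forced[OF cmin wf] r_lt[of v] lo_nonpos[of w] by (simp add: algebra_simps)
  qed
qed

theorem many_indecomposables:
  assumes level and free: "free \<noteq> {}"
    and p: "p = 2 * k + 1" "2 * card H + 1 \<le> k" and s: "s = p div (card H + 1)" "card H \<le> s"
  shows "\<exists>X \<subseteq> min_gens (int p ^ Suc J - 1). finite X \<and> s ^ (J * card free) \<le> card X \<and>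
    (\<forall>x\<in>X. \<forall>i\<in>{1..J}. \<forall>b\<in>omega_neg (int p ^ (Suc J - i) - 1). \<forall>c\<in>omega_neg (int p ^ i - 1).
       \<exists>h. x h \<noteq> int p ^ i * b h + c h)"
proof -
  let ?Y = "Pi\<^sub>E free (\<lambda>v. band_digits p s (height v) J)"
  have p0: "0 < p" using p by simp
  have finf: "finite free" unfolding free_def using finite_H by auto
  have finY: "finite ?Y" using finf finite_band_digits by (intro finite_PiE) auto
  have "inj_on (witness p k J) ?Y"
  proof (rule inj_onI, rule ext)
    fix y y' v assume *: "y \<in> ?Y" "y' \<in> ?Y" "witness p k J y = witness p k J y'"
    show "y v = y' v"
    proof (cases "v \<in> free")
      case True
      have "witness p k J y v = witness p k J y' v" using * by simp
      then show ?thesis unfolding witness_def using True by simp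
    next
      case False then show ?thesis using * by (metis PiE_arb)
    qed
  qed
  then have "card (witness p k J ` ?Y) = card ?Y" by (rule card_image)
  moreover have "s ^ (J * card free) \<le> card ?Y"
  proof -
    have "s ^ J \<le> card (band_digits p s (height v) J)" for v
    proof (rule card_band_digits[OF _ p0])
      have "(height v + 1) * s \<le> (card H + 1) * s" using height_le_card by (intro mult_right_mono) auto
      also have "\<dots> \<le> p" unfolding s by (rule times_div_less_eq_dividend)
      finally show "(height v + 1) * s \<le> p" .
    qed
    then have "(\<Prod>v\<in>free. s ^ J) \<le> (\<Prod>v\<in>free. card (band_digits p s (height v) J))"
      by (intro prod_mono) auto
    then show ?thesis using finf by (simp add: card_PiE power_mult)
  qed
  moreover have "witness p k J ` ?Y \<subseteq> min_gens (int p ^ Suc J - 1)"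
    using witness_mem[OF p] by (auto simp: band_digits_def PiE_def Pi_def)
  moreover have "\<exists>h. witness p k J y h \<noteq> int p ^ i * b h + c h"
    if "y \<in> ?Y" "i \<in> {1..J}" "b \<in> omega_neg (int p ^ (Suc J - i) - 1)" "c \<in> omega_neg (int p ^ i - 1)"
    for y i b c
    using witness_indecomposable[OF assms(1) free p0 s(2), of i J y b c k] that by (auto simp: PiE_def Pi_def)
  ultimately show ?thesis using finY by (intro exI[of _ "witness p k J ` ?Y"]) auto
qed

end

section \<open>Monoid rings over prime fields\<close>

lemma finite_vec_le: "finite {a :: nat ^ 'i::finite. \<forall>i. a $ i \<le> m $ i}"
proof (rule finite_imageD)
  have "vec_nth ` {a :: nat ^ 'i. \<forall>i. a $ i \<le> m $ i} \<subseteq> Pi\<^sub>E UNIV (\<lambda>i. {..m $ i})" by auto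
  then show "finite (vec_nth ` {a :: nat ^ 'i. \<forall>i. a $ i \<le> m $ i})"
    by (rule finite_subset) (intro finite_PiE, auto)
  show "inj_on vec_nth {a :: nat ^ 'i. \<forall>i. a $ i \<le> m $ i}" by (simp add: inj_on_def vec_nth_inject)
qed

lemma finite_splits: "finite {ab :: (nat ^ 'i::finite) \<times> (nat ^ 'i). fst ab + snd ab = m}"
  by (rule finite_subset[OF _ finite_cartesian_product[OF finite_vec_le[of m] finite_vec_le[of m]]]) auto

lemma lookup_mult_splits:
  fixes F G :: "(nat ^ 'i::finite) \<Rightarrow>\<^sub>0 int"
  shows "Poly_Mapping.lookup (F * G) m = (\<Sum>ab\<in>{ab. fst ab + snd ab = m}. Poly_Mapping.lookup F (fst ab) * Poly_Mapping.lookup G (snd ab))"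
proof -
  have "Poly_Mapping.lookup (F * G) m = (\<Sum>(a, b). Poly_Mapping.lookup F a * Poly_Mapping.lookup G b when m = a + b)"
    unfolding times_poly_mapping.rep_eq by (rule prod_fun_unfold_prod) simp_all
  also have "\<dots> = (\<Sum>ab\<in>{ab. fst ab + snd ab = m}. case ab of (a, b) \<Rightarrow> Poly_Mapping.lookup F a * Poly_Mapping.lookup G b when m = a + b)"
    by (rule Sum_any.expand_superset[OF finite_splits]) auto
  also have "\<dots> = (\<Sum>ab\<in>{ab. fst ab + snd ab = m}. Poly_Mapping.lookup F (fst ab) * Poly_Mapping.lookup G (snd ab))"
    by (rule sum.cong) auto
  finally show ?thesis .
qed

definition mon :: "int \<Rightarrow> nat ^ 'i::finite \<Rightarrow> nat ^ 'i \<Rightarrow> int" where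
  "mon c s = (\<lambda>m. if m = s then c else 0)"

text \<open>The monoid algebra of \<open>Sm\<close> over the field with \<open>p\<close> elements, with
  coefficients represented by \<open>{0..<p}\<close>.\<close>
locale fp_monoid_ring =
  fixes p :: nat and R :: "(nat ^ 'i::finite \<Rightarrow> int) ring" (structure) and Sm :: "(nat ^ 'i) set"
  assumes prime_p: "Factorial_Ring.prime p"
    and carrier_R: "carrier R = {f. (\<forall>m. f m \<in> {0..<int p}) \<and> finite {m. f m \<noteq> 0} \<and> (\<forall>m. f m \<noteq> 0 \<longrightarrow> m \<in> Sm)}"
    and mult_R: "f \<in> carrier R \<Longrightarrow> g \<in> carrier R \<Longrightarrow>
       f \<otimes> g = (\<lambda>m. (\<Sum>ab\<in>{ab. fst ab + snd ab = m}. f (fst ab) * g (snd ab)) mod int p)"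
    and add_R: "f \<in> carrier R \<Longrightarrow> g \<in> carrier R \<Longrightarrow> f \<oplus> g = (\<lambda>m. (f m + g m) mod int p)"
    and one_R: "\<one> = mon 1 0" and zero_R: "\<zero> = (\<lambda>m. 0)"
    and Sm_zero: "0 \<in> Sm" and Sm_add: "s \<in> Sm \<Longrightarrow> t \<in> Sm \<Longrightarrow> s + t \<in> Sm"
begin

lemma p_gt_1: "1 < p" using prime_p prime_gt_1_nat by simp

text \<open>Reduction modulo \<open>p\<close> of integer polynomials. It is compatible with the operations,
  so that the ring axioms and the binomial theorem carry over from the type of polynomial
  mappings.\<close>
definition red :: "((nat ^ 'i) \<Rightarrow>\<^sub>0 int) \<Rightarrow> nat ^ 'i \<Rightarrow> int" where
  "red F = (\<lambda>m. Poly_Mapping.lookup F m mod int p)"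

definition lifted :: "((nat ^ 'i) \<Rightarrow>\<^sub>0 int) set" where "lifted = {F. red F \<in> carrier R}"

lemma lifted_iff: "F \<in> lifted \<longleftrightarrow> (\<forall>m. red F m \<noteq> 0 \<longrightarrow> m \<in> Sm)"
proof -
  have "{m. red F m \<noteq> 0} \<subseteq> Poly_Mapping.keys F" unfolding red_def by (auto simp: in_keys_iff)
  then have "finite {m. red F m \<noteq> 0}" by (rule finite_subset) simp
  moreover have "red F m \<in> {0..<int p}" for m unfolding red_def using p_gt_1 by simp
  ultimately show ?thesis unfolding lifted_def carrier_R by auto
qed

lemma carrierE: assumes "f \<in> carrier R" obtains F where "F \<in> lifted" "f = red F"
proof -
  have fin: "finite {m. f m \<noteq> 0}" and mod: "f m mod int p = f m" for m
    using assms unfolding carrier_R by auto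
  have "red (Abs_poly_mapping f) = f" unfolding red_def using fin mod by (simp add: lookup_Abs_poly_mapping)
  then show ?thesis using that[of "Abs_poly_mapping f"] assms unfolding lifted_def by simp
qed

lemma red_add: assumes "F \<in> lifted" "G \<in> lifted" shows "red F \<oplus> red G = red (F + G)"
  using add_R[of "red F" "red G"] assms unfolding lifted_def by (simp add: red_def lookup_add mod_add_eq)

lemma lifted_add: assumes "F \<in> lifted" "G \<in> lifted" shows "F + G \<in> lifted"
proof -
  have "red (F + G) m = (red F m + red G m) mod int p" for m
    unfolding red_def by (simp add: lookup_add mod_add_eq)
  then show ?thesis using assms unfolding lifted_iff by (metis add.right_neutral mod_0)
qed

lemma red_mult_eq: "red (F * G) m = (\<Sum>ab\<in>{ab. fst ab + snd ab = m}. red F (fst ab) * red G (snd ab)) mod int p"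
  unfolding red_def lookup_mult_splits by (subst mod_sum_eq[symmetric], subst mod_mult_eq[symmetric])
    (simp add: mod_sum_eq)

lemma red_mult: assumes "F \<in> lifted" "G \<in> lifted" shows "red F \<otimes> red G = red (F * G)"
  using mult_R[of "red F" "red G"] assms red_mult_eq unfolding lifted_def by auto

lemma lifted_mult: assumes "F \<in> lifted" "G \<in> lifted" shows "F * G \<in> lifted"
  unfolding lifted_iff
proof (intro allI impI)
  fix m assume "red (F * G) m \<noteq> 0"
  then obtain ab where "fst ab + snd ab = m" "red F (fst ab) * red G (snd ab) \<noteq> 0"
    unfolding red_mult_eq by (metis (mono_tags, lifting) mem_Collect_eq mod_0 sum.neutral)
  then show "m \<in> Sm" using assms Sm_add unfolding lifted_iff by force
qed

lemma red_single: "red (Poly_Mapping.single m c) = mon (c mod int p) m"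
  unfolding red_def mon_def by (auto simp: lookup_single when_def)

lemma mon_red: "0 \<le> c \<Longrightarrow> c < int p \<Longrightarrow> mon c m = red (Poly_Mapping.single m c)"
  by (simp add: red_single)

lemma lifted_single: "m \<in> Sm \<Longrightarrow> Poly_Mapping.single m c \<in> lifted"
  unfolding lifted_iff red_single by (auto simp: mon_def)

lemma red_one: "\<one> = red 1"
  unfolding one_R using red_single[of 0 1] p_gt_1 by simp
lemma lifted_one: "1 \<in> lifted" using lifted_single[OF Sm_zero, of 1] by simp
lemma red_zero: "\<zero> = red 0" unfolding zero_R red_def by simp
lemma lifted_zero: "0 \<in> lifted" unfolding lifted_iff red_def by simp
lemma lifted_uminus: assumes "F \<in> lifted" shows "- F \<in> lifted"
proof -
  have "red (- F) m = (- red F m) mod int p" for m unfolding red_def by (simp add: mod_minus_eq)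
  then show ?thesis using assms unfolding lifted_iff by (metis add.inverse_neutral mod_0)
qed

lemma red_carrier: "F \<in> lifted \<Longrightarrow> red F \<in> carrier R" unfolding lifted_def by simp

lemma cring_R: "cring R"
proof (rule cringI)
  show "abelian_group R"
  proof (rule abelian_groupI)
    fix x assume "x \<in> carrier R"
    then obtain F where F: "F \<in> lifted" "x = red F" by (rule carrierE)
    have "red (- F) \<oplus> x = \<zero>" using red_add[OF lifted_uminus[OF F(1)] F(1)] F(2) red_zero by simp
    then show "\<exists>y\<in>carrier R. y \<oplus> x = \<zero>" using red_carrier[OF lifted_uminus[OF F(1)]] by blast
  next
    fix x y z assume "x \<in> carrier R" "y \<in> carrier R" "z \<in> carrier R"
    then show "x \<oplus> y \<oplus> z = x \<oplus> (y \<oplus> z)"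
      by (elim carrierE) (simp add: red_add lifted_add add.assoc)
  qed (auto elim!: carrierE simp: red_add lifted_add red_carrier red_zero lifted_zero add.commute)
  show "Group.comm_monoid R"
  proof (rule comm_monoidI)
    fix x y z assume "x \<in> carrier R" "y \<in> carrier R" "z \<in> carrier R"
    then show "x \<otimes> y \<otimes> z = x \<otimes> (y \<otimes> z)"
      by (elim carrierE) (simp add: red_mult lifted_mult mult.assoc)
  qed (auto elim!: carrierE simp: red_mult lifted_mult red_carrier red_one lifted_one mult.commute)
  fix x y z assume "x \<in> carrier R" "y \<in> carrier R" "z \<in> carrier R"
  then show "(x \<oplus> y) \<otimes> z = x \<otimes> z \<oplus> y \<otimes> z"
    by (elim carrierE) (simp add: red_mult lifted_mult red_add lifted_add distrib_right)
qed

sublocale cring R by (rule cring_R)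

lemma mon_carrier: "c \<in> {0..<int p} \<Longrightarrow> s \<in> Sm \<Longrightarrow> mon c s \<in> carrier R"
  using mon_red[of c s] lifted_single red_carrier by simp

lemma red_pow: "F \<in> lifted \<Longrightarrow> red F [^] (n::nat) = red (F ^ n) \<and> F ^ n \<in> lifted"
  by (induction n) (auto simp: red_one lifted_one red_mult lifted_mult mult.commute)

lemma single_power:
  fixes s :: "nat ^ 'i"
  shows "Poly_Mapping.single s c ^ n = Poly_Mapping.single (n *s s) (c ^ n :: int)"
proof (induction n)
  case 0
  have "0 *s s = (0 :: nat ^ 'i)" by (simp add: vec_eq_iff)
  then show ?case by simp
next
  case (Suc n)
  have "s + n *s s = Suc n *s s" by (simp add: vec_eq_iff)
  then show ?case using Suc by (simp add: mult_single)
qed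

lemma mon_pow:
  assumes "c \<in> {0..<int p}" "s \<in> Sm"
  shows "mon c s [^] (n::nat) = mon (c ^ n mod int p) (n *s s)"
  using mon_red[of c s] red_pow[OF lifted_single[OF assms(2), of c], of n] assms single_power[of s c n] red_single
  by simp

text \<open>The inner binomial coefficients are divisible by \<open>p\<close>.\<close>
lemma frobenius_add_1:
  assumes "f \<in> carrier R" "g \<in> carrier R"
  shows "(f \<oplus> g) [^] p = f [^] p \<oplus> g [^] p"
proof -
  obtain F G where F: "F \<in> lifted" "f = red F" and G: "G \<in> lifted" "g = red G" using assms by (metis carrierE)
  define t where "t k = of_nat (p choose k) * F ^ k * G ^ (p - k)" for k
  define H where "H = (\<Sum>k\<in>{1..<p}. of_nat ((p choose k) div p) * F ^ k * G ^ (p - k))"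
  have tk: "t k = of_nat p * (of_nat ((p choose k) div p) * F ^ k * G ^ (p - k))" if "k \<in> {1..<p}" for k
  proof -
    have "p dvd (p choose k)" using prime_p that by (intro dvd_choose_prime) auto
    then have "p choose k = p * ((p choose k) div p)" by simp
    then have "(of_nat (p choose k) :: (nat ^ 'i) \<Rightarrow>\<^sub>0 int) = of_nat p * of_nat ((p choose k) div p)"
      by (simp only: of_nat_mult[symmetric])
    then show ?thesis unfolding t_def by (simp only: mult.assoc)
  qed
  have "(F + G) ^ p = sum t {..p}" unfolding t_def by (rule binomial_ring)
  also have "{..p} = insert 0 (insert p {1..<p})" using p_gt_1 by auto
  also have "sum t (insert 0 (insert p {1..<p})) = t 0 + (t p + sum t {1..<p})"
    using p_gt_1 by (subst sum.insert; simp)+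
  also have "sum t {1..<p} = of_nat p * H" unfolding H_def sum_distrib_left by (rule sum.cong[OF refl tk])
  also have "t 0 = G ^ p" unfolding t_def by simp
  also have "t p = F ^ p" unfolding t_def by simp
  finally have H: "(F + G) ^ p = F ^ p + G ^ p + of_nat p * H" by (simp only: add_ac)
  have "Poly_Mapping.lookup (of_nat n * H) m = int n * Poly_Mapping.lookup H m" for n m
    by (induction n) (simp_all add: distrib_right lookup_add)
  then have "red ((F + G) ^ p) = red (F ^ p + G ^ p)" unfolding red_def H by (simp add: lookup_add)
  then show ?thesis using F G red_pow red_add lifted_add by metis
qed

lemma frobenius_add:
  assumes "f \<in> carrier R" "g \<in> carrier R"
  shows "(f \<oplus> g) [^] (p ^ e) = f [^] (p ^ e) \<oplus> g [^] (p ^ e)"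
proof (induction e)
  case 0 then show ?case using assms by simp
next
  case (Suc e)
  have "(f \<oplus> g) [^] (p ^ Suc e) = ((f \<oplus> g) [^] (p ^ e)) [^] p" using assms by (simp add: nat_pow_pow mult.commute)
  also have "\<dots> = (f [^] (p ^ e)) [^] p \<oplus> (g [^] (p ^ e)) [^] p" unfolding Suc
    using assms by (intro frobenius_add_1) auto
  finally show ?case using assms by (simp add: nat_pow_pow mult.commute)
qed

lemma fermat: assumes "c \<in> {0..<int p}" shows "c ^ (p ^ e) mod int p = c"
proof (induction e)
  case 0 then show ?case using assms by simp
next
  case (Suc e)
  have "c ^ (p ^ Suc e) mod int p = (c ^ (p ^ e) mod int p) ^ p mod int p"
    by (simp add: power_mod mult.commute flip: power_mult)
  also have "\<dots> = c ^ p mod int p" unfolding Suc ..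
  also have "\<dots> = c"
  proof (cases "c = 0")
    case True then show ?thesis using p_gt_1 by (simp add: zero_power)
  next
    case False
    have "\<not> int p dvd c" using assms False by (simp add: zdvd_not_zless)
    then have "[c ^ (p - 1) = 1] (mod int p)" 
      using fermat_theorem[of p "nat c"] prime_p assms
      by (metis atLeastLessThan_iff cong_int_iff int_dvd_int_iff int_nat_eq of_nat_1 of_nat_power)
    then have "[c * c ^ (p - 1) = c * 1] (mod int p)" by (rule cong_scalar_left)
    then show ?thesis using assms p_gt_1 by (simp add: cong_def flip: power_Suc)
  qed
  finally show ?case .
qed

lemma mon_mult:
  assumes "c \<in> {0..<int p}" "s \<in> Sm" "f \<in> carrier R"
  shows "(mon c s \<otimes> f) (s + k) = c * f k mod int p"
    and "(\<And>k. m \<noteq> s + k) \<Longrightarrow> (mon c s \<otimes> f) m = 0"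
proof -
  have eq: "(mon c s \<otimes> f) m = (\<Sum>ab\<in>{ab. fst ab + snd ab = m}. mon c s (fst ab) * f (snd ab)) mod int p" for m
    using mult_R[OF mon_carrier[OF assms(1,2)] assms(3)] by simp
  have "(\<Sum>ab\<in>{ab. fst ab + snd ab = s + k}. mon c s (fst ab) * f (snd ab)) =
      (\<Sum>ab\<in>{(s, k)}. mon c s (fst ab) * f (snd ab))"
    by (rule sum.mono_neutral_right[OF finite_splits]) (auto simp: mon_def)
  then show "(mon c s \<otimes> f) (s + k) = c * f k mod int p" unfolding eq by (simp add: mon_def)
  assume "\<And>k. m \<noteq> s + k"
  then have "(\<Sum>ab\<in>{ab. fst ab + snd ab = m}. mon c s (fst ab) * f (snd ab)) = 0"
    by (intro sum.neutral) (auto simp: mon_def)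
  then show "(mon c s \<otimes> f) m = 0" unfolding eq by simp
qed

lemma mon_mult_mon:
  assumes "c \<in> {0..<int p}" "d \<in> {0..<int p}" "s \<in> Sm" "t \<in> Sm"
  shows "mon c s \<otimes> mon d t = mon (c * d mod int p) (s + t)"
  using red_mult[OF lifted_single[OF assms(3), of c] lifted_single[OF assms(4), of d]] assms(1,2)
  by (simp add: red_single mult_single)

lemma carrier_D: "f \<in> carrier R \<Longrightarrow> f m \<in> {0..<int p}" "f \<in> carrier R \<Longrightarrow> finite {m. f m \<noteq> 0}"
   "f \<in> carrier R \<Longrightarrow> f m \<noteq> 0 \<Longrightarrow> m \<in> Sm" "f \<in> carrier R \<Longrightarrow> f m mod int p = f m"
  unfolding carrier_R by auto

lemma carrier_induct [consumes 1, case_names zero mon add]: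
  assumes "f \<in> carrier R" and zero: "Q \<zero>"
    and mon: "\<And>c s. c \<in> {0..<int p} \<Longrightarrow> s \<in> Sm \<Longrightarrow> Q (mon c s)"
    and add: "\<And>f g. f \<in> carrier R \<Longrightarrow> g \<in> carrier R \<Longrightarrow> Q f \<Longrightarrow> Q g \<Longrightarrow> Q (f \<oplus> g)"
  shows "Q f"
proof -
  have "\<forall>f. f \<in> carrier R \<and> {m. f m \<noteq> 0} \<subseteq> A \<longrightarrow> Q f" if "finite A" for A
    using that
  proof (induction A)
    case empty
    have "f = \<zero>" if "{m. f m \<noteq> 0} \<subseteq> {}" for f using that unfolding zero_R by auto
    then show ?case using zero by blast
  next
    case (insert s A)
    show ?case
    proof (intro allI impI, elim conjE)
      fix f assume f: "f \<in> carrier R" "{m. f m \<noteq> 0} \<subseteq> insert s A"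
      define g where "g = f(s := 0)"
      have "{m. g m \<noteq> 0} \<subseteq> {m. f m \<noteq> 0}" unfolding g_def by auto
      then have "finite {m. g m \<noteq> 0}" using carrier_D(2)[OF f(1)] by (rule finite_subset)
      then have g: "g \<in> carrier R" using f(1) p_gt_1 unfolding carrier_R by (simp add: g_def)
      have "{m. g m \<noteq> 0} \<subseteq> A" using f(2) unfolding g_def by auto
      then have Qg: "Q g" using insert g by blast
      show "Q f"
      proof (cases "f s = 0")
        case True then have "g = f" unfolding g_def by auto
        then show ?thesis using Qg by simp
      next
        case False
        have m: "mon (f s) s \<in> carrier R" "f s \<in> {0..<int p}" "s \<in> Sm"
          using mon_carrier carrier_D[OF f(1)] False by auto
        have "f = g \<oplus> mon (f s) s" unfolding add_R[OF g m(1)]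
          using carrier_D(4)[OF f(1)] carrier_D(4)[OF g] by (auto simp: mon_def g_def fun_eq_iff)
        then show ?thesis using add[OF g m(1) Qg] mon m by metis
      qed
    qed
  qed
  then show ?thesis using assms(1) carrier_D(2) by blast
qed

end

section \<open>Monomial Cartier maps\<close>

definition int_vec :: "nat ^ 'i::finite \<Rightarrow> int ^ 'i" where "int_vec m = (\<chi> i. int (m $ i))"
definition nat_vec :: "int ^ 'i::finite \<Rightarrow> nat ^ 'i" where "nat_vec z = (\<chi> i. nat (z $ i))"

lemma nat_vec_int_vec [simp]: "nat_vec (int_vec m) = m" unfolding nat_vec_def int_vec_def by (simp add: vec_eq_iff)
lemma int_vec_inj [simp]: "int_vec m = int_vec n \<longleftrightarrow> m = n" unfolding int_vec_def by (simp add: vec_eq_iff)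
lemma int_vec_add: "int_vec (m + n) = int_vec m + int_vec n" unfolding int_vec_def by (simp add: vec_eq_iff)
lemma int_vec_smult: "int_vec (q *s m) = int q *s int_vec m" unfolding int_vec_def by (simp add: vec_eq_iff)
lemma int_vec_zero [simp]: "int_vec 0 = 0" unfolding int_vec_def by (simp add: vec_eq_iff)

lemma mod_sum_cong:
  fixes f g :: "'a \<Rightarrow> int"
  assumes "\<And>x. x \<in> A \<Longrightarrow> f x mod a = g x mod a"
  shows "sum f A mod a = sum g A mod a"
proof -
  have "sum f A mod a = (\<Sum>x\<in>A. f x mod a) mod a" by (simp add: mod_sum_eq)
  also have "\<dots> = (\<Sum>x\<in>A. g x mod a) mod a" using assms by simp
  finally show ?thesis by (simp add: mod_sum_eq)
qed

text \<open>The number \<open>a\<close> with \<open>(m + a) / q = n\<close>: the exponent of the monomial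
  map that sends \<open>x\<^sup>m\<close> to \<open>x\<^sup>n\<close>.\<close>
definition map_exponent :: "nat \<Rightarrow> nat ^ 'i::finite \<Rightarrow> nat ^ 'i \<Rightarrow> int ^ 'i" where
  "map_exponent q m n = int q *s int_vec n - int_vec m"

context fp_monoid_ring
begin

definition exponent_group :: "(int ^ 'i) set" where "exponent_group = {int_vec m - int_vec n | m n. m \<in> Sm \<and> n \<in> Sm}"

text \<open>The exponents \<open>a\<close> for which \<open>(m + a) / q\<close> is an exponent of the ring
  whenever it is integral. For Hibi rings this is \<open>omega_neg (q - 1)\<close>.\<close>
definition map_exponents :: "nat \<Rightarrow> (int ^ 'i) set" where
  "map_exponents q = {a \<in> exponent_group. \<forall>m\<in>Sm. \<forall>n\<in>exponent_group. int q *s n = int_vec m + a \<longrightarrow> n \<in> int_vec ` Sm}"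

lemma Sm_smult: "s \<in> Sm \<Longrightarrow> n *s s \<in> Sm"
proof (induction n)
  case 0
  have "0 *s s = 0" by (simp add: vec_eq_iff)
  then show ?case using Sm_zero by simp
next
  case (Suc n)
  have "Suc n *s s = s + n *s s" by (simp add: vec_eq_iff)
  then show ?case using Suc Sm_add by simp
qed

lemma map_exponent_exponent_group: assumes "m \<in> Sm" "n \<in> Sm" shows "map_exponent q m n \<in> exponent_group"
  unfolding map_exponent_def exponent_group_def using assms Sm_smult[OF assms(2), of q] by (auto simp: int_vec_smult[symmetric])

lemma exponent_group_map_exponent: assumes "a \<in> exponent_group" "0 < q" obtains m n where "m \<in> Sm" "n \<in> Sm" "a = map_exponent q m n"
proof -
  obtain x y where xy: "x \<in> Sm" "y \<in> Sm" "a = int_vec x - int_vec y" using assms(1) unfolding exponent_group_def by blast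
  have "a = map_exponent q ((q - 1) *s x + y) x"
    unfolding xy map_exponent_def int_vec_add int_vec_smult using assms(2) by (simp add: vec_eq_iff of_nat_diff algebra_simps)
  then show ?thesis using that xy Sm_add Sm_smult by blast
qed

lemma map_exponents_1: "a \<in> map_exponents 1 \<Longrightarrow> a \<in> int_vec ` Sm"
  unfolding map_exponents_def using Sm_zero by (force simp: vec_eq_iff)

definition additive :: "((nat ^ 'i \<Rightarrow> int) \<Rightarrow> (nat ^ 'i \<Rightarrow> int)) \<Rightarrow> bool" where
  "additive \<phi> \<longleftrightarrow> \<phi> \<in> carrier R \<rightarrow> carrier R \<and>
     (\<forall>x\<in>carrier R. \<forall>y\<in>carrier R. \<phi> (x \<oplus> y) = \<phi> x \<oplus> \<phi> y)"

lemma additive_closed: "additive \<phi> \<Longrightarrow> x \<in> carrier R \<Longrightarrow> \<phi> x \<in> carrier R"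
  unfolding additive_def by auto

lemma additive_zero: assumes "additive \<phi>" shows "\<phi> \<zero> = \<zero>"
proof -
  have "\<phi> \<zero> \<in> carrier R" using assms unfolding additive_def by auto
  moreover have "\<phi> \<zero> \<oplus> \<phi> \<zero> = \<phi> \<zero>" using assms unfolding additive_def by (metis zero_closed l_zero)
  ultimately show ?thesis by (metis add.r_cancel_one')
qed

lemma mon_1_carrier: "m \<in> Sm \<Longrightarrow> mon 1 m \<in> carrier R"
  using mon_carrier[of 1 m] p_gt_1 by simp

lemma add_eval: "f \<in> carrier R \<Longrightarrow> g \<in> carrier R \<Longrightarrow> (f \<oplus> g) n = (f n + g n) mod int p"
  by (simp add: add_R)

lemma additive_mon:
  assumes "additive \<phi>" "m \<in> Sm"
  shows "k < p \<Longrightarrow> \<phi> (mon (int k) m) n = int k * \<phi> (mon 1 m) n mod int p"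
proof (induction k)
  case 0
  have "mon 0 m = \<zero>" unfolding zero_R mon_def by auto
  then show ?case using additive_zero[OF assms(1)] zero_R by simp
next
  case (Suc k)
  have c: "mon (int k) m \<in> carrier R" "mon 1 m \<in> carrier R"
    using mon_carrier[OF _ assms(2)] Suc p_gt_1 by auto
  have "mon (int (Suc k)) m = mon (int k) m \<oplus> mon 1 m"
    unfolding add_R[OF c] using Suc.prems by (auto simp: mon_def)
  then have "\<phi> (mon (int (Suc k)) m) = \<phi> (mon (int k) m) \<oplus> \<phi> (mon 1 m)"
    using assms(1) c unfolding additive_def by simp
  then have "\<phi> (mon (int (Suc k)) m) n = (\<phi> (mon (int k) m) n + \<phi> (mon 1 m) n) mod int p"
    using add_eval additive_closed[OF assms(1)] c by simp
  also have "\<dots> = (int k * \<phi> (mon 1 m) n + \<phi> (mon 1 m) n) mod int p" using Suc by (simp add: mod_add_left_eq)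
  finally show ?case by (simp add: algebra_simps)
qed

text \<open>Over a prime field additive maps are linear, and hence determined by the images of the
  monomials.\<close>
lemma additive_expand:
  assumes "additive \<phi>" "f \<in> carrier R"
  shows "finite A \<Longrightarrow> {m. f m \<noteq> 0} \<subseteq> A \<Longrightarrow> \<phi> f n = (\<Sum>m\<in>A. f m * \<phi> (mon 1 m) n) mod int p"
  using assms(2)
proof (induction f arbitrary: A rule: carrier_induct)
  case zero
  then show ?case using additive_zero[OF assms(1)] by (simp add: zero_R)
next
  case (mon c s)
  have "(\<Sum>m\<in>A. mon c s m * \<phi> (mon 1 m) n) = c * \<phi> (mon 1 s) n"
  proof (cases "c = 0")
    case True then show ?thesis by (simp add: mon_def)
  next
    case False
    then have "s \<in> A" using mon by (auto simp: mon_def)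
    then have "(\<Sum>m\<in>A. mon c s m * \<phi> (mon 1 m) n) = (\<Sum>m\<in>{s}. mon c s m * \<phi> (mon 1 m) n)"
      using mon by (intro sum.mono_neutral_right) (auto simp: mon_def)
    then show ?thesis by (simp add: mon_def)
  qed
  then show ?case using additive_mon[OF assms(1) mon(2), of "nat c" n] mon(1) by auto
next
  case (add f g)
  define B where "B = A \<union> {m. f m \<noteq> 0} \<union> {m. g m \<noteq> 0}"
  have B: "finite B" "{m. f m \<noteq> 0} \<subseteq> B" "{m. g m \<noteq> 0} \<subseteq> B" "A \<subseteq> B"
    unfolding B_def using add carrier_D(2) by auto
  have "(\<Sum>m\<in>A. (f \<oplus> g) m * \<phi> (mon 1 m) n) = (\<Sum>m\<in>B. (f \<oplus> g) m * \<phi> (mon 1 m) n)"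
    using B add by (intro sum.mono_neutral_left) auto
  also have "\<dots> mod int p = (\<Sum>m\<in>B. (f m + g m) * \<phi> (mon 1 m) n) mod int p"
    by (rule mod_sum_cong) (simp add: add_eval add mod_mult_left_eq)
  also have "\<dots> = ((\<Sum>m\<in>B. f m * \<phi> (mon 1 m) n) mod int p + (\<Sum>m\<in>B. g m * \<phi> (mon 1 m) n) mod int p) mod int p"
    by (simp add: distrib_right sum.distrib mod_add_eq)
  also have "\<dots> = (\<phi> f n + \<phi> g n) mod int p" using add.IH(1)[of B] add.IH(2)[of B] B by simp
  also have "\<dots> = \<phi> (f \<oplus> g) n" using assms(1) add(1,2) add_eval additive_closed[OF assms(1)]
    unfolding additive_def by simp
  finally show ?case by simp
qed

abbreviation frob :: "nat \<Rightarrow> ((nat ^ 'i \<Rightarrow> int) \<Rightarrow> (nat ^ 'i \<Rightarrow> int)) set" where "frob \<equiv> frobenius_maps p R"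

lemma frob_additive: "\<psi> \<in> frob e \<Longrightarrow> additive \<psi>"
  unfolding frobenius_maps_def additive_def by auto
lemma frob_linear: "\<psi> \<in> frob e \<Longrightarrow> r \<in> carrier R \<Longrightarrow> x \<in> carrier R \<Longrightarrow> \<psi> (r [^] (p ^ e) \<otimes> x) = r \<otimes> \<psi> x"
  unfolding frobenius_maps_def by auto
lemma frob_closed: "\<psi> \<in> frob e \<Longrightarrow> x \<in> carrier R \<Longrightarrow> \<psi> x \<in> carrier R"
  unfolding frobenius_maps_def by auto
lemma frob_ext: "\<psi> \<in> frob e \<Longrightarrow> x \<notin> carrier R \<Longrightarrow> \<psi> x = undefined"
  unfolding frobenius_maps_def by auto
lemma frobI:
  assumes "\<psi> \<in> extensional (carrier R)" "additive \<psi>"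
    "\<And>r x. r \<in> carrier R \<Longrightarrow> x \<in> carrier R \<Longrightarrow> \<psi> (r [^] (p ^ e) \<otimes> x) = r \<otimes> \<psi> x"
  shows "\<psi> \<in> frob e"
  using assms unfolding frobenius_maps_def additive_def PiE_def by auto

lemma pe_pos: "0 < p ^ e" using p_gt_1 by simp

lemma frob_shift:
  assumes "\<psi> \<in> frob e" "m \<in> Sm" "s \<in> Sm"
  shows "\<psi> (mon 1 (p ^ e *s s + m)) = mon 1 s \<otimes> \<psi> (mon 1 m)"
proof -
  have "mon 1 s [^] (p ^ e) = mon 1 (p ^ e *s s)" using mon_pow[of 1 s "p ^ e"] assms(3) p_gt_1 by simp
  then have "mon 1 s [^] (p ^ e) \<otimes> mon 1 m = mon 1 (p ^ e *s s + m)"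
    using mon_mult_mon[of 1 1 "p ^ e *s s" m] assms Sm_smult p_gt_1 by simp
  then show ?thesis using frob_linear[OF assms(1) mon_1_carrier[OF assms(3)] mon_1_carrier[OF assms(2)]] by simp
qed

lemma frob_shift_eval:
  assumes "\<psi> \<in> frob e" "m \<in> Sm" "s \<in> Sm"
  shows "\<psi> (mon 1 (p ^ e *s s + m)) (s + k) = \<psi> (mon 1 m) k"
  unfolding frob_shift[OF assms]
  using mon_mult(1)[of 1 s "\<psi> (mon 1 m)" k] assms frob_closed[OF assms(1) mon_1_carrier[OF assms(2)]]
    carrier_D(4) p_gt_1 by simp

text \<open>The coefficient of the monomial map of exponent \<open>a\<close> in \<open>\<psi>\<close>. It is
  the coefficient of \<open>x\<^sup>n\<close> in \<open>\<psi> (x\<^sup>m)\<close> for any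
  \<open>m\<close>, \<open>n\<close> with \<open>a = q * n - m\<close>.\<close>
definition map_coeff :: "nat \<Rightarrow> ((nat ^ 'i \<Rightarrow> int) \<Rightarrow> (nat ^ 'i \<Rightarrow> int)) \<Rightarrow> int ^ 'i \<Rightarrow> int" where
  "map_coeff q \<psi> a = (let mn = (SOME mn. fst mn \<in> Sm \<and> snd mn \<in> Sm \<and> a = map_exponent q (fst mn) (snd mn))
     in \<psi> (mon 1 (fst mn)) (snd mn))"

lemma map_exponent_eqD: "map_exponent q m n = map_exponent q m' n' \<Longrightarrow> q *s n' + m = q *s n + m'"
proof -
  assume "map_exponent q m n = map_exponent q m' n'"
  then have "int_vec (q *s n' + m) = int_vec (q *s n + m')" unfolding map_exponent_def int_vec_add int_vec_smult by (simp add: algebra_simps)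
  then show ?thesis by simp
qed

text \<open>Two representations \<open>q * n - m = q * n' - m'\<close> give the same coefficient: multiply
  the monomial of \<open>m\<close> by the \<open>q\<close>-th power of that of \<open>n'\<close>,
  and the monomial of \<open>m'\<close> by the \<open>q\<close>-th power of that of
  \<open>n\<close>.\<close>
lemma map_coeff_eq:
  assumes "\<psi> \<in> frob e" "m \<in> Sm" "n \<in> Sm"
  shows "map_coeff (p ^ e) \<psi> (map_exponent (p ^ e) m n) = \<psi> (mon 1 m) n"
proof -
  define mn where "mn = (SOME mn. fst mn \<in> Sm \<and> snd mn \<in> Sm \<and> map_exponent (p ^ e) m n = map_exponent (p ^ e) (fst mn) (snd mn))"
  have "fst mn \<in> Sm \<and> snd mn \<in> Sm \<and> map_exponent (p ^ e) m n = map_exponent (p ^ e) (fst mn) (snd mn)"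
    unfolding mn_def by (rule someI[of _ "(m, n)"]) (simp add: assms)
  then have mn: "fst mn \<in> Sm" "snd mn \<in> Sm" "p ^ e *s snd mn + m = p ^ e *s n + fst mn"
    using map_exponent_eqD by auto
  have "\<psi> (mon 1 m) n = \<psi> (mon 1 (p ^ e *s snd mn + m)) (snd mn + n)"
    using frob_shift_eval[OF assms(1,2) mn(2)] by simp
  also have "\<dots> = \<psi> (mon 1 (p ^ e *s n + fst mn)) (n + snd mn)" unfolding mn(3) by (simp add: add.commute)
  also have "\<dots> = \<psi> (mon 1 (fst mn)) (snd mn)" using frob_shift_eval[OF assms(1) mn(1) assms(3)] by simp
  finally show ?thesis unfolding map_coeff_def mn_def[symmetric] by simp
qed

text \<open>Suppose that \<open>(m' + a) / q = n'\<close> is integral. After multiplication by suitable ring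
  elements the nonzero coefficient also appears in the image of the monomial of exponent
  \<open>m'\<close>, at the exponent \<open>n'\<close>. As this image lies in the ring, so does
  the monomial of \<open>n'\<close>.\<close>
lemma map_coeff_map_exponents:
  assumes "\<psi> \<in> frob e" "a \<in> exponent_group" "map_coeff (p ^ e) \<psi> a \<noteq> 0"
  shows "a \<in> map_exponents (p ^ e)"
proof -
  obtain m n where mn: "m \<in> Sm" "n \<in> Sm" "a = map_exponent (p ^ e) m n" using exponent_group_map_exponent[OF assms(2) pe_pos] .
  then have nz: "\<psi> (mon 1 m) n \<noteq> 0" using map_coeff_eq assms by simp
  have "n' \<in> int_vec ` Sm" if m': "m' \<in> Sm" and n': "n' \<in> exponent_group" and eq: "int (p ^ e) *s n' = int_vec m' + a" for m' n'
  proof -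
    obtain x y where xy: "x \<in> Sm" "y \<in> Sm" "n' = int_vec x - int_vec y" using n' unfolding exponent_group_def by blast
    have "int_vec (p ^ e *s (n + y) + m') = int_vec (p ^ e *s x + m)"
      using eq unfolding mn map_exponent_def xy int_vec_add int_vec_smult by (simp add: vec_eq_iff algebra_simps)
    then have eq': "p ^ e *s (n + y) + m' = p ^ e *s x + m" by simp
    have "\<psi> (mon 1 (p ^ e *s x + m)) (x + n) \<noteq> 0" using frob_shift_eval[OF assms(1) mn(1) xy(1)] nz by simp
    then have nz': "(mon 1 (n + y) \<otimes> \<psi> (mon 1 m')) (x + n) \<noteq> 0"
      using frob_shift[OF assms(1) m' Sm_add[OF mn(2) xy(2)]] eq' by simp
    have c: "\<psi> (mon 1 m') \<in> carrier R" using frob_closed[OF assms(1) mon_1_carrier[OF m']] .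
    obtain k where k: "x + n = (n + y) + k"
      using nz' mon_mult(2)[OF _ Sm_add[OF mn(2) xy(2)] c, of 1 "x + n"] p_gt_1 by auto
    then have "\<psi> (mon 1 m') k \<noteq> 0"
      using nz' mon_mult(1)[OF _ Sm_add[OF mn(2) xy(2)] c, of 1 k] p_gt_1 by auto
    then have "k \<in> Sm" using carrier_D(3)[OF c] by simp
    moreover have "n' = int_vec k" using arg_cong[OF k, of int_vec] unfolding xy int_vec_add by (simp add: algebra_simps)
    ultimately show ?thesis by simp
  qed
  then show ?thesis using assms(2) unfolding map_exponents_def by blast
qed

lemma frob_eqI:
  assumes "\<phi> \<in> frob e" "\<psi> \<in> frob e" "\<And>a. a \<in> exponent_group \<Longrightarrow> map_coeff (p ^ e) \<phi> a = map_coeff (p ^ e) \<psi> a"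
  shows "\<phi> = \<psi>"
proof
  fix f show "\<phi> f = \<psi> f"
  proof (cases "f \<in> carrier R")
    case True
    have mon: "\<phi> (mon 1 m) n = \<psi> (mon 1 m) n" if "m \<in> Sm" for m n
    proof (cases "n \<in> Sm")
      case True
      then show ?thesis using map_coeff_eq[OF assms(1) that True] map_coeff_eq[OF assms(2) that True]
          assms(3)[OF map_exponent_exponent_group[OF that True]] by simp
    next
      case False
      have "\<phi> (mon 1 m) \<in> carrier R" "\<psi> (mon 1 m) \<in> carrier R"
        using frob_closed assms mon_1_carrier[OF that] by auto
      then have "\<phi> (mon 1 m) n = 0" "\<psi> (mon 1 m) n = 0" using carrier_D(3) False by blast+
      then show ?thesis by simp
    qed
    have "\<phi> f n = \<psi> f n" for n
    proof -
      have fin: "finite {m. f m \<noteq> 0}" using carrier_D(2)[OF True] .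
      have "\<phi> f n = (\<Sum>m\<in>{m. f m \<noteq> 0}. f m * \<phi> (mon 1 m) n) mod int p"
        by (rule additive_expand[OF frob_additive[OF assms(1)] True fin]) simp
      also have "\<dots> = (\<Sum>m\<in>{m. f m \<noteq> 0}. f m * \<psi> (mon 1 m) n) mod int p"
        using mon carrier_D(3)[OF True] by (intro arg_cong[of _ _ "\<lambda>x. x mod int p"] sum.cong) auto
      also have "\<dots> = \<psi> f n"
        by (rule additive_expand[OF frob_additive[OF assms(2)] True fin, symmetric]) simp
      finally show ?thesis .
    qed
    then show ?thesis by auto
  next
    case False then show ?thesis using frob_ext assms by metis
  qed
qed

text \<open>The map that sends the monomial of exponent \<open>m\<close> to that of exponent \<open>(m + a)
  / q\<close>, or to \<open>0\<close> if this is not an exponent of the ring.\<close>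
definition monomial_map :: "nat \<Rightarrow> int ^ 'i \<Rightarrow> (nat ^ 'i \<Rightarrow> int) \<Rightarrow> (nat ^ 'i \<Rightarrow> int)" where
  "monomial_map q a = (\<lambda>f\<in>carrier R. \<lambda>n. if n \<in> Sm \<and> int q *s int_vec n - a \<in> int_vec ` Sm then f (nat_vec (int q *s int_vec n - a)) else 0)"

lemma monomial_map_eval: "f \<in> carrier R \<Longrightarrow> monomial_map q a f n =
   (if n \<in> Sm \<and> int q *s int_vec n - a \<in> int_vec ` Sm then f (nat_vec (int q *s int_vec n - a)) else 0)"
  unfolding monomial_map_def by simp

lemma monomial_map_closed: assumes "0 < q" "f \<in> carrier R" shows "monomial_map q a f \<in> carrier R"
proof -
  have "inj_on (\<lambda>n. nat_vec (int q *s int_vec n - a)) {n. monomial_map q a f n \<noteq> 0}"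
  proof (rule inj_onI)
    fix n n' assume n: "n \<in> {n. monomial_map q a f n \<noteq> 0}" "n' \<in> {n. monomial_map q a f n \<noteq> 0}"
      "nat_vec (int q *s int_vec n - a) = nat_vec (int q *s int_vec n' - a)"
    then have "int q *s int_vec n - a \<in> int_vec ` Sm" "int q *s int_vec n' - a \<in> int_vec ` Sm"
      unfolding monomial_map_eval[OF assms(2)] by (auto split: if_splits)
    then have "int q *s int_vec n - a = int q *s int_vec n' - a" using n(3) by (metis imageE nat_vec_int_vec)
    then show "n = n'" using assms(1) by (simp add: vec_eq_iff int_vec_def)
  qed
  moreover have "(\<lambda>n. nat_vec (int q *s int_vec n - a)) ` {n. monomial_map q a f n \<noteq> 0} \<subseteq> {m. f m \<noteq> 0}"
    unfolding monomial_map_eval[OF assms(2)] by (auto split: if_splits)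
  ultimately have "finite {n. monomial_map q a f n \<noteq> 0}"
    using carrier_D(2)[OF assms(2)] finite_subset finite_imageD by blast
  then show ?thesis unfolding carrier_R using carrier_D(1)[OF assms(2)] p_gt_1
    by (auto simp: monomial_map_eval[OF assms(2)] split: if_splits)
qed

lemma monomial_map_additive: assumes "0 < q" shows "additive (monomial_map q a)"
  unfolding additive_def
proof (intro conjI ballI funcsetI)
  fix x y assume xy: "x \<in> carrier R" "y \<in> carrier R"
  have "monomial_map q a (x \<oplus> y) n = (monomial_map q a x \<oplus> monomial_map q a y) n" for n
    using xy by (simp add: add_eval monomial_map_closed[OF assms] monomial_map_eval a_closed)
  then show "monomial_map q a (x \<oplus> y) = monomial_map q a x \<oplus> monomial_map q a y" by auto
qed (simp add: monomial_map_closed[OF assms])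

text \<open>The hypothesis concerns only the exponents that occur in \<open>x\<close>. This form covers both
  the maps of the Cartier algebra and the homomorphisms from the canonical module. By additivity
  of the Frobenius it suffices to treat monomials \<open>r\<close>.\<close>
lemma monomial_map_linear:
  assumes x: "x \<in> carrier R" and r: "r \<in> carrier R"
    and good_shift: "\<And>j n. x j \<noteq> 0 \<Longrightarrow> n \<in> exponent_group \<Longrightarrow> int (p ^ e) *s n = int_vec j + a \<Longrightarrow> n \<in> int_vec ` Sm"
  shows "monomial_map (p ^ e) a (r [^] (p ^ e) \<otimes> x) = r \<otimes> monomial_map (p ^ e) a x"
proof -
  define q where "q = p ^ e"
  have q: "0 < q" unfolding q_def by (rule pe_pos)
  note add = monomial_map_additive[OF q, of a]
  show ?thesis
    unfolding q_def[symmetric] using r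
  proof (induction r rule: carrier_induct)
    case zero
    have "\<zero> [^] q = \<zero>" using q by (simp add: nat_pow_zero)
    then show ?case using additive_zero[OF add] x monomial_map_closed[OF q x] by simp
  next
    case (add f g)
    have "(f \<oplus> g) [^] q = f [^] q \<oplus> g [^] q" unfolding q_def using frobenius_add add by simp
    then have "monomial_map q a ((f \<oplus> g) [^] q \<otimes> x) = monomial_map q a (f [^] q \<otimes> x \<oplus> g [^] q \<otimes> x)"
      using add x by (simp add: l_distr)
    also have "\<dots> = monomial_map q a (f [^] q \<otimes> x) \<oplus> monomial_map q a (g [^] q \<otimes> x)"
      using monomial_map_additive[OF q, of a] add x unfolding additive_def by simp
    finally show ?case using add monomial_map_closed[OF q x] by (simp add: l_distr)
  next
    case (mon c s)
    have "mon c s [^] q = mon c (q *s s)" using mon_pow[OF mon, of q] fermat[OF mon(1), of e] unfolding q_def by simp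
    moreover have "monomial_map q a (mon c (q *s s) \<otimes> x) n = (mon c s \<otimes> monomial_map q a x) n" for n
    proof -
      have qs: "q *s s \<in> Sm" using Sm_smult mon by simp
      have c: "mon c (q *s s) \<otimes> x \<in> carrier R" using mon_carrier[OF mon(1) qs] x by simp
      have good: "\<exists>k\<in>Sm. n = s + k \<and> int q *s int_vec k - a \<in> int_vec ` Sm" if nz: "monomial_map q a (mon c (q *s s) \<otimes> x) n \<noteq> 0"
      proof -
        from nz obtain m where m: "n \<in> Sm" "m \<in> Sm" "int q *s int_vec n - a = int_vec m" "(mon c (q *s s) \<otimes> x) m \<noteq> 0"
          unfolding monomial_map_eval[OF c] by (auto split: if_splits)
        obtain j where j: "m = q *s s + j" using mon_mult(2)[OF mon(1) qs x, of m] m(4) by blast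
        then have "x j \<noteq> 0" using mon_mult(1)[OF mon(1) qs x, of j] m(4) by auto
        then have jS: "j \<in> Sm" using carrier_D(3)[OF x] by simp
        have "int_vec n - int_vec s \<in> exponent_group" using m(1) mon(2) unfolding exponent_group_def by blast
        moreover have eq: "int q *s (int_vec n - int_vec s) = int_vec j + a"
          using m(3) unfolding j int_vec_add int_vec_smult by (simp add: vec_eq_iff algebra_simps)
        ultimately have "int_vec n - int_vec s \<in> int_vec ` Sm" using good_shift[of j] \<open>x j \<noteq> 0\<close> unfolding q_def by blast
        then obtain k where k: "k \<in> Sm" "int_vec n - int_vec s = int_vec k" by blast
        then have "int_vec n = int_vec (s + k)" unfolding int_vec_add by (simp add: algebra_simps)
        moreover have "int q *s int_vec k - a = int_vec j" using eq unfolding k by simp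
        ultimately show ?thesis using k jS by auto
      qed
      show ?thesis
      proof (cases "\<exists>k\<in>Sm. n = s + k \<and> int q *s int_vec k - a \<in> int_vec ` Sm")
        case True
        then obtain k j where k: "k \<in> Sm" "n = s + k" "j \<in> Sm" "int q *s int_vec k - a = int_vec j" by blast
        have "n \<in> Sm" using k mon Sm_add by simp
        moreover have eq: "int q *s int_vec n - a = int_vec (q *s s + j)"
          unfolding k(2) int_vec_add int_vec_smult k(4)[symmetric] by (simp add: vec_eq_iff algebra_simps)
        ultimately have "monomial_map q a (mon c (q *s s) \<otimes> x) n = (mon c (q *s s) \<otimes> x) (q *s s + j)"
          unfolding monomial_map_eval[OF c] using Sm_add[OF qs k(3)] by simp
        also have "\<dots> = c * x j mod int p" by (rule mon_mult(1)[OF mon(1) qs x])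
        also have "\<dots> = c * monomial_map q a x k mod int p" using k by (simp add: monomial_map_eval[OF x])
        also have "\<dots> = (mon c s \<otimes> monomial_map q a x) n" unfolding k(2)
          by (rule mon_mult(1)[OF mon monomial_map_closed[OF q x], symmetric])
        finally show ?thesis .
      next
        case False
        have "(mon c s \<otimes> monomial_map q a x) n = 0"
        proof (cases "\<exists>k. n = s + k")
          case True
          then obtain k where k: "n = s + k" by blast
          then have "monomial_map q a x k = 0" using False by (auto simp: monomial_map_eval[OF x])
          then show ?thesis unfolding k mon_mult(1)[OF mon monomial_map_closed[OF q x]] by simp
        next
          case no: False then show ?thesis using mon_mult(2)[OF mon monomial_map_closed[OF q x], of n] by blast
        qed
        then show ?thesis using good False by auto
      qed
    qed
    ultimately show ?case by auto
  qed
qed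

lemma monomial_map_frob: assumes "a \<in> map_exponents (p ^ e)" shows "monomial_map (p ^ e) a \<in> frob e"
proof (rule frobI)
  show "monomial_map (p ^ e) a \<in> extensional (carrier R)" unfolding monomial_map_def by simp
  show "additive (monomial_map (p ^ e) a)" by (rule monomial_map_additive[OF pe_pos])
  fix r x assume r: "r \<in> carrier R" and x: "x \<in> carrier R"
  show "monomial_map (p ^ e) a (r [^] (p ^ e) \<otimes> x) = r \<otimes> monomial_map (p ^ e) a x"
    using assms carrier_D(3)[OF x] unfolding map_exponents_def by (intro monomial_map_linear[OF x r]) blast
qed

lemma monomial_map_mon:
  assumes "m \<in> Sm" "n \<in> Sm"
  shows "monomial_map q a (mon 1 m) n = (if a = map_exponent q m n then 1 else 0)"
proof -
  have "a = map_exponent q m n \<longleftrightarrow> int q *s int_vec n - a = int_vec m" unfolding map_exponent_def by (auto simp: algebra_simps)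
  then show ?thesis unfolding monomial_map_eval[OF mon_1_carrier[OF assms(1)]] using assms by (auto simp: mon_def)
qed

lemma map_coeff_monomial_map:
  assumes "a \<in> map_exponents (p ^ e)" "b \<in> exponent_group"
  shows "map_coeff (p ^ e) (monomial_map (p ^ e) a) b = (if a = b then 1 else 0)"
proof -
  obtain m n where mn: "m \<in> Sm" "n \<in> Sm" "b = map_exponent (p ^ e) m n" using exponent_group_map_exponent[OF assms(2) pe_pos] .
  then show ?thesis using map_coeff_eq[OF monomial_map_frob[OF assms(1)] mn(1,2)] monomial_map_mon[OF mn(1,2)] by simp
qed

end

section \<open>Products in the Cartier algebra\<close>

context fp_monoid_ring
begin

definition zero_map where "zero_map = (\<lambda>x\<in>carrier R. \<zero>)"
definition add_map where "add_map \<phi> \<psi> = (\<lambda>x\<in>carrier R. \<phi> x \<oplus> \<psi> x)"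
definition neg_map where "neg_map \<phi> = (\<lambda>x\<in>carrier R. \<ominus> \<phi> x)"
definition comp_map where "comp_map \<phi> \<psi> = (\<lambda>x\<in>carrier R. \<phi> (\<psi> x))"

lemma frob_add: "\<phi> \<in> frob e \<Longrightarrow> x \<in> carrier R \<Longrightarrow> y \<in> carrier R \<Longrightarrow> \<phi> (x \<oplus> y) = \<phi> x \<oplus> \<phi> y"
  unfolding frobenius_maps_def by auto

lemma frob_zero: "\<phi> \<in> frob e \<Longrightarrow> \<phi> \<zero> = \<zero>"
  using additive_zero[OF frob_additive] .

lemma frobI2:
  assumes "\<psi> \<in> extensional (carrier R)" "\<And>x. x \<in> carrier R \<Longrightarrow> \<psi> x \<in> carrier R"
    "\<And>x y. x \<in> carrier R \<Longrightarrow> y \<in> carrier R \<Longrightarrow> \<psi> (x \<oplus> y) = \<psi> x \<oplus> \<psi> y"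
    "\<And>r x. r \<in> carrier R \<Longrightarrow> x \<in> carrier R \<Longrightarrow> \<psi> (r [^] (p ^ e) \<otimes> x) = r \<otimes> \<psi> x"
  shows "\<psi> \<in> frob e"
  using assms unfolding frobenius_maps_def PiE_def by auto

lemma zero_map_frob: "zero_map \<in> frob e"
  by (rule frobI2) (auto simp: zero_map_def)

lemma add_map_frob: assumes "\<phi> \<in> frob e" "\<psi> \<in> frob e" shows "add_map \<phi> \<psi> \<in> frob e"
  by (rule frobI2)
    (use frob_closed[OF assms(1)] frob_closed[OF assms(2)] frob_add[OF assms(1)] frob_add[OF assms(2)]
      frob_linear[OF assms(1)] frob_linear[OF assms(2)] in \<open>auto simp: add_map_def r_distr a_ac\<close>)

lemma neg_map_frob: assumes "\<phi> \<in> frob e" shows "neg_map \<phi> \<in> frob e"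
  by (rule frobI2)
    (use frob_closed[OF assms(1)] frob_add[OF assms(1)] frob_linear[OF assms(1)]
      in \<open>auto simp: neg_map_def minus_add r_minus\<close>)

lemma comp_map_frob: assumes "\<phi> \<in> frob i" "\<psi> \<in> frob j" shows "comp_map \<phi> \<psi> \<in> frob (i + j)"
proof (rule frobI2)
  fix r x assume rx: "r \<in> carrier R" "x \<in> carrier R"
  have "r [^] (p ^ (i + j)) = (r [^] (p ^ i)) [^] (p ^ j)" using rx by (simp add: nat_pow_pow power_add)
  then show "comp_map \<phi> \<psi> (r [^] (p ^ (i + j)) \<otimes> x) = r \<otimes> comp_map \<phi> \<psi> x"
    unfolding comp_map_def using rx frob_linear[OF assms(2), of "r [^] (p ^ i)" x] frob_linear[OF assms(1), of r "\<psi> x"]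
      frob_closed[OF assms(2)] by simp
qed (use frob_closed[OF assms(1)] frob_closed[OF assms(2)] frob_add[OF assms(1)] frob_add[OF assms(2)]
      in \<open>auto simp: comp_map_def\<close>)

lemma map_coeff_zero_map: assumes "a \<in> exponent_group" shows "map_coeff (p ^ e) zero_map a = 0"
proof -
  obtain m n where mn: "m \<in> Sm" "n \<in> Sm" "a = map_exponent (p ^ e) m n" using exponent_group_map_exponent[OF assms pe_pos] .
  then show ?thesis using map_coeff_eq[OF zero_map_frob mn(1,2)] mon_1_carrier[OF mn(1)] zero_R by (simp add: zero_map_def)
qed

lemma map_coeff_add_map: assumes "\<phi> \<in> frob e" "\<psi> \<in> frob e" "a \<in> exponent_group"
  shows "map_coeff (p ^ e) (add_map \<phi> \<psi>) a = (map_coeff (p ^ e) \<phi> a + map_coeff (p ^ e) \<psi> a) mod int p"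
proof -
  obtain m n where mn: "m \<in> Sm" "n \<in> Sm" "a = map_exponent (p ^ e) m n" using exponent_group_map_exponent[OF assms(3) pe_pos] .
  show ?thesis unfolding mn(3) map_coeff_eq[OF add_map_frob[OF assms(1,2)] mn(1,2)] map_coeff_eq[OF assms(1) mn(1,2)]
      map_coeff_eq[OF assms(2) mn(1,2)]
    using mon_1_carrier[OF mn(1)] frob_closed assms add_eval by (simp add: add_map_def)
qed

lemma map_coeff_range: assumes "\<phi> \<in> frob e" "a \<in> exponent_group"
  shows "map_coeff (p ^ e) \<phi> a mod int p = map_coeff (p ^ e) \<phi> a" "map_coeff (p ^ e) \<phi> a \<in> {0..<int p}"
proof -
  obtain m n where mn: "m \<in> Sm" "n \<in> Sm" "a = map_exponent (p ^ e) m n" using exponent_group_map_exponent[OF assms(2) pe_pos] .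
  have "\<phi> (mon 1 m) \<in> carrier R" using frob_closed[OF assms(1) mon_1_carrier[OF mn(1)]] .
  then show "map_coeff (p ^ e) \<phi> a mod int p = map_coeff (p ^ e) \<phi> a" "map_coeff (p ^ e) \<phi> a \<in> {0..<int p}"
    unfolding mn(3) map_coeff_eq[OF assms(1) mn(1,2)] using carrier_D by auto
qed

lemma add_map_neg_map: assumes "\<phi> \<in> frob e" shows "add_map (neg_map \<phi>) \<phi> = zero_map"
  using frob_closed[OF assms] unfolding add_map_def neg_map_def zero_map_def by (auto simp: l_neg)

lemma map_coeff_neg_map: assumes "\<phi> \<in> frob e" "a \<in> exponent_group"
  shows "map_coeff (p ^ e) (neg_map \<phi>) a = (- map_coeff (p ^ e) \<phi> a) mod int p"
proof -
  have "(map_coeff (p ^ e) (neg_map \<phi>) a + map_coeff (p ^ e) \<phi> a) mod int p = 0"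
    using map_coeff_add_map[OF neg_map_frob[OF assms(1)] assms(1,2)] add_map_neg_map[OF assms(1)] map_coeff_zero_map[OF assms(2)] by simp
  then have "map_coeff (p ^ e) (neg_map \<phi>) a mod int p = (- map_coeff (p ^ e) \<phi> a) mod int p"
    by (simp add: mod_eq_dvd_iff mod_eq_0_iff_dvd)
  then show ?thesis using map_coeff_range[OF neg_map_frob[OF assms(1)] assms(2)] by simp
qed

lemma finsum_frob:
  assumes "finite I" "\<And>i. i \<in> I \<Longrightarrow> h i \<in> frob e"
  shows "(\<lambda>x\<in>carrier R. \<Oplus>i\<in>I. h i x) \<in> frob e \<and>
    (\<forall>a\<in>exponent_group. map_coeff (p ^ e) (\<lambda>x\<in>carrier R. \<Oplus>i\<in>I. h i x) a = (\<Sum>i\<in>I. map_coeff (p ^ e) (h i) a) mod int p)"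
  using assms
proof (induction I)
  case empty
  have "(\<lambda>x\<in>carrier R. \<Oplus>i\<in>{}. h i x) = zero_map" unfolding zero_map_def by simp
  then show ?case using zero_map_frob map_coeff_zero_map by simp
next
  case (insert j I)
  have h: "h i \<in> frob e" if "i \<in> insert j I" for i using insert that by blast
  let ?s = "\<lambda>x\<in>carrier R. \<Oplus>i\<in>I. h i x"
  have s: "?s \<in> frob e" "\<forall>a\<in>exponent_group. map_coeff (p ^ e) ?s a = (\<Sum>i\<in>I. map_coeff (p ^ e) (h i) a) mod int p"
    using insert.IH[OF h] by blast+
  have eq: "(\<lambda>x\<in>carrier R. \<Oplus>i\<in>insert j I. h i x) = add_map (h j) ?s"
    unfolding add_map_def using insert(1,2) frob_closed[OF h] by (auto simp: finsum_insert)
  have "map_coeff (p ^ e) (add_map (h j) ?s) a = (\<Sum>i\<in>insert j I. map_coeff (p ^ e) (h i) a) mod int p" if "a \<in> exponent_group" for a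
    using map_coeff_add_map[OF h s(1) that, of j] s(2) that insert(1,2) by (simp add: mod_add_right_eq)
  then show ?case unfolding eq using add_map_frob[OF h s(1), of j] by simp
qed

text \<open>Minimal generators of \<open>map_exponents (p ^ e)\<close> that are not composed of exponents of degrees
  \<open>i\<close> and \<open>e - i\<close>; the corresponding coefficient vanishes on everything
  generated in lower degrees.\<close>
definition indecomposable :: "nat \<Rightarrow> int ^ 'i \<Rightarrow> bool" where
  "indecomposable e a \<longleftrightarrow> a \<in> exponent_group \<and> (\<forall>b\<in>map_exponents (p ^ e). \<forall>s\<in>Sm. a = b + int_vec s \<longrightarrow> s = 0) \<and>
     (\<forall>i. 0 < i \<and> i < e \<longrightarrow> (\<forall>b\<in>map_exponents (p ^ i). \<forall>c\<in>map_exponents (p ^ (e - i)). a \<noteq> int (p ^ (e - i)) *s b + c))"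

text \<open>The coefficient of \<open>\<phi> \<circ> \<psi>\<close> at \<open>a\<close> is the sum of
  products of coefficients over all \<open>a = p ^ j * b + c\<close>. For an indecomposable
  \<open>a\<close> only the trivial decompositions with a factor of degree \<open>0\<close> and
  constant coefficient remain.\<close>
lemma map_coeff_comp_map_indecomposable:
  assumes a: "indecomposable e a" and e: "0 < e" "i + j = e" and \<phi>: "\<phi> \<in> frob i" and \<psi>: "\<psi> \<in> frob j"
  shows "map_coeff (p ^ e) (comp_map \<phi> \<psi>) a =
    (if i = 0 then map_coeff 1 \<phi> 0 * map_coeff (p ^ e) \<psi> a mod int p else if j = 0 then map_coeff (p ^ e) \<phi> a * map_coeff 1 \<psi> 0 mod int p else 0)"
proof -
  have aL: "a \<in> exponent_group" using a unfolding indecomposable_def by simp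
  obtain m n where mn: "m \<in> Sm" "n \<in> Sm" "a = map_exponent (p ^ e) m n" using exponent_group_map_exponent[OF aL pe_pos] .
  have cf: "comp_map \<phi> \<psi> \<in> frob e" using comp_map_frob[OF \<phi> \<psi>] e by simp
  let ?g = "\<psi> (mon 1 m)"
  have g: "?g \<in> carrier R" using frob_closed[OF \<psi> mon_1_carrier[OF mn(1)]] .
  let ?K = "{k. ?g k \<noteq> 0}"
  let ?t = "\<lambda>k. ?g k * \<phi> (mon 1 k) n"
  have fin: "finite ?K" using carrier_D(2)[OF g] .
  have K: "k \<in> Sm" if "k \<in> ?K" for k using carrier_D(3)[OF g] that by simp
  have "map_coeff (p ^ e) (comp_map \<phi> \<psi>) a = \<phi> ?g n"
    using map_coeff_eq[OF cf mn(1,2)] mon_1_carrier[OF mn(1)] mn(3) by (simp add: comp_map_def)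
  also have "\<dots> = (\<Sum>k\<in>?K. ?t k) mod int p"
    by (rule additive_expand[OF frob_additive[OF \<phi>] g fin]) simp
  finally have sum: "map_coeff (p ^ e) (comp_map \<phi> \<psi>) a = (\<Sum>k\<in>?K. ?t k) mod int p" .
  have key: "map_exponent (p ^ i) k n \<in> map_exponents (p ^ i) \<and> map_exponent (p ^ j) m k \<in> map_exponents (p ^ j) \<and>
      a = int (p ^ j) *s map_exponent (p ^ i) k n + map_exponent (p ^ j) m k" if "k \<in> ?K" "?t k \<noteq> 0" for k
  proof (intro conjI)
    have k: "k \<in> Sm" using K that by simp
    show "map_exponent (p ^ i) k n \<in> map_exponents (p ^ i)"
      using map_coeff_map_exponents[OF \<phi> map_exponent_exponent_group[OF k mn(2)]] map_coeff_eq[OF \<phi> k mn(2)] that by simp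
    show "map_exponent (p ^ j) m k \<in> map_exponents (p ^ j)"
      using map_coeff_map_exponents[OF \<psi> map_exponent_exponent_group[OF mn(1) k]] map_coeff_eq[OF \<psi> mn(1) k] that by simp
    show "a = int (p ^ j) *s map_exponent (p ^ i) k n + map_exponent (p ^ j) m k"
      unfolding mn(3) map_exponent_def e(2)[symmetric] by (simp add: vec_eq_iff algebra_simps power_add)
  qed
  have div0: "map_exponent 1 k k = (0 :: int ^ 'i)" for k by (simp add: map_exponent_def vec_eq_iff)
  have single: "(\<Sum>k\<in>?K. ?t k) = ?t k0" if "\<And>k. k \<in> ?K \<Longrightarrow> ?t k \<noteq> 0 \<Longrightarrow> k = k0" for k0
  proof -
    have "(\<Sum>k\<in>?K. ?t k) = (\<Sum>k\<in>?K. if k = k0 then ?t k else 0)" using that by (intro sum.cong) auto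
    also have "\<dots> = (if k0 \<in> ?K then ?t k0 else 0)" by (rule sum.delta[OF fin])
    finally show ?thesis by auto
  qed
  consider "i = 0" | "i \<noteq> 0" "j = 0" | "i \<noteq> 0" "j \<noteq> 0" by blast
  then show ?thesis
  proof cases
    case 1
    have "k = n" if k: "k \<in> ?K" "?t k \<noteq> 0" for k
    proof -
      have "map_exponent 1 k n \<in> int_vec ` Sm" using map_exponents_1 key[OF k] 1 by simp
      then obtain s where s: "s \<in> Sm" "map_exponent 1 k n = int_vec s" by blast
      have "a = map_exponent (p ^ e) m k + int_vec (p ^ e *s s)"
        using key[OF k] 1 e s(2) unfolding int_vec_smult by (simp add: add.commute)
      then have "p ^ e *s s = 0" using a key[OF k] 1 e Sm_smult[OF s(1)] unfolding indecomposable_def by auto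
      then have "s = 0" using p_gt_1 by (simp add: vec_eq_iff)
      then show "k = n" using s(2) unfolding map_exponent_def by (simp add: vec_eq_iff int_vec_def)
    qed
    then have "map_coeff (p ^ e) (comp_map \<phi> \<psi>) a = ?t n mod int p" using sum single[of n] by presburger
    moreover have "?g n = map_coeff (p ^ e) \<psi> a" using map_coeff_eq[OF \<psi> mn(1,2)] 1 e mn(3) by simp
    moreover have "\<phi> (mon 1 n) n = map_coeff 1 \<phi> 0" using map_coeff_eq[OF \<phi> mn(2,2)] 1 div0[of n] by simp
    ultimately show ?thesis using 1 by (simp add: mult.commute)
  next
    case 2
    have "k = m" if k: "k \<in> ?K" "?t k \<noteq> 0" for k
    proof -
      have "map_exponent 1 m k \<in> int_vec ` Sm" using map_exponents_1 key[OF k] 2 by simp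
      then obtain s where s: "s \<in> Sm" "map_exponent 1 m k = int_vec s" by blast
      have "a = map_exponent (p ^ e) k n + int_vec s" using key[OF k] 2 e s(2) by simp
      then have "s = 0" using a key[OF k] 2 e s(1) unfolding indecomposable_def by auto
      then show "k = m" using s(2) unfolding map_exponent_def by (simp add: vec_eq_iff int_vec_def)
    qed
    then have "map_coeff (p ^ e) (comp_map \<phi> \<psi>) a = ?t m mod int p" using sum single[of m] by presburger
    moreover have "\<phi> (mon 1 m) n = map_coeff (p ^ e) \<phi> a" using map_coeff_eq[OF \<phi> mn(1,2)] 2 e mn(3) by simp
    moreover have "?g m = map_coeff 1 \<psi> 0" using map_coeff_eq[OF \<psi> mn(1,1)] 2 div0[of m] by simp
    ultimately show ?thesis using 2 by (simp add: mult.commute)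
  next
    case 3
    have "?t k = 0" if k: "k \<in> ?K" for k
    proof (rule ccontr)
      assume "?t k \<noteq> 0"
      then show False using key[OF k] a 3 e unfolding indecomposable_def by (metis add_diff_cancel_left' less_add_same_cancel1 neq0_conv)
    qed
    then have "(\<Sum>k\<in>?K. ?t k) = 0" by simp
    then show ?thesis using sum 3 by simp
  qed
qed

abbreviation A where "A \<equiv> cartier_algebra p R"
abbreviation C where "C \<equiv> cartier_component p R"

lemma A_carrier: "f \<in> carrier A \<longleftrightarrow> (\<forall>e. f e \<in> frob e) \<and> finite {e. f e \<noteq> zero_map}"
  unfolding cartier_algebra_def zero_map_def by simp
lemma A_add: "f \<oplus>\<^bsub>A\<^esub> g = (\<lambda>e. add_map (f e) (g e))"
  unfolding cartier_algebra_def add_map_def by simp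
lemma A_zero: "\<zero>\<^bsub>A\<^esub> = (\<lambda>e. zero_map)"
  unfolding cartier_algebra_def zero_map_def by simp
lemma A_one: "\<one>\<^bsub>A\<^esub> = (\<lambda>e. if e = 0 then (\<lambda>x\<in>carrier R. x) else zero_map)"
  unfolding cartier_algebra_def zero_map_def by auto
lemma A_mult: "(f \<otimes>\<^bsub>A\<^esub> g) e = (\<lambda>x\<in>carrier R. \<Oplus>i\<in>{..e}. f i (g (e - i) x))"
  unfolding cartier_algebra_def by simp
lemma C_iff: "f \<in> C e \<longleftrightarrow> f \<in> carrier A \<and> (\<forall>i. i \<noteq> e \<longrightarrow> f i = zero_map)"
  unfolding cartier_component_def zero_map_def by simp

lemma C_frob: "f \<in> C e \<Longrightarrow> f i \<in> frob i" unfolding C_iff A_carrier by simp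

lemma add_map_zero_map: "\<phi> \<in> frob e \<Longrightarrow> add_map zero_map \<phi> = \<phi>" 
  using frob_closed[of \<phi> e] frob_ext[of \<phi> e] unfolding add_map_def zero_map_def by fastforce

lemma add_map_commute: "\<phi> \<in> frob e \<Longrightarrow> \<psi> \<in> frob e \<Longrightarrow> add_map \<phi> \<psi> = add_map \<psi> \<phi>"
  using frob_closed[of \<phi> e] frob_closed[of \<psi> e] unfolding add_map_def by (auto simp: a_comm)

lemma add_map_zero_map_zero_map: "add_map zero_map zero_map = zero_map" using add_map_zero_map[OF zero_map_frob] .
lemma neg_map_zero_map: "neg_map zero_map = zero_map" unfolding neg_map_def zero_map_def by auto

lemma A_add_closed: assumes "f \<in> carrier A" "g \<in> carrier A" shows "f \<oplus>\<^bsub>A\<^esub> g \<in> carrier A"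
proof -
  have "{e. add_map (f e) (g e) \<noteq> zero_map} \<subseteq> {e. f e \<noteq> zero_map} \<union> {e. g e \<noteq> zero_map}"
    using add_map_zero_map_zero_map by auto
  then have "finite {e. add_map (f e) (g e) \<noteq> zero_map}" using assms finite_subset unfolding A_carrier by blast
  then show ?thesis using assms add_map_frob unfolding A_carrier A_add by auto
qed

lemma A_neg_closed: assumes "f \<in> carrier A" shows "(\<lambda>e. neg_map (f e)) \<in> carrier A"
proof -
  have "{e. neg_map (f e) \<noteq> zero_map} \<subseteq> {e. f e \<noteq> zero_map}" using neg_map_zero_map by auto
  then have "finite {e. neg_map (f e) \<noteq> zero_map}" using assms finite_subset unfolding A_carrier by blast
  then show ?thesis using assms neg_map_frob unfolding A_carrier by auto
qed

lemma abelian_group_A: "abelian_group A"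
proof (rule abelian_groupI)
  fix f g h assume fgh: "f \<in> carrier A" "g \<in> carrier A" "h \<in> carrier A"
  show "f \<oplus>\<^bsub>A\<^esub> g \<oplus>\<^bsub>A\<^esub> h = f \<oplus>\<^bsub>A\<^esub> (g \<oplus>\<^bsub>A\<^esub> h)"
  proof
    fix e
    have "f e \<in> frob e" "g e \<in> frob e" "h e \<in> frob e" using fgh unfolding A_carrier by auto
    then show "(f \<oplus>\<^bsub>A\<^esub> g \<oplus>\<^bsub>A\<^esub> h) e = (f \<oplus>\<^bsub>A\<^esub> (g \<oplus>\<^bsub>A\<^esub> h)) e"
      using frob_closed unfolding A_add add_map_def by (auto simp: a_assoc)
  qed
next
  fix f g assume fg: "f \<in> carrier A" "g \<in> carrier A"
  then show "f \<oplus>\<^bsub>A\<^esub> g \<in> carrier A" by (rule A_add_closed)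
  show "f \<oplus>\<^bsub>A\<^esub> g = g \<oplus>\<^bsub>A\<^esub> f" using fg add_map_commute unfolding A_add A_carrier by blast
next
  show "\<zero>\<^bsub>A\<^esub> \<in> carrier A" unfolding A_zero A_carrier using zero_map_frob by simp
next
  fix f assume f: "f \<in> carrier A"
  show "\<zero>\<^bsub>A\<^esub> \<oplus>\<^bsub>A\<^esub> f = f" using f add_map_zero_map unfolding A_add A_zero A_carrier by fastforce
  have "(\<lambda>e. neg_map (f e)) \<oplus>\<^bsub>A\<^esub> f = \<zero>\<^bsub>A\<^esub>" using f add_map_neg_map unfolding A_add A_zero A_carrier by fastforce
  then show "\<exists>g\<in>carrier A. g \<oplus>\<^bsub>A\<^esub> f = \<zero>\<^bsub>A\<^esub>" using A_neg_closed[OF f] by blast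
qed

lemma A_inv: assumes "f \<in> carrier A" shows "\<ominus>\<^bsub>A\<^esub> f = (\<lambda>e. neg_map (f e))"
proof -
  interpret A: abelian_group A by (rule abelian_group_A)
  have "(\<lambda>e. neg_map (f e)) \<oplus>\<^bsub>A\<^esub> f = \<zero>\<^bsub>A\<^esub>" using assms add_map_neg_map unfolding A_add A_zero A_carrier by fastforce
  then show ?thesis using A.minus_equality A_neg_closed[OF assms] assms by blast
qed

lemma A_mult_frob:
  assumes "f \<in> carrier A" "g \<in> carrier A"
  shows "(f \<otimes>\<^bsub>A\<^esub> g) e \<in> frob e"
    and "a \<in> exponent_group \<Longrightarrow> map_coeff (p ^ e) ((f \<otimes>\<^bsub>A\<^esub> g) e) a = (\<Sum>i\<le>e. map_coeff (p ^ e) (comp_map (f i) (g (e - i))) a) mod int p"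
proof -
  have h: "comp_map (f i) (g (e - i)) \<in> frob e" if "i \<in> {..e}" for i
    using comp_map_frob[of "f i" i "g (e - i)" "e - i"] assms that unfolding A_carrier by simp
  have eq: "(f \<otimes>\<^bsub>A\<^esub> g) e = (\<lambda>x\<in>carrier R. \<Oplus>i\<in>{..e}. comp_map (f i) (g (e - i)) x)"
    unfolding A_mult
  proof (rule restrict_ext)
    fix x assume x: "x \<in> carrier R"
    show "(\<Oplus>i\<in>{..e}. f i (g (e - i) x)) = (\<Oplus>i\<in>{..e}. comp_map (f i) (g (e - i)) x)"
      using frob_closed[OF h x] x by (intro finsum_cong') (auto simp: comp_map_def)
  qed
  show "(f \<otimes>\<^bsub>A\<^esub> g) e \<in> frob e" unfolding eq using finsum_frob[of "{..e}" "\<lambda>i. comp_map (f i) (g (e - i))" e] h by blast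
  show "map_coeff (p ^ e) ((f \<otimes>\<^bsub>A\<^esub> g) e) a = (\<Sum>i\<le>e. map_coeff (p ^ e) (comp_map (f i) (g (e - i))) a) mod int p" if "a \<in> exponent_group"
    unfolding eq using finsum_frob[of "{..e}" "\<lambda>i. comp_map (f i) (g (e - i))" e] h that by blast
qed

lemma A_mult_closed: assumes "f \<in> carrier A" "g \<in> carrier A" shows "f \<otimes>\<^bsub>A\<^esub> g \<in> carrier A"
proof -
  let ?F = "{e. f e \<noteq> zero_map}" and ?G = "{e. g e \<noteq> zero_map}"
  have fr: "f i \<in> frob i" "g i \<in> frob i" for i using assms unfolding A_carrier by auto
  have "{e. (f \<otimes>\<^bsub>A\<^esub> g) e \<noteq> zero_map} \<subseteq> (\<lambda>(i, j). i + j) ` (?F \<times> ?G)"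
  proof
    fix e assume e: "e \<in> {e. (f \<otimes>\<^bsub>A\<^esub> g) e \<noteq> zero_map}"
    show "e \<in> (\<lambda>(i, j). i + j) ` (?F \<times> ?G)"
    proof (rule ccontr)
      assume no: "e \<notin> (\<lambda>(i, j). i + j) ` (?F \<times> ?G)"
      have "f i (g (e - i) x) = \<zero>" if i: "i \<in> {..e}" and x: "x \<in> carrier R" for i x
      proof -
        have "\<not> (i \<in> ?F \<and> e - i \<in> ?G)" 
        proof
          assume "i \<in> ?F \<and> e - i \<in> ?G"
          then have "(i, e - i) \<in> ?F \<times> ?G" by simp
          then have "i + (e - i) \<in> (\<lambda>(i, j). i + j) ` (?F \<times> ?G)" by (metis case_prod_conv imageI)
          then show False using no i by simp
        qed
        then have "f i = zero_map \<or> g (e - i) = zero_map" by auto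
        then show ?thesis using frob_closed[OF fr(2) x] frob_zero[OF fr(1)] x by (auto simp: zero_map_def)
      qed
      then have "(\<Oplus>i\<in>{..e}. f i (g (e - i) x)) = \<zero>" if "x \<in> carrier R" for x
        using that by (intro add.finprod_one_eqI) auto
      then have "(f \<otimes>\<^bsub>A\<^esub> g) e = zero_map" unfolding A_mult zero_map_def by (auto intro!: restrict_ext)
      then show False using e by simp
    qed
  qed
  then have "finite {e. (f \<otimes>\<^bsub>A\<^esub> g) e \<noteq> zero_map}" using assms finite_subset unfolding A_carrier by blast
  then show ?thesis using A_mult_frob(1)[OF assms] unfolding A_carrier by simp
qed

lemma map_coeff_A_mult_indecomposable:
  assumes "f \<in> carrier A" "g \<in> carrier A" "indecomposable e a" "0 < e"
  shows "map_coeff (p ^ e) ((f \<otimes>\<^bsub>A\<^esub> g) e) a =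
    (map_coeff 1 (f 0) 0 * map_coeff (p ^ e) (g e) a + map_coeff (p ^ e) (f e) a * map_coeff 1 (g 0) 0) mod int p"
proof -
  have fr: "f i \<in> frob i" "g i \<in> frob i" for i using assms unfolding A_carrier by auto
  have aL: "a \<in> exponent_group" using assms unfolding indecomposable_def by simp
  let ?t = "\<lambda>i. map_coeff (p ^ e) (comp_map (f i) (g (e - i))) a"
  have t: "?t i = (if i = 0 then map_coeff 1 (f 0) 0 * map_coeff (p ^ e) (g e) a mod int p
     else if i = e then map_coeff (p ^ e) (f e) a * map_coeff 1 (g 0) 0 mod int p else 0)" if "i \<le> e" for i
    using map_coeff_comp_map_indecomposable[OF assms(3,4), of i "e - i" "f i" "g (e - i)"] fr that by auto
  have "(\<Sum>i\<le>e. ?t i) = (\<Sum>i\<in>{0, e}. ?t i)"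
    using t assms(4) by (intro sum.mono_neutral_right) auto
  also have "\<dots> = map_coeff 1 (f 0) 0 * map_coeff (p ^ e) (g e) a mod int p + map_coeff (p ^ e) (f e) a * map_coeff 1 (g 0) 0 mod int p"
    using t[of 0] t[of e] assms(4) by simp
  finally show ?thesis unfolding A_mult_frob(2)[OF assms(1,2) aL] by (simp add: mod_add_eq)
qed

text \<open>By \<open>map_coeff_A_mult_indecomposable\<close> the coefficients at indecomposable exponents behave like
  derivations, so they vanish on the subring once they vanish on its generators.\<close>
lemma generated_below_map_coeff:
  assumes "0 < e" "h \<in> generated_below A C e"
  shows "h \<in> carrier A \<and> (\<forall>a. indecomposable e a \<longrightarrow> map_coeff (p ^ e) (h e) a = 0)"
proof -
  have "h \<in> generate_ring A (\<Union>i<e. C i)" using assms unfolding generated_below_def by simp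
  then show ?thesis
  proof induction
    case one
    have "(\<lambda>x\<in>carrier R. x) \<in> frob 0" by (rule frobI2) auto
    then have "\<one>\<^bsub>A\<^esub> \<in> carrier A" unfolding A_one A_carrier using zero_map_frob by auto
    then show ?case unfolding A_one using assms(1) map_coeff_zero_map unfolding indecomposable_def by auto
  next
    case (incl h)
    then obtain i where i: "i < e" "h \<in> C i" by blast
    then have "h e = zero_map" "h \<in> carrier A" unfolding C_iff by auto
    then show ?case using map_coeff_zero_map unfolding indecomposable_def by auto
  next
    case (a_inv h)
    then have "h e \<in> frob e" unfolding A_carrier by simp
    then show ?case using a_inv A_inv[of h] A_neg_closed[of h] map_coeff_neg_map[of "h e" e] unfolding indecomposable_def by auto
  next
    case (eng_add f g)
    then have "f e \<in> frob e" "g e \<in> frob e" unfolding A_carrier by auto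
    then show ?case using eng_add A_add_closed[of f g] map_coeff_add_map[of "f e" e "g e"] unfolding A_add indecomposable_def by auto
  next
    case (eng_mult f g)
    then show ?case using A_mult_closed[of f g] map_coeff_A_mult_indecomposable[of f g e] assms(1) by auto
  qed
qed

definition homog where "homog e \<phi> = (\<lambda>i. if i = e then \<phi> else zero_map)"

lemma homog_C: "\<phi> \<in> frob e \<Longrightarrow> homog e \<phi> \<in> C e"
proof -
  assume "\<phi> \<in> frob e"
  moreover have "{i. homog e \<phi> i \<noteq> zero_map} \<subseteq> {e}" unfolding homog_def by auto
  then have "finite {i. homog e \<phi> i \<noteq> zero_map}" by (rule finite_subset) simp
  ultimately show ?thesis unfolding C_iff A_carrier using zero_map_frob by (auto simp: homog_def)
qed

lemma C_homog: "f \<in> C e \<Longrightarrow> f = homog e (f e)" unfolding C_iff homog_def by auto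

lemma homog_mult:
  assumes "\<phi> \<in> frob i" "\<psi> \<in> frob j"
  shows "homog i \<phi> \<otimes>\<^bsub>A\<^esub> homog j \<psi> = homog (i + j) (comp_map \<phi> \<psi>)"
proof
  fix k
  have h: "homog i \<phi> l (homog j \<psi> (k - l) x) = (if i = l then (if k = i + j then \<phi> (\<psi> x) else \<zero>) else \<zero>)"
    if "l \<in> {..k}" "x \<in> carrier R" for l x
  proof -
    have "homog j \<psi> (k - l) x \<in> carrier R" using that frob_closed[OF assms(2)] unfolding homog_def zero_map_def by auto
    moreover have "k = i + j \<longleftrightarrow> k - i = j" if "i = l" using that \<open>l \<in> {..k}\<close> by auto
    ultimately show ?thesis using that frob_zero[OF assms(1)] by (auto simp: homog_def zero_map_def)
  qed
  have "(\<Oplus>l\<in>{..k}. homog i \<phi> l (homog j \<psi> (k - l) x)) = (if k = i + j then \<phi> (\<psi> x) else \<zero>)" if x: "x \<in> carrier R" for x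
  proof -
    have c: "\<phi> (\<psi> x) \<in> carrier R" using frob_closed assms x by blast
    have "(\<Oplus>l\<in>{..k}. homog i \<phi> l (homog j \<psi> (k - l) x)) =
      (\<Oplus>l\<in>{..k}. if i = l then (if k = i + j then \<phi> (\<psi> x) else \<zero>) else \<zero>)"
      using h x c by (intro finsum_cong') auto
    also have "\<dots> = (if k = i + j then \<phi> (\<psi> x) else \<zero>)"
    proof (cases "i \<le> k")
      case True then show ?thesis using c finsum_singleton[of i "{..k}" "\<lambda>_. if k = i + j then \<phi> (\<psi> x) else \<zero>"] by auto
    next
      case False then show ?thesis by (subst add.finprod_one_eqI) auto
    qed
    finally show ?thesis .
  qed
  then show "(homog i \<phi> \<otimes>\<^bsub>A\<^esub> homog j \<psi>) k = homog (i + j) (comp_map \<phi> \<psi>) k"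
    unfolding A_mult homog_def[of "i + j"] comp_map_def zero_map_def by (auto intro!: restrict_ext)
qed

lemma C_mult: assumes "b \<in> C i" "f \<in> C j" shows "b \<otimes>\<^bsub>A\<^esub> f \<in> C (i + j)"
  using homog_mult[OF C_frob[OF assms(1)] C_frob[OF assms(2)]] C_homog[OF assms(1)] C_homog[OF assms(2)]
    homog_C[OF comp_map_frob[OF C_frob[OF assms(1)] C_frob[OF assms(2)]]] by metis

lemma C_add: "f \<in> C e \<Longrightarrow> g \<in> C e \<Longrightarrow> f \<oplus>\<^bsub>A\<^esub> g \<in> C e"
  using A_add_closed add_map_zero_map_zero_map unfolding C_iff A_add by auto

lemma C_neg: "f \<in> C e \<Longrightarrow> (\<lambda>i. neg_map (f i)) \<in> C e"
  using A_neg_closed neg_map_zero_map unfolding C_iff by auto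

end

section \<open>Counting generators of the Cartier algebra\<close>

context fp_monoid_ring
begin

text \<open>The elements whose vectors of coefficients at \<open>X\<close> are combinations of those of
  \<open>S\<close> form a bimodule that contains \<open>S\<close> and everything of lower degree.
  Hence the vectors of \<open>S\<close> span the functions on \<open>X\<close>, and counting both
  sides over the field with \<open>p\<close> elements gives \<open>p ^ card X \<le> p ^ card
  S\<close>.\<close>
lemma complexity_lower:
  assumes e: "0 < e" and X: "finite X" "\<And>a. a \<in> X \<Longrightarrow> indecomposable e a \<and> a \<in> map_exponents (p ^ e)"
  shows "enat (card X) \<le> complexity_sequence A C e"
  unfolding complexity_sequence_def
proof (rule INF_greatest)
  fix S assume "S \<in> {S. finite S \<and> generates_modulo_lower A C e S}"
  then have S: "finite S" "S \<subseteq> C e"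
    and gen: "\<And>N. sub_bimodule A (C 0) N \<Longrightarrow> N \<subseteq> C e \<Longrightarrow> generated_below A C e \<inter> C e \<subseteq> N \<Longrightarrow> S \<subseteq> N \<Longrightarrow> N = C e"
    unfolding generates_modulo_lower_def by auto
  interpret A: abelian_group A by (rule abelian_group_A)
  define co where "co f a = map_coeff (p ^ e) (f e) a" for f :: "nat \<Rightarrow> (nat ^ 'i \<Rightarrow> int) \<Rightarrow> nat ^ 'i \<Rightarrow> int" and a
  define N where "N = {f \<in> C e. \<exists>c. \<forall>a\<in>X. co f a = (\<Sum>s\<in>S. c s * co s a) mod int p}"
  have XL: "a \<in> exponent_group" if "a \<in> X" for a using X(2)[OF that] unfolding indecomposable_def by simp
  have NI: "f \<in> N" if "f \<in> C e" "\<And>a. a \<in> X \<Longrightarrow> co f a = (\<Sum>s\<in>S. c s * co s a) mod int p" for f c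
    using that unfolding N_def by blast
  have CA: "f \<in> carrier A" if "f \<in> C i" for f i using that unfolding C_iff by simp
  have lower: "f \<in> N" if "f \<in> C e" "\<And>a. a \<in> X \<Longrightarrow> co f a = 0" for f
    using NI[OF that(1), of "\<lambda>_. 0"] that(2) by simp
  have "subgroup N (add_monoid A)"
  proof (rule subgroup.intro)
    show "N \<subseteq> carrier (add_monoid A)" unfolding N_def using CA by auto
    show "\<one>\<^bsub>add_monoid A\<^esub> \<in> N"
    proof -
      have "\<zero>\<^bsub>A\<^esub> \<in> C e" unfolding C_iff A_zero A_carrier using zero_map_frob by simp
      then have "\<zero>\<^bsub>A\<^esub> \<in> N" by (rule lower) (simp add: co_def A_zero map_coeff_zero_map XL)
      then show ?thesis by simp
    qed
    fix f assume "f \<in> N"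
    then obtain c where f: "f \<in> C e" "\<And>a. a \<in> X \<Longrightarrow> co f a = (\<Sum>s\<in>S. c s * co s a) mod int p"
      unfolding N_def by blast
    have "\<ominus>\<^bsub>A\<^esub> f \<in> N"
    proof (rule NI[of _ "\<lambda>s. - c s"])
      show "\<ominus>\<^bsub>A\<^esub> f \<in> C e" unfolding A_inv[OF CA[OF f(1)]] by (rule C_neg[OF f(1)])
      fix a assume a: "a \<in> X"
      have "co (\<ominus>\<^bsub>A\<^esub> f) a = (- co f a) mod int p"
        unfolding A_inv[OF CA[OF f(1)]] co_def by (rule map_coeff_neg_map[OF C_frob[OF f(1)] XL[OF a]])
      also have "\<dots> = (\<Sum>s\<in>S. - c s * co s a) mod int p" unfolding f(2)[OF a] by (simp add: mod_minus_eq sum_negf)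
      finally show "co (\<ominus>\<^bsub>A\<^esub> f) a = (\<Sum>s\<in>S. - c s * co s a) mod int p" .
    qed
    then show "inv\<^bsub>add_monoid A\<^esub> f \<in> N" unfolding a_inv_def .
    fix g assume "g \<in> N"
    then obtain d where g: "g \<in> C e" "\<And>a. a \<in> X \<Longrightarrow> co g a = (\<Sum>s\<in>S. d s * co s a) mod int p"
      unfolding N_def by blast
    have "f \<oplus>\<^bsub>A\<^esub> g \<in> N"
    proof (rule NI[of _ "\<lambda>s. c s + d s"])
      show "f \<oplus>\<^bsub>A\<^esub> g \<in> C e" by (rule C_add[OF f(1) g(1)])
      fix a assume a: "a \<in> X"
      have "co (f \<oplus>\<^bsub>A\<^esub> g) a = (co f a + co g a) mod int p"
        unfolding A_add co_def by (rule map_coeff_add_map[OF C_frob[OF f(1)] C_frob[OF g(1)] XL[OF a]])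
      also have "\<dots> = (\<Sum>s\<in>S. (c s + d s) * co s a) mod int p"
        unfolding f(2)[OF a] g(2)[OF a] by (simp add: mod_add_eq distrib_right sum.distrib)
      finally show "co (f \<oplus>\<^bsub>A\<^esub> g) a = (\<Sum>s\<in>S. (c s + d s) * co s a) mod int p" .
    qed
    then show "f \<otimes>\<^bsub>add_monoid A\<^esub> g \<in> N" by simp
  qed
  moreover have "b \<otimes>\<^bsub>A\<^esub> f \<in> N \<and> f \<otimes>\<^bsub>A\<^esub> b \<in> N" if b: "b \<in> C 0" and fN: "f \<in> N" for b f
  proof -
    obtain c where f: "f \<in> C e" "\<And>a. a \<in> X \<Longrightarrow> co f a = (\<Sum>s\<in>S. c s * co s a) mod int p"
      using fN unfolding N_def by blast
    define u where "u = map_coeff 1 (b 0) 0"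
    have be: "co b a = 0" if "a \<in> X" for a
      using b e map_coeff_zero_map[OF XL[OF that]] unfolding co_def C_iff by simp
    have uf: "u * co f a mod int p = (\<Sum>s\<in>S. (u * c s) * co s a) mod int p" if "a \<in> X" for a
      unfolding f(2)[OF that] by (simp add: mod_mult_right_eq sum_distrib_left mult.assoc)
    have "co (b \<otimes>\<^bsub>A\<^esub> f) a = u * co f a mod int p" "co (f \<otimes>\<^bsub>A\<^esub> b) a = u * co f a mod int p" if a: "a \<in> X" for a
      using map_coeff_A_mult_indecomposable[OF CA[OF b] CA[OF f(1)], of e a] map_coeff_A_mult_indecomposable[OF CA[OF f(1)] CA[OF b], of e a]
        X(2)[OF a] e be[OF a] unfolding co_def u_def by (auto simp: mult.commute)
    then show ?thesis using NI[of "b \<otimes>\<^bsub>A\<^esub> f" "\<lambda>s. u * c s"] NI[of "f \<otimes>\<^bsub>A\<^esub> b" "\<lambda>s. u * c s"]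
        C_mult[OF b f(1)] C_mult[OF f(1) b] uf by simp
  qed
  ultimately have "sub_bimodule A (C 0) N" unfolding sub_bimodule_def by blast
  moreover have "generated_below A C e \<inter> C e \<subseteq> N"
  proof
    fix h assume h: "h \<in> generated_below A C e \<inter> C e"
    show "h \<in> N"
    proof (rule lower)
      show "h \<in> C e" using h by simp
      show "co h a = 0" if "a \<in> X" for a
        using generated_below_map_coeff[OF e, of h] h X(2)[OF that] unfolding co_def by simp
    qed
  qed
  moreover have "S \<subseteq> N"
  proof
    fix f assume f: "f \<in> S"
    show "f \<in> N"
    proof (rule NI[of _ "\<lambda>s. if s = f then 1 else 0"])
      show "f \<in> C e" using f S by auto
      fix a assume a: "a \<in> X"
      have "(\<Sum>s\<in>S. (if s = f then 1 else 0) * co s a) = (\<Sum>s\<in>S. if s = f then co s a else 0)"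
        by (rule sum.cong) auto
      also have "\<dots> = co f a" using f S(1) by simp
      finally show "co f a = (\<Sum>s\<in>S. (if s = f then 1 else 0) * co s a) mod int p"
        using map_coeff_range(1)[OF C_frob[OF \<open>f \<in> C e\<close>] XL[OF a]] unfolding co_def by simp
    qed
  qed
  ultimately have NC: "N = C e" using gen unfolding N_def by blast
  have "\<exists>c. \<forall>b\<in>X. (if a = b then 1 else 0) = (\<Sum>s\<in>S. c s * co s b) mod int p" if a: "a \<in> X" for a
  proof -
    have aT: "a \<in> map_exponents (p ^ e)" using X(2)[OF a] by simp
    then have "homog e (monomial_map (p ^ e) a) \<in> N" unfolding NC using homog_C[OF monomial_map_frob] by simp
    moreover have "co (homog e (monomial_map (p ^ e) a)) b = (if a = b then 1 else 0)" if "b \<in> X" for b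
      unfolding co_def homog_def using map_coeff_monomial_map[OF aT XL[OF that]] by simp
    ultimately show ?thesis unfolding N_def by auto
  qed
  then have "\<exists>c. \<forall>a\<in>X. \<forall>b\<in>X. (if a = b then 1 else 0) = (\<Sum>s\<in>S. c a s * co s b) mod int p"
    by (intro bchoice) blast
  then obtain c where c: "\<And>a b. a \<in> X \<Longrightarrow> b \<in> X \<Longrightarrow> (if a = b then 1 else 0) = (\<Sum>s\<in>S. c a s * co s b) mod int p"
    by blast
  let ?F = "{0..<int p}"
  let ?\<Phi> = "\<lambda>d. \<lambda>b\<in>X. (\<Sum>s\<in>S. d s * co s b) mod int p"
  have "(X \<rightarrow>\<^sub>E ?F) \<subseteq> ?\<Phi> ` (S \<rightarrow>\<^sub>E ?F)"
  proof
    fix t assume t: "t \<in> X \<rightarrow>\<^sub>E ?F"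
    define d where "d = (\<lambda>s\<in>S. (\<Sum>a\<in>X. t a * c a s) mod int p)"
    have "?\<Phi> d b = t b" for b
    proof (cases "b \<in> X")
      case True
      have "(\<Sum>s\<in>S. d s * co s b) mod int p = (\<Sum>s\<in>S. (\<Sum>a\<in>X. t a * c a s) * co s b) mod int p"
        by (rule mod_sum_cong) (simp add: d_def mod_mult_left_eq)
      also have "(\<Sum>s\<in>S. (\<Sum>a\<in>X. t a * c a s) * co s b) = (\<Sum>a\<in>X. t a * (\<Sum>s\<in>S. c a s * co s b))"
        unfolding sum_distrib_left sum_distrib_right by (subst sum.swap) (simp add: mult.assoc)
      also have "\<dots> mod int p = (\<Sum>a\<in>X. t a * (if a = b then 1 else 0)) mod int p"
        proof (rule mod_sum_cong)
          fix a assume a: "a \<in> X"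
          show "t a * (\<Sum>s\<in>S. c a s * co s b) mod int p = t a * (if a = b then 1 else 0) mod int p"
            unfolding c[OF a True] by (simp add: mod_mult_right_eq)
        qed
      also have "(\<Sum>a\<in>X. t a * (if a = b then 1 else 0)) = (\<Sum>a\<in>X. if a = b then t a else 0)"
        by (rule sum.cong) auto
      also have "\<dots> = t b" using True X(1) by simp
      also have "t b mod int p = t b" using t True by (auto simp: PiE_def Pi_def)
      finally show ?thesis using True by simp
    next
      case False then show ?thesis using PiE_arb[OF t False] by simp
    qed
    then have "t = ?\<Phi> d" by (intro ext) (rule sym)
    moreover have "d \<in> S \<rightarrow>\<^sub>E ?F" unfolding d_def using p_gt_1 by auto
    ultimately show "t \<in> ?\<Phi> ` (S \<rightarrow>\<^sub>E ?F)" by (rule image_eqI)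
  qed
  then have "card (X \<rightarrow>\<^sub>E ?F) \<le> card (S \<rightarrow>\<^sub>E ?F)"
    using S(1) by (intro surj_card_le finite_PiE) auto
  then have "p ^ card X \<le> p ^ card S" using X(1) S(1) by (simp add: card_PiE)
  then show "enat (card X) \<le> enat (card S)" using power_le_imp_le_exp[OF p_gt_1, of "card X" "card S"] by simp
qed

text \<open>The monomial maps of the exponents in \<open>Y\<close> generate, because every map of degree
  \<open>e\<close> has only finitely many nonzero coefficients. The set \<open>G\<close> of
  residues modulo \<open>p ^ e\<close> guarantees the finiteness: a map is determined by its
  values on the monomials of \<open>G\<close>.\<close>
lemma complexity_upper:
  assumes Y: "finite Y" "Y \<subseteq> map_exponents (p ^ e)"
    and gen: "\<And>a. a \<in> map_exponents (p ^ e) \<Longrightarrow> \<exists>y\<in>Y. \<exists>s\<in>Sm. a = y + int_vec s"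
    and G: "finite G" "G \<subseteq> Sm" "\<And>m. m \<in> Sm \<Longrightarrow> \<exists>g\<in>G. \<exists>s\<in>Sm. m = p ^ e *s s + g"
  shows "complexity_sequence A C e \<le> enat (card Y)"
proof -
  interpret A: abelian_group A by (rule abelian_group_A)
  let ?b = "\<lambda>a. homog e (monomial_map (p ^ e) a)"
  let ?S = "?b ` Y"
  have bC: "?b a \<in> C e" if "a \<in> map_exponents (p ^ e)" for a using homog_C[OF monomial_map_frob[OF that]] .
  have "N = C e" if N: "sub_bimodule A (C 0) N" "N \<subseteq> C e" "?S \<subseteq> N" for N
  proof -
    have sg: "subgroup N (add_monoid A)" and
      bi: "\<And>b x. b \<in> C 0 \<Longrightarrow> x \<in> N \<Longrightarrow> b \<otimes>\<^bsub>A\<^esub> x \<in> N" "\<And>b x. b \<in> C 0 \<Longrightarrow> x \<in> N \<Longrightarrow> x \<otimes>\<^bsub>A\<^esub> b \<in> N"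
      using N(1) unfolding sub_bimodule_def by auto
    define lmul where "lmul r = (\<lambda>x\<in>carrier R. r \<otimes> x)" for r
    have lmul: "lmul r \<in> frob 0" if "r \<in> carrier R" for r
      by (rule frobI2) (use that in \<open>auto simp: lmul_def r_distr m_lcomm\<close>)
    have bN: "?b a \<in> N" if a: "a \<in> map_exponents (p ^ e)" for a
    proof -
      obtain y s where ys: "y \<in> Y" "s \<in> Sm" "a = y + int_vec s" using gen[OF a] by blast
      have y: "y \<in> map_exponents (p ^ e)" using ys Y by auto
      have fr: "comp_map (monomial_map (p ^ e) y) (lmul (mon 1 s)) \<in> frob e"
        using comp_map_frob[OF monomial_map_frob[OF y] lmul[OF mon_1_carrier[OF ys(2)]]] by simp
      have "comp_map (monomial_map (p ^ e) y) (lmul (mon 1 s)) = monomial_map (p ^ e) a"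
      proof (rule frob_eqI[OF fr monomial_map_frob[OF a]])
        fix b assume "b \<in> exponent_group"
        then obtain m n where mn: "m \<in> Sm" "n \<in> Sm" "b = map_exponent (p ^ e) m n" using exponent_group_map_exponent[OF _ pe_pos] by blast
        have "mon 1 s \<otimes> mon 1 m = mon 1 (s + m)" using mon_mult_mon[of 1 1 s m] ys(2) mn(1) p_gt_1 by simp
        then have "comp_map (monomial_map (p ^ e) y) (lmul (mon 1 s)) (mon 1 m) n = monomial_map (p ^ e) y (mon 1 (s + m)) n"
          using mon_1_carrier[OF mn(1)] by (simp add: comp_map_def lmul_def)
        also have "\<dots> = monomial_map (p ^ e) a (mon 1 m) n"
          unfolding monomial_map_mon[OF Sm_add[OF ys(2) mn(1)] mn(2)] monomial_map_mon[OF mn(1,2)] ys(3) map_exponent_def int_vec_add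
          by (auto simp: algebra_simps)
        finally show "map_coeff (p ^ e) (comp_map (monomial_map (p ^ e) y) (lmul (mon 1 s))) b = map_coeff (p ^ e) (monomial_map (p ^ e) a) b"
          unfolding mn(3) map_coeff_eq[OF fr mn(1,2)] map_coeff_eq[OF monomial_map_frob[OF a] mn(1,2)] .
      qed
      then have "?b a = ?b y \<otimes>\<^bsub>A\<^esub> homog 0 (lmul (mon 1 s))"
        using homog_mult[OF monomial_map_frob[OF y] lmul[OF mon_1_carrier[OF ys(2)]]] by simp
      then show ?thesis using bi(2) homog_C[OF lmul[OF mon_1_carrier[OF ys(2)]]] N(3) ys(1) by auto
    qed
    have smult: "homog e (comp_map (lmul (mon c 0)) (monomial_map (p ^ e) a)) \<in> N" if "a \<in> map_exponents (p ^ e)" "c \<in> {0..<int p}" for a c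
    proof -
      have l: "lmul (mon c 0) \<in> frob 0" using lmul[OF mon_carrier[OF that(2) Sm_zero]] .
      show ?thesis using homog_mult[OF l monomial_map_frob[OF that(1)]] bi(1)[OF homog_C[OF l] bN[OF that(1)]] by simp
    qed
    have map_coeff_smult: "map_coeff (p ^ e) (comp_map (lmul (mon c 0)) (monomial_map (p ^ e) a)) b = (if a = b then c else 0)"
      "comp_map (lmul (mon c 0)) (monomial_map (p ^ e) a) \<in> frob e"
      if a: "a \<in> map_exponents (p ^ e)" and c: "c \<in> {0..<int p}" and b: "b \<in> exponent_group" for a b c
    proof -
      show fr: "comp_map (lmul (mon c 0)) (monomial_map (p ^ e) a) \<in> frob e"
        using comp_map_frob[OF lmul[OF mon_carrier[OF c Sm_zero]] monomial_map_frob[OF a]] by simp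
      obtain m n where mn: "m \<in> Sm" "n \<in> Sm" "b = map_exponent (p ^ e) m n" using exponent_group_map_exponent[OF b pe_pos] .
      have "monomial_map (p ^ e) a (mon 1 m) \<in> carrier R" using frob_closed[OF monomial_map_frob[OF a] mon_1_carrier[OF mn(1)]] .
      then have "comp_map (lmul (mon c 0)) (monomial_map (p ^ e) a) (mon 1 m) n = c * monomial_map (p ^ e) a (mon 1 m) n mod int p"
        using mon_mult(1)[OF c Sm_zero, of "monomial_map (p ^ e) a (mon 1 m)" n] mon_1_carrier[OF mn(1)]
        by (simp add: comp_map_def lmul_def)
      then show "map_coeff (p ^ e) (comp_map (lmul (mon c 0)) (monomial_map (p ^ e) a)) b = (if a = b then c else 0)"
        unfolding mn(3) map_coeff_eq[OF fr mn(1,2)] using monomial_map_mon[OF mn(1,2)] c by simp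
    qed
    have "\<forall>f\<in>C e. {a \<in> exponent_group. map_coeff (p ^ e) (f e) a \<noteq> 0} \<subseteq> B \<longrightarrow> f \<in> N" if "finite B" for B
      using that
    proof (induction B)
      case empty
      show ?case
      proof (intro ballI impI)
        fix f assume f: "f \<in> C e" "{a \<in> exponent_group. map_coeff (p ^ e) (f e) a \<noteq> 0} \<subseteq> {}"
        then have "f e = zero_map" by (intro frob_eqI[OF C_frob[OF f(1)] zero_map_frob]) (auto simp: map_coeff_zero_map)
        then have "f = \<zero>\<^bsub>A\<^esub>" using f(1) unfolding C_iff A_zero by auto
        then show "f \<in> N" using subgroup.one_closed[OF sg] by simp
      qed
    next
      case (insert a B)
      show ?case
      proof (intro ballI impI)
        fix f assume f: "f \<in> C e" "{b \<in> exponent_group. map_coeff (p ^ e) (f e) b \<noteq> 0} \<subseteq> insert a B"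
        show "f \<in> N"
        proof (cases "a \<in> exponent_group \<and> map_coeff (p ^ e) (f e) a \<noteq> 0")
          case False
          then have "{b \<in> exponent_group. map_coeff (p ^ e) (f e) b \<noteq> 0} \<subseteq> B" using f(2) by auto
          then show ?thesis using insert f(1) by blast
        next
          case True
          define c where "c = map_coeff (p ^ e) (f e) a"
          have fe: "f e \<in> frob e" using C_frob[OF f(1)] .
          have c: "c \<in> {0..<int p}" "c \<noteq> 0" "int p - c \<in> {0..<int p}"
            using map_coeff_range(2)[OF fe, of a] True unfolding c_def by (auto simp: less_le)
          have aT: "a \<in> map_exponents (p ^ e)" using map_coeff_map_exponents[OF fe] True by simp
          let ?g = "\<lambda>c. comp_map (lmul (mon c 0)) (monomial_map (p ^ e) a)"
          define h where "h = homog e (add_map (f e) (?g (int p - c)))"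
          have g: "?g c \<in> frob e" "?g (int p - c) \<in> frob e" using map_coeff_smult(2)[OF aT _ _, of _ a] True c by auto
          have hf: "add_map (f e) (?g (int p - c)) \<in> frob e" using add_map_frob[OF fe g(2)] .
          have kh: "map_coeff (p ^ e) (h e) b = (map_coeff (p ^ e) (f e) b + (if a = b then int p - c else 0)) mod int p" if "b \<in> exponent_group" for b
            unfolding h_def homog_def using map_coeff_add_map[OF fe g(2) that] map_coeff_smult(1)[OF aT c(3) that] by simp
          have "map_coeff (p ^ e) (h e) a = 0" using kh[of a] True c_def by simp
          moreover have "map_coeff (p ^ e) (h e) b = map_coeff (p ^ e) (f e) b" if "b \<in> exponent_group" "b \<noteq> a" for b
            using kh[OF that(1)] that map_coeff_range(1)[OF fe that(1)] by auto
          ultimately have "b \<in> B" if "b \<in> exponent_group" "map_coeff (p ^ e) (h e) b \<noteq> 0" for b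
            using f(2) that by (cases "b = a") auto
          then have "{b \<in> exponent_group. map_coeff (p ^ e) (h e) b \<noteq> 0} \<subseteq> B" by blast
          then have hN: "h \<in> N" using insert.IH homog_C[OF hf] unfolding h_def by blast
          have he: "h e \<in> frob e" unfolding h_def homog_def using hf by simp
          have "add_map (h e) (?g c) = f e"
          proof (rule frob_eqI[OF add_map_frob[OF he g(1)] fe])
            fix b assume b: "b \<in> exponent_group"
            show "map_coeff (p ^ e) (add_map (h e) (?g c)) b = map_coeff (p ^ e) (f e) b"
              using map_coeff_add_map[OF he g(1) b] kh[OF b] map_coeff_smult(1)[OF aT c(1) b] map_coeff_range(1)[OF fe b] c_def
              by (auto simp: mod_add_left_eq)
          qed
          then have "f i = add_map (h i) (homog e (?g c) i)" for i
            using f(1) add_map_zero_map_zero_map by (cases "i = e") (simp_all add: h_def homog_def C_iff)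
          then have "f = h \<oplus>\<^bsub>A\<^esub> homog e (?g c)" unfolding A_add by (intro ext) simp
          then show ?thesis using subgroup.m_closed[OF sg hN smult[OF aT c(1)]] by simp
        qed
      qed
    qed
    moreover have "finite {a \<in> exponent_group. map_coeff (p ^ e) (f e) a \<noteq> 0}" if f: "f \<in> C e" for f
    proof -
      have fe: "f e \<in> frob e" using C_frob[OF f] .
      let ?P = "SIGMA g:G. {k. f e (mon 1 g) k \<noteq> 0}"
      have "{a \<in> exponent_group. map_coeff (p ^ e) (f e) a \<noteq> 0} \<subseteq> (\<lambda>(g, k). map_exponent (p ^ e) g k) ` ?P"
      proof
        fix a assume a: "a \<in> {a \<in> exponent_group. map_coeff (p ^ e) (f e) a \<noteq> 0}"
        then obtain m n where mn: "m \<in> Sm" "n \<in> Sm" "a = map_exponent (p ^ e) m n" using exponent_group_map_exponent[OF _ pe_pos] by blast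
        then have nz: "f e (mon 1 m) n \<noteq> 0" using a map_coeff_eq[OF fe mn(1,2)] by simp
        obtain g s where gs: "g \<in> G" "s \<in> Sm" "m = p ^ e *s s + g" using G(3)[OF mn(1)] by blast
        have g: "g \<in> Sm" using gs G by auto
        have c: "f e (mon 1 g) \<in> carrier R" using frob_closed[OF fe mon_1_carrier[OF g]] .
        have nz': "(mon 1 s \<otimes> f e (mon 1 g)) n \<noteq> 0" using nz frob_shift[OF fe g gs(2)] gs(3) by simp
        then obtain k where k: "n = s + k" using mon_mult(2)[OF _ gs(2) c, of 1 n] p_gt_1 by auto
        then have "f e (mon 1 g) k \<noteq> 0" using nz' mon_mult(1)[OF _ gs(2) c, of 1 k] p_gt_1 by auto
        moreover have "a = map_exponent (p ^ e) g k"
          unfolding mn(3) gs(3) k map_exponent_def int_vec_add int_vec_smult by (simp add: vec_eq_iff algebra_simps)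
        ultimately show "a \<in> (\<lambda>(g, k). map_exponent (p ^ e) g k) ` ?P" using gs(1) by force
      qed
      moreover have "finite ?P"
        using G carrier_D(2) frob_closed[OF fe mon_1_carrier] by (intro finite_SigmaI) auto
      ultimately show ?thesis using finite_subset by blast
    qed
    ultimately have "C e \<subseteq> N" by blast
    then show "N = C e" using N(2) by blast
  qed
  then have "generates_modulo_lower A C e ?S" unfolding generates_modulo_lower_def using bC Y(2) by auto
  then have "complexity_sequence A C e \<le> enat (card ?S)"
    unfolding complexity_sequence_def using Y(1) by (intro INF_lower) simp
  also have "\<dots> \<le> enat (card Y)" using card_image_le[OF Y(1)] by simp
  finally show ?thesis .
qed

end

section \<open>Hibi rings as monoid rings\<close>

lemma residue_finsum:
  assumes "1 < p" "finite A" "\<And>x. x \<in> A \<Longrightarrow> f x \<in> {0..<int p}"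
  shows "finsum (residue_ring (int p)) f A = (\<Sum>x\<in>A. f x) mod int p"
  using assms(2,3)
proof (induction A)
  case empty
  interpret residues "int p" "residue_ring (int p)" using assms(1) by unfold_locales auto
  show ?case by (simp add: res_zero_eq)
next
  case (insert x A)
  interpret residues "int p" "residue_ring (int p)" using assms(1) by unfold_locales auto
  have "f \<in> insert x A \<rightarrow> carrier (residue_ring (int p))" using insert.prems by (auto simp: res_carrier_eq)
  then have "finsum (residue_ring (int p)) f (insert x A) = f x \<oplus>\<^bsub>residue_ring (int p)\<^esub> finsum (residue_ring (int p)) f A"
    using insert.hyps by (intro finsum_insert) auto
  then show ?case using insert by (simp add: res_add_eq mod_add_right_eq)
qed

lemma fp_monoid_ring_restrict:
  assumes "fp_monoid_ring p R Sm" "Sm' \<subseteq> Sm" "0 \<in> Sm'" "\<And>s t. s \<in> Sm' \<Longrightarrow> t \<in> Sm' \<Longrightarrow> s + t \<in> Sm'"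
  shows "fp_monoid_ring p (R\<lparr>carrier := {f \<in> carrier R. \<forall>m. f m \<noteq> 0 \<longrightarrow> m \<in> Sm'}\<rparr>) Sm'"
proof -
  interpret fp_monoid_ring p R Sm by (rule assms(1))
  show ?thesis
    using assms prime_p carrier_R mult_R add_R one_R zero_R by unfold_locales auto
qed

lemma (in fp_monoid_ring) minus_eval: "f \<in> carrier R \<Longrightarrow> f m = 0 \<Longrightarrow> (\<ominus> f) m = 0"
proof -
  assume f: "f \<in> carrier R" "f m = 0"
  have "(f \<oplus> \<ominus> f) m = 0" using r_neg[OF f(1)] zero_R by simp
  then show ?thesis using add_eval[OF f(1) a_inv_closed[OF f(1)], of m] f(2) carrier_D(4)[OF a_inv_closed[OF f(1)]]
    by simp
qed

lemma (in fp_monoid_ring) mult_support: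
  assumes "f \<in> carrier R" "g \<in> carrier R" "(f \<otimes> g) m \<noteq> 0"
  shows "\<exists>k j. m = k + j \<and> f k \<noteq> 0 \<and> g j \<noteq> 0"
proof (rule ccontr)
  assume no: "\<not> (\<exists>k j. m = k + j \<and> f k \<noteq> 0 \<and> g j \<noteq> 0)"
  have "f (fst ab) * g (snd ab) = 0" if "fst ab + snd ab = m" for ab
    using no that by (metis mult_eq_0_iff)
  then have "(\<Sum>ab\<in>{ab. fst ab + snd ab = m}. f (fst ab) * g (snd ab)) = 0"
    by (intro sum.neutral) blast
  then show False using assms(3) mult_R[OF assms(1,2)] by simp
qed

text \<open>The measure \<open>\<mu>\<close> drives the induction that writes each monomial as a product of
  generators.\<close>
lemma (in fp_monoid_ring) generate_monoid_ring:
  assumes gens: "E \<subseteq> Sm'" and sub: "Sm' \<subseteq> Sm"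
    and S0: "0 \<in> Sm'" and Sadd: "\<And>s t. s \<in> Sm' \<Longrightarrow> t \<in> Sm' \<Longrightarrow> s + t \<in> Sm'"
    and dec: "\<And>m. m \<in> Sm' \<Longrightarrow> m \<noteq> 0 \<Longrightarrow> \<exists>g\<in>E. \<exists>m'\<in>Sm'. m = g + m' \<and> \<mu> m' < (\<mu> m :: nat)"
  shows "generate_ring R ((\<lambda>c. mon c 0) ` {0..<int p} \<union> mon 1 ` E) = {f \<in> carrier R. \<forall>m. f m \<noteq> 0 \<longrightarrow> m \<in> Sm'}"
    (is "?G = ?R'")
proof
  have mon0: "mon c 0 \<in> ?R'" if "c \<in> {0..<int p}" for c
    using that mon_carrier[OF that Sm_zero] S0 by (auto simp: mon_def)
  have mon1: "mon 1 s \<in> ?R'" if "s \<in> Sm'" for s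
    using that sub mon_1_carrier by (auto simp: mon_def)
  show "?G \<subseteq> ?R'"
  proof
    fix f assume "f \<in> ?G"
    then show "f \<in> ?R'"
    proof induction
      case one
      show ?case using mon1[OF S0] one_R by simp
    next
      case (incl h) then show ?case using mon0 mon1 gens by blast
    next
      case (a_inv h) then show ?case using minus_eval by auto
    next
      case (eng_add f g)
      have "f m \<noteq> 0 \<or> g m \<noteq> 0" if "(f \<oplus> g) m \<noteq> 0" for m
        using that add_eval[of f g m] eng_add by auto
      then show ?case using eng_add by auto
    next
      case (eng_mult f g)
      have "m \<in> Sm'" if nz: "(f \<otimes> g) m \<noteq> 0" for m
      proof -
        obtain k j where "m = k + j" "f k \<noteq> 0" "g j \<noteq> 0" using mult_support[OF _ _ nz] eng_mult by blast
        then have "k \<in> Sm'" "j \<in> Sm'" "m = k + j" using eng_mult by auto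
        then show ?thesis using Sadd by simp
      qed
      then show ?case using eng_mult by auto
    qed
  qed
  have g1: "mon 1 m \<in> ?G" if "m \<in> Sm'" for m
    using that
  proof (induction "\<mu> m" arbitrary: m rule: less_induct)
    case less
    show ?case
    proof (cases "m = 0")
      case True then show ?thesis using generate_ring.one[of R] one_R by simp
    next
      case False
      then obtain g m' where g: "g \<in> E" "m' \<in> Sm'" "m = g + m'" "\<mu> m' < \<mu> m" using dec less by blast
      have "mon 1 g \<otimes> mon 1 m' = mon 1 m"
        using mon_mult_mon[of 1 1 g m'] g gens sub p_gt_1 by auto
      moreover have "mon 1 g \<in> ?G" "mon 1 m' \<in> ?G" using g less by (auto intro: generate_ring.incl)
      ultimately show ?thesis using generate_ring.eng_mult by metis
    qed
  qed
  interpret R': fp_monoid_ring p "R\<lparr>carrier := ?R'\<rparr>" Sm'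
    by (rule fp_monoid_ring_restrict) (use fp_monoid_ring_axioms sub S0 Sadd in auto)
  show "?R' \<subseteq> ?G"
  proof
    fix f assume "f \<in> ?R'"
    then have "f \<in> carrier (R\<lparr>carrier := ?R'\<rparr>)" by simp
    then show "f \<in> ?G"
    proof (induction f rule: R'.carrier_induct)
      case zero
      show ?case using zero_in_generate by simp
    next
      case (mon c s)
      have "mon c 0 \<otimes> mon 1 s = mon c s" using mon_mult_mon[of c 1 0 s] mon sub Sm_zero p_gt_1 by auto
      moreover have "mon c 0 \<in> ?G" using mon by (auto intro: generate_ring.incl)
      ultimately show ?case using generate_ring.eng_mult[of "mon c 0"] g1[OF mon(2)] by metis
    next
      case (add f g) then show ?case using generate_ring.eng_add by simp
    qed
  qed
qed

lemma mpoly_ring_fp: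
  assumes "Factorial_Ring.prime p"
  shows "fp_monoid_ring p (mpoly_ring (residue_ring (int p)) V) {m. \<forall>i. m $ i \<noteq> 0 \<longrightarrow> i \<in> V}"
proof -
  have p: "1 < p" using assms prime_gt_1_nat by simp
  interpret K: residues "int p" "residue_ring (int p)" using p by unfold_locales auto
  have car: "carrier (residue_ring (int p)) = {0..<int p}" by (auto simp: K.res_carrier_eq)
  show ?thesis
  proof
    show "carrier (mpoly_ring (residue_ring (int p)) V) =
      {f. (\<forall>m. f m \<in> {0..<int p}) \<and> finite {m. f m \<noteq> 0} \<and> (\<forall>m. f m \<noteq> 0 \<longrightarrow> m \<in> {m. \<forall>i. m $ i \<noteq> 0 \<longrightarrow> i \<in> V})}"
      unfolding mpoly_ring_def by (simp add: car K.res_zero_eq)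
    show "\<one>\<^bsub>mpoly_ring (residue_ring (int p)) V\<^esub> = mon 1 0"
      unfolding mpoly_ring_def mon_def K.res_one_eq K.res_zero_eq by simp
    show "\<zero>\<^bsub>mpoly_ring (residue_ring (int p)) V\<^esub> = (\<lambda>m. 0)"
      unfolding mpoly_ring_def by (simp add: K.res_zero_eq)
    fix f g assume "f \<in> carrier (mpoly_ring (residue_ring (int p)) V)" "g \<in> carrier (mpoly_ring (residue_ring (int p)) V)"
    show "f \<oplus>\<^bsub>mpoly_ring (residue_ring (int p)) V\<^esub> g = (\<lambda>m. (f m + g m) mod int p)"
      unfolding mpoly_ring_def by (simp add: K.res_add_eq)
    show "f \<otimes>\<^bsub>mpoly_ring (residue_ring (int p)) V\<^esub> g =
      (\<lambda>m. (\<Sum>ab\<in>{ab. fst ab + snd ab = m}. f (fst ab) * g (snd ab)) mod int p)"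
    proof
      fix m
      have "(f \<otimes>\<^bsub>mpoly_ring (residue_ring (int p)) V\<^esub> g) m =
         (\<Oplus>\<^bsub>residue_ring (int p)\<^esub>ab\<in>{ab. fst ab + snd ab = m}. (f (fst ab) * g (snd ab)) mod int p)"
        unfolding mpoly_ring_def by (simp add: K.res_mult_eq)
      also have "\<dots> = (\<Sum>ab\<in>{ab. fst ab + snd ab = m}. (f (fst ab) * g (snd ab)) mod int p) mod int p"
        using p by (intro residue_finsum finite_splits) auto
      finally show "(f \<otimes>\<^bsub>mpoly_ring (residue_ring (int p)) V\<^esub> g) m =
         (\<Sum>ab\<in>{ab. fst ab + snd ab = m}. f (fst ab) * g (snd ab)) mod int p" by (simp add: mod_sum_eq)
    qed
  qed (use assms in auto)
qed

definition hibi_monoid :: "'v::finite set \<Rightarrow> ('v \<times> 'v) set \<Rightarrow> (nat ^ 'v option) set" where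
  "hibi_monoid P r = {m. (\<forall>v. v \<notin> P \<longrightarrow> m $ Some v = 0) \<and> (\<forall>v. m $ Some v \<le> m $ None) \<and>
     (\<forall>u v. (u, v) \<in> r \<longrightarrow> m $ Some v \<le> m $ Some u)}"

lemma hibi_monoid_zero: "0 \<in> hibi_monoid P r" unfolding hibi_monoid_def by simp
lemma hibi_monoid_add: "s \<in> hibi_monoid P r \<Longrightarrow> t \<in> hibi_monoid P r \<Longrightarrow> s + t \<in> hibi_monoid P r"
  unfolding hibi_monoid_def by (auto simp: add_mono)

lemma hibi_exponent_monoid:
  assumes "r \<subseteq> P \<times> P" "I \<in> poset_ideals P r" shows "hibi_exponent I \<in> hibi_monoid P r"
  using assms unfolding poset_ideals_def hibi_exponent_def hibi_monoid_def by auto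

text \<open>Split off the ideal of all elements with positive exponent.\<close>
lemma hibi_monoid_decompose:
  assumes "r \<subseteq> P \<times> P" "m \<in> hibi_monoid P r" "m \<noteq> 0"
  shows "\<exists>I\<in>poset_ideals P r. \<exists>m'\<in>hibi_monoid P r. m = hibi_exponent I + m' \<and> m' $ None < m $ None"
proof -
  define I where "I = {v. m $ Some v \<noteq> 0}"
  define m' where "m' = (\<chi> i. m $ i - 1)"
  have N: "m $ None \<noteq> 0"
  proof
    assume 0: "m $ None = 0"
    have "m $ i = 0" for i
    proof (cases i)
      case (Some v)
      have "m $ Some v \<le> m $ None" using assms(2) unfolding hibi_monoid_def by simp
      then show ?thesis using 0 Some by simp
    qed (use 0 in simp)
    then show False using assms(3) by (simp add: vec_eq_iff)
  qed
  have "I \<in> poset_ideals P r"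
    using assms(1,2) unfolding poset_ideals_def I_def hibi_monoid_def by fastforce
  moreover have "m' \<in> hibi_monoid P r"
    using assms(2) unfolding m'_def hibi_monoid_def by (auto intro: diff_le_mono)
  moreover have "m = hibi_exponent I + m'"
    using N unfolding m'_def hibi_exponent_def I_def by (auto simp: vec_eq_iff split: option.splits)
  ultimately show ?thesis using N unfolding m'_def by force
qed

lemma hibi_ring_fp:
  fixes P :: "'v::finite set"
  assumes "Factorial_Ring.prime p" "r \<subseteq> P \<times> P"
  shows "fp_monoid_ring p (hibi_ring (residue_ring (int p)) P r) (hibi_monoid P r)"
proof -
  let ?K = "residue_ring (int p)"
  let ?V = "insert None (Some ` P)"
  let ?Vm = "{m :: nat ^ 'v option. \<forall>i. m $ i \<noteq> 0 \<longrightarrow> i \<in> ?V}"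
  have p: "1 < p" using assms prime_gt_1_nat by simp
  interpret K: residues "int p" ?K using p by unfold_locales auto
  interpret amb: fp_monoid_ring p "hibi_ambient_ring ?K P" ?Vm
    unfolding hibi_ambient_ring_def by (rule mpoly_ring_fp[OF assms(1)])
  have sub: "hibi_monoid P r \<subseteq> ?Vm"
  proof
    fix m assume m: "m \<in> hibi_monoid P r"
    have "i \<in> ?V" if "m $ i \<noteq> 0" for i using that m unfolding hibi_monoid_def by (cases i) auto
    then show "m \<in> ?Vm" by simp
  qed
  have "(\<lambda>c. mterm ?K c (0 :: nat ^ 'v option)) ` carrier ?K = (\<lambda>c. mon c 0) ` {0..<int p}"
    unfolding mterm_def mon_def K.res_zero_eq K.res_carrier_eq by (rule image_cong) auto
  moreover have "(\<lambda>I. mterm ?K \<one>\<^bsub>?K\<^esub> (hibi_exponent I)) ` poset_ideals P r = mon 1 ` hibi_exponent ` poset_ideals P r"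
    unfolding mterm_def mon_def K.res_zero_eq K.res_one_eq by auto
  moreover have "generate_ring (hibi_ambient_ring ?K P)
      ((\<lambda>c. mon c 0) ` {0..<int p} \<union> mon 1 ` hibi_exponent ` poset_ideals P r) =
      {f \<in> carrier (hibi_ambient_ring ?K P). \<forall>m. f m \<noteq> 0 \<longrightarrow> m \<in> hibi_monoid P r}"
    by (rule amb.generate_monoid_ring[OF _ sub hibi_monoid_zero hibi_monoid_add, where \<mu> = "\<lambda>m. m $ None"])
      (use hibi_exponent_monoid[OF assms(2)] hibi_monoid_decompose[OF assms(2)] in auto)
  ultimately have "hibi_ring ?K P r =
     (hibi_ambient_ring ?K P)\<lparr>carrier := {f \<in> carrier (hibi_ambient_ring ?K P). \<forall>m. f m \<noteq> 0 \<longrightarrow> m \<in> hibi_monoid P r}\<rparr>"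
    unfolding hibi_ring_def by (simp only:)
  then show ?thesis
    using fp_monoid_ring_restrict[OF amb.fp_monoid_ring_axioms sub hibi_monoid_zero hibi_monoid_add] by simp
qed

lemma hibi_monoid_sum:
  fixes P :: "'v::finite set"
  assumes "r \<subseteq> P \<times> P" "m \<in> hibi_monoid P r"
  shows "\<exists>c. m = (\<Sum>I\<in>poset_ideals P r. c I *s hibi_exponent I)"
  using assms(2)
proof (induction "m $ None" arbitrary: m rule: less_induct)
  case less
  have fin: "finite (poset_ideals P r)" by simp
  show ?case
  proof (cases "m = 0")
    case True
    then have "m = (\<Sum>I\<in>poset_ideals P r. 0 *s hibi_exponent I)" by (simp add: vec_eq_iff)
    then show ?thesis by (rule exI[of _ "\<lambda>_. 0"])
  next
    case False
    then obtain J m' where J: "J \<in> poset_ideals P r" "m' \<in> hibi_monoid P r" "m = hibi_exponent J + m'" "m' $ None < m $ None"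
      using hibi_monoid_decompose[OF assms(1) less.prems] by blast
    then obtain c where c: "m' = (\<Sum>I\<in>poset_ideals P r. c I *s hibi_exponent I)" using less.hyps by blast
    have "(\<Sum>I\<in>poset_ideals P r. (if I = J then 1 else 0) *s hibi_exponent I) = 
        (\<Sum>I\<in>poset_ideals P r. if I = J then hibi_exponent I else 0 :: nat ^ 'v option)"
      by (rule sum.cong) (auto simp: vec_eq_iff)
    also have "\<dots> = hibi_exponent J" using J(1) fin by simp
    finally have "m = (\<Sum>I\<in>poset_ideals P r. ((if I = J then 1 else 0) + c I) *s hibi_exponent I)"
      using J(3) c by (simp add: vector_sadd_rdistrib sum.distrib)
    then show ?thesis by (rule exI[of _ "\<lambda>I. (if I = J then 1 else 0) + c I"])
  qed
qed

text \<open>Write the exponent as a combination of the generators and divide the coefficients by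
  \<open>q\<close> with remainder.\<close>
lemma hibi_monoid_residues:
  fixes P :: "'v::finite set"
  assumes r: "r \<subseteq> P \<times> P" and q: "0 < q"
  shows "\<exists>G. finite G \<and> G \<subseteq> hibi_monoid P r \<and>
    (\<forall>m\<in>hibi_monoid P r. \<exists>g\<in>G. \<exists>s\<in>hibi_monoid P r. m = q *s s + g)"
proof -
  let ?I = "poset_ideals P r"
  define S where "S c = (\<Sum>I\<in>?I. c I *s hibi_exponent I)" for c :: "'v set \<Rightarrow> nat"
  have mult: "n *s s \<in> hibi_monoid P r" if "s \<in> hibi_monoid P r" for s and n :: nat
    using that unfolding hibi_monoid_def by auto
  have S: "S c \<in> hibi_monoid P r" for c
  proof -
    have "(\<Sum>I\<in>J. c I *s hibi_exponent I) \<in> hibi_monoid P r" if "J \<subseteq> ?I" for J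
      using finite[of J] that
      by (induction J rule: finite_induct) (auto intro: hibi_monoid_zero hibi_monoid_add mult hibi_exponent_monoid[OF r])
    then show ?thesis unfolding S_def by simp
  qed
  define G where "G = S ` (?I \<rightarrow>\<^sub>E {..<q})"
  have "finite G" unfolding G_def by (intro finite_imageI finite_PiE) auto
  moreover have "G \<subseteq> hibi_monoid P r" unfolding G_def using S by auto
  moreover have "\<exists>g\<in>G. \<exists>s\<in>hibi_monoid P r. m = q *s s + g" if m: "m \<in> hibi_monoid P r" for m
  proof -
    obtain c where c: "m = S c" using hibi_monoid_sum[OF r m] unfolding S_def by blast
    define d where "d = (\<lambda>I\<in>?I. c I mod q)"
    have "d \<in> ?I \<rightarrow>\<^sub>E {..<q}" unfolding d_def using q by auto
    then have "S d \<in> G" unfolding G_def by (rule imageI)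
    moreover have "m = q *s S (\<lambda>I. c I div q) + S d"
    proof -
      have "c I *s hibi_exponent I = q *s ((c I div q) *s hibi_exponent I) + d I *s hibi_exponent I"
        if "I \<in> ?I" for I
      proof -
        have cI: "c I = q * (c I div q) + d I" using that unfolding d_def by simp
        show ?thesis by (subst cI) (simp add: vec_eq_iff algebra_simps)
      qed
      then have "m = (\<Sum>I\<in>?I. q *s ((c I div q) *s hibi_exponent I) + d I *s hibi_exponent I)"
        unfolding c S_def by (intro sum.cong) auto
      also have "\<dots> = q *s S (\<lambda>I. c I div q) + S d"
        unfolding S_def sum.distrib by (simp add: vec_eq_iff sum_distrib_left mult.assoc)
      finally show ?thesis .
    qed
    ultimately show ?thesis using S by blast
  qed
  ultimately show ?thesis by blast
qed

section \<open>Monomials as functions on the extended poset\<close>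

text \<open>The extended poset: \<open>Some None\<close> is the new bottom, the index of \<open>t\<close>,
  and \<open>None\<close> is the new top.\<close>
definition hat_set :: "'v set \<Rightarrow> 'v option option set" where
  "hat_set P = insert None (Some ` insert None (Some ` P))"

definition hat_le :: "'v set \<Rightarrow> ('v \<times> 'v) set \<Rightarrow> 'v option option \<Rightarrow> 'v option option \<Rightarrow> bool" where
  "hat_le P r x y \<longleftrightarrow> x \<in> hat_set P \<and> y \<in> hat_set P \<and>
     (y = None \<or> x = Some None \<or> (\<exists>u v. x = Some (Some u) \<and> y = Some (Some v) \<and> (u, v) \<in> r))"

lemma hat_poset:
  fixes P :: "'v::finite set"
  assumes "partial_order_on P r"
  shows "bounded_poset (hat_set P) (hat_le P r) (Some None) None"
proof -
  note po = partial_order_onD[OF assms]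
  show ?thesis
  proof
    show "finite (hat_set P)" by simp
    fix x y z
    show "x \<in> hat_set P \<Longrightarrow> hat_le P r x x"
      unfolding hat_le_def using po(1) unfolding hat_set_def refl_on_def by auto
    show "hat_le P r x y \<Longrightarrow> hat_le P r y x \<Longrightarrow> x = y"
      unfolding hat_le_def using po(3) unfolding antisym_def by auto
    show "hat_le P r x y \<Longrightarrow> hat_le P r y z \<Longrightarrow> hat_le P r x z"
      unfolding hat_le_def using po(2) unfolding trans_def by blast
  qed (auto simp: hat_le_def hat_set_def)
qed

definition ext :: "int ^ 'v::finite option \<Rightarrow> 'v option option \<Rightarrow> int" where
  "ext a h = (case h of None \<Rightarrow> 0 | Some i \<Rightarrow> a $ i)"
definition unext :: "('v::finite option option \<Rightarrow> int) \<Rightarrow> int ^ 'v option" where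
  "unext x = (\<chi> i. x (Some i))"

lemma ext_simps [simp]: "ext a None = 0" "ext a (Some i) = a $ i"
  by (simp_all add: ext_def)
lemma unext_ext [simp]: "unext (ext a) = a" by (simp add: unext_def vec_eq_iff)
lemma ext_unext: "x None = 0 \<Longrightarrow> ext (unext x) = x"
  by (auto simp: ext_def unext_def fun_eq_iff split: option.splits)
lemma ext_add: "ext (a + b) h = ext a h + ext b h" by (simp add: ext_def split: option.splits)
lemma ext_diff: "ext (a - b) h = ext a h - ext b h" by (simp add: ext_def split: option.splits)
lemma ext_smult: "ext (c *s a) h = c * ext a h" by (simp add: ext_def split: option.splits)
lemma ext_eq_iff: "ext a = ext b \<longleftrightarrow> a = b" by (metis unext_ext)
lemma ext_zero: "ext 0 = (\<lambda>_. 0)" by (auto simp: ext_def split: option.splits)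

locale hibi_poset =
  fixes P :: "'v::finite set" and r :: "('v \<times> 'v) set"
  assumes po: "partial_order_on P r"
begin

sublocale bounded_poset "hat_set P" "hat_le P r" "Some None" None
  by (rule hat_poset[OF po])

lemma r_sub: "r \<subseteq> P \<times> P" using partial_order_onD(4)[OF po] .

lemma monoid_iff: "m \<in> hibi_monoid P r \<longleftrightarrow> ext (int_vec m) \<in> omega_neg 0"
proof
  assume m: "m \<in> hibi_monoid P r"
  have "ext (int_vec m) v \<le> ext (int_vec m) u" if "hat_le P r u v" for u v
    using that m unfolding hat_le_def hat_set_def hibi_monoid_def by (auto simp: int_vec_def)
  then have "ext (int_vec m) v \<le> ext (int_vec m) u" if "(u, v) \<in> cov" for u v using covD that by blast
  moreover have "ext (int_vec m) h = 0" if "h \<notin> hat_set P" for h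
    using that m unfolding hat_set_def hibi_monoid_def by (cases h; cases "the h") (auto simp: int_vec_def)
  ultimately show "ext (int_vec m) \<in> omega_neg 0" unfolding omega_neg_def by simp
next
  assume m: "ext (int_vec m) \<in> omega_neg 0"
  have mono: "ext (int_vec m) y \<le> ext (int_vec m) x" if "hat_le P r x y" for x y using omega_neg_0_mono[OF m that] .
  have out: "m $ Some v = 0" if "v \<notin> P" for v
  proof -
    have "Some (Some v) \<notin> hat_set P" using that unfolding hat_set_def by auto
    then have "ext (int_vec m) (Some (Some v)) = 0" using m unfolding omega_neg_def by blast
    then show ?thesis by (simp add: int_vec_def)
  qed
  moreover have "m $ Some v \<le> m $ None" for v
  proof (cases "v \<in> P")
    case True
    then have "hat_le P r (Some None) (Some (Some v))" unfolding hat_le_def hat_set_def by auto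
    from mono[OF this] show ?thesis by (simp add: int_vec_def)
  qed (use out in simp)
  moreover have "m $ Some v \<le> m $ Some u" if "(u, v) \<in> r" for u v
  proof -
    have "hat_le P r (Some (Some u)) (Some (Some v))" using that r_sub unfolding hat_le_def hat_set_def by auto
    from mono[OF this] show ?thesis by (simp add: int_vec_def)
  qed
  ultimately show "m \<in> hibi_monoid P r" unfolding hibi_monoid_def by blast
qed

lemma int_vec_monoid_iff: "a \<in> int_vec ` hibi_monoid P r \<longleftrightarrow> ext a \<in> omega_neg 0"
proof
  assume a: "ext a \<in> omega_neg 0"
  have "0 \<le> a $ i" for i using omega_neg_0_nonneg[OF a, of "Some i"] by simp
  then have "a = int_vec (nat_vec a)" by (simp add: vec_eq_iff int_vec_def nat_vec_def)
  then show "a \<in> int_vec ` hibi_monoid P r" using monoid_iff[of "nat_vec a"] a by (metis image_eqI)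
qed (use monoid_iff in auto)

lemma lattice_ext: "ext a \<in> lattice \<longleftrightarrow> (\<forall>v. v \<notin> P \<longrightarrow> a $ Some v = 0)"
proof -
  have "(\<forall>h. h \<notin> hat_set P \<longrightarrow> ext a h = 0) \<longleftrightarrow> (\<forall>v. v \<notin> P \<longrightarrow> a $ Some v = 0)"
  proof
    assume *: "\<forall>h. h \<notin> hat_set P \<longrightarrow> ext a h = 0"
    have "a $ Some v = 0" if "v \<notin> P" for v
      using *[rule_format, of "Some (Some v)"] that unfolding hat_set_def by auto
    then show "\<forall>v. v \<notin> P \<longrightarrow> a $ Some v = 0" by blast
  next
    assume *: "\<forall>v. v \<notin> P \<longrightarrow> a $ Some v = 0"
    have "ext a h = 0" if "h \<notin> hat_set P" for h
      using that * unfolding hat_set_def by (cases h; cases "the h") auto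
    then show "\<forall>h. h \<notin> hat_set P \<longrightarrow> ext a h = 0" by blast
  qed
  then show ?thesis unfolding lattice_def by simp
qed

lemma omega_neg_lattice: "x \<in> omega_neg n \<Longrightarrow> x \<in> lattice" unfolding omega_neg_def lattice_def by auto

lemma lattice_unext: "x \<in> lattice \<Longrightarrow> ext (unext x) = x"
  using ext_unext unfolding lattice_def by blast

end

locale hibi_fp = hibi_poset P r for P :: "'v::finite set" and r +
  fixes p :: nat
  assumes pp: "Factorial_Ring.prime p"
begin

abbreviation "RR \<equiv> hibi_ring (residue_ring (int p)) P r"

sublocale R: fp_monoid_ring p RR "hibi_monoid P r"
  by (rule hibi_ring_fp[OF pp r_sub])

lemma exponent_group_iff: "a \<in> R.exponent_group \<longleftrightarrow> ext a \<in> lattice"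
proof
  assume "a \<in> R.exponent_group"
  then obtain m n where "m \<in> hibi_monoid P r" "n \<in> hibi_monoid P r" "a = int_vec m - int_vec n" unfolding R.exponent_group_def by blast
  then show "ext a \<in> lattice" unfolding lattice_ext hibi_monoid_def by (simp add: int_vec_def)
next
  assume "ext a \<in> lattice"
  then obtain s t where st: "s \<in> omega_neg 0" "t \<in> omega_neg 0" "\<forall>h. ext a h = s h - t h" using lattice_diff by blast
  have "ext (unext s) = s" "ext (unext t) = t" using st omega_neg_lattice lattice_unext by auto
  then have "unext s \<in> int_vec ` hibi_monoid P r" "unext t \<in> int_vec ` hibi_monoid P r"
    using int_vec_monoid_iff st by auto
  then obtain x y where xy: "x \<in> hibi_monoid P r" "y \<in> hibi_monoid P r" "unext s = int_vec x" "unext t = int_vec y" by blast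
  have "a = unext s - unext t"
  proof -
    have "ext a = ext (unext s - unext t)" using st(3) \<open>ext (unext s) = s\<close> \<open>ext (unext t) = t\<close>
      by (auto simp: fun_eq_iff ext_diff)
    then show ?thesis by (simp add: ext_eq_iff)
  qed
  then have "a = int_vec x - int_vec y" using xy by simp
  then show "a \<in> R.exponent_group" using xy(1,2) unfolding R.exponent_group_def by blast
qed

text \<open>Translates the description of monomial maps into the language of the extended poset, where
  \<open>frobenius_support\<close> applies.\<close>
lemma map_exponents_iff: assumes "0 < q" shows "a \<in> R.map_exponents q \<longleftrightarrow> ext a \<in> omega_neg (int q - 1)"
proof -
  have "a \<in> R.map_exponents q \<longleftrightarrow> ext a \<in> lattice \<and>
     (\<forall>m\<in>omega_neg 0. \<forall>n\<in>lattice. (\<forall>h. int q * n h = m h + ext a h) \<longrightarrow> n \<in> omega_neg 0)"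
    (is "_ \<longleftrightarrow> _ \<and> ?C")
  proof
    assume a: "a \<in> R.map_exponents q"
    have ?C
    proof (intro ballI impI)
      fix m n assume mn: "m \<in> omega_neg 0" "n \<in> lattice" "\<forall>h. int q * n h = m h + ext a h"
      have e: "ext (unext m) = m" "ext (unext n) = n" using mn omega_neg_lattice lattice_unext by auto
      then obtain m' where m': "m' \<in> hibi_monoid P r" "unext m = int_vec m'" using int_vec_monoid_iff[of "unext m"] mn by auto
      have "unext n \<in> R.exponent_group" using exponent_group_iff e mn by simp
      moreover have "int q *s unext n = int_vec m' + a"
      proof -
        have "ext (int q *s unext n) = ext (int_vec m' + a)"
          using mn(3) e m'(2) by (auto simp: fun_eq_iff ext_smult ext_add)
        then show ?thesis by (simp add: ext_eq_iff)
      qed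
      ultimately have "unext n \<in> int_vec ` hibi_monoid P r" using a m' unfolding R.map_exponents_def by blast
      then show "n \<in> omega_neg 0" using int_vec_monoid_iff e by metis
    qed
    then show "ext a \<in> lattice \<and> ?C" using a exponent_group_iff unfolding R.map_exponents_def by blast
  next
    assume a: "ext a \<in> lattice \<and> ?C"
    have "n \<in> int_vec ` hibi_monoid P r"
      if mn: "m \<in> hibi_monoid P r" "n \<in> R.exponent_group" "int q *s n = int_vec m + a" for m n
    proof -
      have "\<forall>h. int q * ext n h = ext (int_vec m) h + ext a h"
        using arg_cong[OF mn(3), of ext] by (metis ext_add ext_smult)
      then show ?thesis using a mn monoid_iff exponent_group_iff int_vec_monoid_iff by blast
    qed
    then show "a \<in> R.map_exponents q" using a exponent_group_iff unfolding R.map_exponents_def by blast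
  qed
  moreover have "ext a \<in> omega_neg (int q - 1) \<Longrightarrow> ext a \<in> lattice" by (rule omega_neg_lattice)
  ultimately show ?thesis using frobenius_support[of "ext a" "int q"] assms by auto
qed

lemma map_exponents_pow: "a \<in> R.map_exponents (p ^ e) \<longleftrightarrow> ext a \<in> omega_neg (int p ^ e - 1)"
  using map_exponents_iff[OF R.pe_pos, of a e] by simp

definition cx :: "nat \<Rightarrow> enat" where
  "cx e = complexity_sequence (cartier_algebra p RR) (cartier_component p RR) e"

lemma cx_upper:
  assumes level
  shows "cx e \<le> enat (nat (2 * (int p ^ e - 1) * int (card (hat_set P)) + 1) ^ card free)"
proof -
  let ?n = "int p ^ e - 1"
  have n: "0 \<le> ?n" using R.pe_pos[of e] by (simp flip: of_nat_power)
  then obtain k where k: "?n = int k" by (metis nonneg_int_cases)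
  note B = min_gens_card[OF n]
  let ?Y = "unext ` min_gens ?n"
  have eq: "ext (unext x) = x" if "x \<in> min_gens ?n" for x
    using that omega_neg_lattice lattice_unext unfolding min_gens_def by blast
  obtain G where G: "finite G" "G \<subseteq> hibi_monoid P r"
    "\<And>m. m \<in> hibi_monoid P r \<Longrightarrow> \<exists>g\<in>G. \<exists>s\<in>hibi_monoid P r. m = p ^ e *s s + g"
    using hibi_monoid_residues[OF r_sub R.pe_pos[of e]] by blast
  have "cx e \<le> enat (card ?Y)" unfolding cx_def
  proof (rule R.complexity_upper[OF _ _ _ G])
    show "finite ?Y" using B by simp
    show "?Y \<subseteq> R.map_exponents (p ^ e)" using eq unfolding map_exponents_pow subset_iff by (auto simp: min_gens_def)
    fix a assume "a \<in> R.map_exponents (p ^ e)"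
    then have "ext a \<in> omega_neg (int k)" unfolding map_exponents_pow k .
    then obtain b s where bs: "b \<in> min_gens ?n" "s \<in> omega_neg 0" "\<forall>h. ext a h = b h + s h"
      using level_generates[OF assms] k by metis
    have es: "ext (unext s) = s" using bs omega_neg_lattice lattice_unext by blast
    then obtain s' where s': "s' \<in> hibi_monoid P r" "unext s = int_vec s'" using int_vec_monoid_iff[of "unext s"] bs(2) by auto
    have "ext a = ext (unext b + int_vec s')" using bs(3) eq[OF bs(1)] es s'(2) by (auto simp: fun_eq_iff ext_add)
    then have "a = unext b + int_vec s'" by (simp add: ext_eq_iff)
    then show "\<exists>y\<in>?Y. \<exists>s\<in>hibi_monoid P r. a = y + int_vec s" using bs(1) s'(1) by blast
  qed
  also have "card ?Y \<le> card (min_gens ?n)" by (rule card_image_le[OF B(1)])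
  finally show ?thesis using B(2) by (meson enat_ord_simps(1) order_trans)
qed

lemma cx_lower:
  assumes level "free \<noteq> {}" "p = 2 * k + 1" "2 * card (hat_set P) + 1 \<le> k"
    "s = p div (card (hat_set P) + 1)" "card (hat_set P) \<le> s"
  shows "enat (s ^ (J * card free)) \<le> cx (Suc J)"
proof -
  obtain X where X: "X \<subseteq> min_gens (int p ^ Suc J - 1)" "finite X" "s ^ (J * card free) \<le> card X"
    "\<And>x i b c. x \<in> X \<Longrightarrow> i \<in> {1..J} \<Longrightarrow> b \<in> omega_neg (int p ^ (Suc J - i) - 1) \<Longrightarrow> c \<in> omega_neg (int p ^ i - 1) \<Longrightarrow>
       \<exists>h. x h \<noteq> int p ^ i * b h + c h"
    using many_indecomposables[OF assms, of J] by blast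
  have eq: "ext (unext x) = x" if "x \<in> X" for x
    using that X(1) omega_neg_lattice lattice_unext unfolding min_gens_def by blast
  have "inj_on unext X" using eq by (metis inj_on_inverseI)
  then have card: "card (unext ` X) = card X" by (rule card_image)
  have "enat (card (unext ` X)) \<le> cx (Suc J)" unfolding cx_def
  proof (rule R.complexity_lower)
    show "0 < Suc J" "finite (unext ` X)" using X(2) by auto
    fix a assume "a \<in> unext ` X"
    then obtain x where x: "x \<in> X" "a = unext x" by blast
    have xa: "ext a = x" using eq x by simp
    have xm: "x \<in> min_gens (int p ^ Suc J - 1)" using x X by auto
    then have aT: "a \<in> R.map_exponents (p ^ Suc J)" unfolding map_exponents_pow xa min_gens_def by simp
    have 1: "s = 0" if "b \<in> R.map_exponents (p ^ Suc J)" "s \<in> hibi_monoid P r" "a = b + int_vec s" for b s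
    proof -
      have "ext (int_vec s) = (\<lambda>_. 0)"
        using min_gens_minimal[OF xm, of "ext b" "ext (int_vec s)"] that xa ext_add monoid_iff unfolding map_exponents_pow by metis
      then have "ext (int_vec s) = ext 0" by (simp add: ext_zero)
      then have "int_vec s = int_vec 0" unfolding ext_eq_iff int_vec_zero .
      then show ?thesis unfolding int_vec_inj .
    qed
    have 2: "a \<noteq> int (p ^ (Suc J - i)) *s b + c"
      if i: "0 < i" "i < Suc J" and b: "b \<in> R.map_exponents (p ^ i)" and c: "c \<in> R.map_exponents (p ^ (Suc J - i))" for i b c
    proof
      assume a: "a = int (p ^ (Suc J - i)) *s b + c"
      have "x h = int p ^ (Suc J - i) * ext b h + ext c h" for h
        unfolding xa[symmetric] a ext_add ext_smult by simp
      moreover have "Suc J - i \<in> {1..J}" "Suc J - (Suc J - i) = i" using i by auto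
      ultimately show False using X(4)[OF x(1), of "Suc J - i" "ext b" "ext c"] b c unfolding map_exponents_pow by auto
    qed
    have "a \<in> R.exponent_group" using aT unfolding R.map_exponents_def by simp
    then have "R.indecomposable (Suc J) a" unfolding R.indecomposable_def using 1 2 by blast
    then show "R.indecomposable (Suc J) a \<and> a \<in> R.map_exponents (p ^ Suc J)" using aT by simp
  qed
  then show ?thesis using X(3) unfolding card by (meson enat_ord_simps(1) order_trans)
qed

end

section \<open>Shortest maximal chains and the interior of the cone\<close>

lemma maximal_chains_iff:
  assumes "partial_order_on P r"
  shows "C \<in> maximal_chains P r \<longleftrightarrow> C \<subseteq> P \<and> (\<forall>x\<in>C. \<forall>y\<in>C. (x, y) \<in> r \<or> (y, x) \<in> r) \<and>
    (\<forall>z\<in>P. (\<forall>x\<in>C. (x, z) \<in> r \<or> (z, x) \<in> r) \<longrightarrow> z \<in> C)"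
proof -
  have refl: "(x, x) \<in> r" if "x \<in> P" for x
    using partial_order_onD(1)[OF assms] that unfolding refl_on_def by blast
  have chain: "pred_on.chain P (\<lambda>x y. (x, y) \<in> r) S \<longleftrightarrow> S \<subseteq> P \<and> (\<forall>x\<in>S. \<forall>y\<in>S. (x, y) \<in> r \<or> (y, x) \<in> r)" for S
    unfolding pred_on.chain_def using refl by blast
  show ?thesis
  proof
    assume "C \<in> maximal_chains P r"
    then have C: "C \<subseteq> P" "\<forall>x\<in>C. \<forall>y\<in>C. (x, y) \<in> r \<or> (y, x) \<in> r"
      and max: "\<And>S. S \<subseteq> P \<Longrightarrow> \<forall>x\<in>S. \<forall>y\<in>S. (x, y) \<in> r \<or> (y, x) \<in> r \<Longrightarrow> \<not> C \<subset> S"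
      unfolding maximal_chains_def mem_Collect_eq pred_on.maxchain_def chain by blast+
    have "z \<in> C" if "z \<in> P" "\<forall>x\<in>C. (x, z) \<in> r \<or> (z, x) \<in> r" for z
      using max[of "insert z C"] C that refl by blast
    then show "C \<subseteq> P \<and> (\<forall>x\<in>C. \<forall>y\<in>C. (x, y) \<in> r \<or> (y, x) \<in> r) \<and>
      (\<forall>z\<in>P. (\<forall>x\<in>C. (x, z) \<in> r \<or> (z, x) \<in> r) \<longrightarrow> z \<in> C)" using C by blast
  next
    assume "C \<subseteq> P \<and> (\<forall>x\<in>C. \<forall>y\<in>C. (x, y) \<in> r \<or> (y, x) \<in> r) \<and>
      (\<forall>z\<in>P. (\<forall>x\<in>C. (x, z) \<in> r \<or> (z, x) \<in> r) \<longrightarrow> z \<in> C)"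
    then show "C \<in> maximal_chains P r"
      unfolding maximal_chains_def mem_Collect_eq pred_on.maxchain_def chain by blast
  qed
qed

definition hat_chain :: "'v set \<Rightarrow> 'v option option set" where
  "hat_chain C = insert None (insert (Some None) ((\<lambda>v. Some (Some v)) ` C))"

lemma hat_chain_mem [simp]: "None \<in> hat_chain C" "Some None \<in> hat_chain C" "Some (Some v) \<in> hat_chain C \<longleftrightarrow> v \<in> C"
  unfolding hat_chain_def by auto

lemma card_hat_chain: assumes "finite C" shows "card (hat_chain C) = card C + 2"
proof -
  have "inj_on (\<lambda>v. Some (Some v)) C" by (rule inj_onI) simp
  then have "card ((\<lambda>v. Some (Some v)) ` C) = card C" by (rule card_image)
  moreover have "Some None \<notin> (\<lambda>v. Some (Some v)) ` C" by auto
  moreover have "None \<notin> insert (Some None) ((\<lambda>v. Some (Some v)) ` C)" by auto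
  ultimately show ?thesis unfolding hat_chain_def using assms by simp
qed

context hibi_poset
begin

lemma hat_le_simps:
  "hat_le P r (Some (Some u)) (Some (Some v)) \<longleftrightarrow> (u, v) \<in> r"
  "hat_le P r (Some None) x \<longleftrightarrow> x \<in> hat_set P" "hat_le P r x None \<longleftrightarrow> x \<in> hat_set P"
  "Some (Some v) \<in> hat_set P \<longleftrightarrow> v \<in> P" "None \<in> hat_set P" "Some None \<in> hat_set P"
  using r_sub unfolding hat_le_def hat_set_def by auto

lemma saturated_hat_chain:
  "saturated (Some None) None (hat_chain C) \<longleftrightarrow> C \<in> maximal_chains P r"
proof -
  have total: "(\<forall>x\<in>hat_chain C. \<forall>y\<in>hat_chain C. hat_le P r x y \<or> hat_le P r y x) \<longleftrightarrow>
      (\<forall>x\<in>C. \<forall>y\<in>C. (x, y) \<in> r \<or> (y, x) \<in> r)" if "C \<subseteq> P"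
    using that unfolding hat_chain_def by (auto simp: hat_le_simps subset_iff)
  have bounds: "(\<forall>x\<in>hat_chain C. hat_le P r (Some None) x \<and> hat_le P r x None) \<longleftrightarrow> C \<subseteq> P"
    unfolding hat_chain_def by (auto simp: hat_le_simps)
  have max: "(\<forall>z. hat_le P r (Some None) z \<and> hat_le P r z None \<and>
        (\<forall>x\<in>hat_chain C. hat_le P r x z \<or> hat_le P r z x) \<longrightarrow> z \<in> hat_chain C) \<longleftrightarrow>
      (\<forall>z\<in>P. (\<forall>x\<in>C. (x, z) \<in> r \<or> (z, x) \<in> r) \<longrightarrow> z \<in> C)" (is "?L \<longleftrightarrow> ?R")
  proof
    assume L: ?L
    show ?R
    proof (intro ballI impI)
      fix z assume "z \<in> P" "\<forall>x\<in>C. (x, z) \<in> r \<or> (z, x) \<in> r"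
      then show "z \<in> C" using L[rule_format, of "Some (Some z)"] by (auto simp: hat_le_simps hat_chain_def)
    qed
  next
    assume R: ?R
    show ?L
    proof (intro allI impI, elim conjE)
      fix z assume z: "hat_le P r z None" "\<forall>x\<in>hat_chain C. hat_le P r x z \<or> hat_le P r z x"
      show "z \<in> hat_chain C"
      proof (cases z)
        case (Some i)
        then show ?thesis using R z by (cases i) (auto simp: hat_le_simps hat_chain_def)
      qed simp
    qed
  qed
  show ?thesis unfolding maximal_chains_iff[OF po] saturated_def max bounds using total by auto
qed

lemma saturated_is_hat_chain:
  assumes "saturated (Some None) None D" shows "\<exists>C. D = hat_chain C"
proof -
  have "D = hat_chain {v. Some (Some v) \<in> D}"
  proof (rule Set.set_eqI)
    fix x show "x \<in> D \<longleftrightarrow> x \<in> hat_chain {v. Some (Some v) \<in> D}"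
      using saturatedD(1,2)[OF assms] by (cases x; cases "the x") auto
  qed
  then show ?thesis by blast
qed

lemma card_free: "card free = card {v \<in> P. \<forall>C\<in>minimal_length_maximal_chains P r. v \<notin> C}"
proof -
  have fin: "finite (C :: 'v set)" for C by simp
  have "x \<in> free \<longleftrightarrow> x \<in> (\<lambda>v. Some (Some v)) ` {v \<in> P. \<forall>C\<in>minimal_length_maximal_chains P r. v \<notin> C}" for x
  proof -
    have ex: "(\<forall>D. saturated (Some None) None D \<longrightarrow> Q D) \<longleftrightarrow> (\<forall>C\<in>maximal_chains P r. Q (hat_chain C))" for Q
      using saturated_is_hat_chain saturated_hat_chain by metis
    have "x \<in> free \<longleftrightarrow> x \<in> hat_set P \<and> (\<forall>C\<in>maximal_chains P r.
        (\<forall>D\<in>maximal_chains P r. card (hat_chain C) \<le> card (hat_chain D)) \<longrightarrow> x \<notin> hat_chain C)"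
      unfolding free_iff imp_conjL ex ..
    also have "\<dots> \<longleftrightarrow> x \<in> hat_set P \<and> (\<forall>C\<in>minimal_length_maximal_chains P r. x \<notin> hat_chain C)"
      unfolding minimal_length_maximal_chains_def card_hat_chain[OF fin] by auto
    finally have eq: "x \<in> free \<longleftrightarrow> x \<in> hat_set P \<and> (\<forall>C\<in>minimal_length_maximal_chains P r. x \<notin> hat_chain C)" .
    show ?thesis
    proof (cases "x = None \<or> x = Some None")
      case True
      then have "x \<in> forced" using bot_forced top_forced by auto
      then show ?thesis using True unfolding free_def by auto
    next
      case False
      then obtain v where v: "x = Some (Some v)" by (metis option.exhaust)
      show ?thesis using eq unfolding v by (auto simp: hat_le_simps)
    qed
  qed
  then have "free = (\<lambda>v. Some (Some v)) ` {v \<in> P. \<forall>C\<in>minimal_length_maximal_chains P r. v \<notin> C}" by blast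
  then show ?thesis by (simp add: card_image inj_on_def)
qed

definition real_cone :: "(real ^ 'v option) set" where
  "real_cone = convex_cone hull (real_exponent ` hibi_monoid P r)"

definition rext :: "real ^ 'v option \<Rightarrow> 'v option option \<Rightarrow> real" where
  "rext z h = (case h of None \<Rightarrow> 0 | Some i \<Rightarrow> z $ i)"

lemma rext_add: "rext (x + y) h = rext x h + rext y h"
  and rext_scale: "rext (c *\<^sub>R x) h = c * rext x h"
  and rext_real_exponent: "rext (real_exponent m) h = real_of_int (ext (int_vec m) h)"
  and rext_zero: "rext 0 h = 0"
  unfolding rext_def ext_def real_exponent_def int_vec_def by (auto split: option.splits)

lemma real_cone_mono: assumes "(u, v) \<in> cov" "z \<in> real_cone" shows "rext z v \<le> rext z u"
  using assms(2) unfolding real_cone_def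
proof (rule hull_induct)
  fix x assume "x \<in> real_exponent ` hibi_monoid P r"
  then obtain m where m: "m \<in> hibi_monoid P r" "x = real_exponent m" by blast
  have "ext (int_vec m) v \<le> ext (int_vec m) u"
    using m monoid_iff assms(1) unfolding omega_neg_def by auto
  then show "rext x v \<le> rext x u" unfolding m rext_real_exponent by simp
next
  show "convex_cone {x. rext x v \<le> rext x u}"
    unfolding convex_cone_iff by (auto simp: rext_add rext_scale rext_zero add_mono mult_left_mono)
qed

text \<open>In one direction a point of the relative interior can be moved a little away from a steep vector
  without leaving the cone, so no facet functional vanishes on it. Conversely, if all facet
  functionals are positive on \<open>m\<close>, then \<open>n * m - s\<close> is an exponent of
  the ring for every generator \<open>s\<close> and large \<open>n\<close>. The points
  \<open>x\<close> such that \<open>m - \<delta> * x\<close> remains in the cone for some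
  \<open>\<delta> > 0\<close> therefore form a cone containing all generators.\<close>
lemma rel_interior_iff:
  assumes "m \<in> hibi_monoid P r"
  shows "real_exponent m \<in> rel_interior real_cone \<longleftrightarrow> ext (int_vec m) \<in> interior_vecs"
proof -
  have conv: "convex real_cone" "real_cone \<noteq> {}" unfolding real_cone_def
    using convex_convex_cone_hull convex_cone_hull_nonempty by auto
  have gen: "real_exponent k \<in> real_cone" if "k \<in> hibi_monoid P r" for k
    unfolding real_cone_def using that by (intro hull_inc) auto
  have add: "x + y \<in> real_cone" if "x \<in> real_cone" "y \<in> real_cone" for x y
    using that convex_cone_hull_add unfolding real_cone_def by blast
  have scale: "c *\<^sub>R x \<in> real_cone" if "x \<in> real_cone" "0 \<le> c" for x c
    using that convex_cone_hull_mul unfolding real_cone_def by blast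
  have mm: "ext (int_vec m) \<in> omega_neg 0" using assms monoid_iff by simp
  show ?thesis
  proof
    assume int: "real_exponent m \<in> rel_interior real_cone"
    have "ext (int_vec m) v + 1 \<le> ext (int_vec m) u" if uv: "(u, v) \<in> cov" for u v
    proof (rule ccontr)
      assume "\<not> ext (int_vec m) v + 1 \<le> ext (int_vec m) u"
      moreover have "ext (int_vec m) v \<le> ext (int_vec m) u" using mm uv unfolding omega_neg_def by auto
      ultimately have eq: "ext (int_vec m) u = ext (int_vec m) v" by linarith
      obtain y where y: "y \<in> lattice" "\<And>a b. (a, b) \<in> cov \<Longrightarrow> y b + 1 \<le> y a" using ex_steep[of 1] by auto
      have "y \<in> omega_neg 0" using y unfolding omega_neg_def lattice_def by fastforce
      then obtain k where k: "k \<in> hibi_monoid P r" "unext y = int_vec k"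
        using int_vec_monoid_iff[of "unext y"] lattice_unext[OF y(1)] by auto
      have ky: "ext (int_vec k) = y" using k lattice_unext[OF y(1)] by simp
      obtain e where e: "e > 1" "(1 - e) *\<^sub>R real_exponent k + e *\<^sub>R real_exponent m \<in> real_cone"
        using int gen[OF k(1)] unfolding convex_rel_interior_iff[OF conv] by blast
      have "(1 - e) * y v + e * ext (int_vec m) v \<le> (1 - e) * y u + e * ext (int_vec m) u"
        using real_cone_mono[OF uv e(2)] unfolding rext_add rext_scale rext_real_exponent ky .
      then have "(e - 1) * (real_of_int (y u) - real_of_int (y v)) \<le> 0" unfolding eq by (simp add: algebra_simps)
      moreover have "real_of_int (y u) - real_of_int (y v) > 0" using y(2)[OF uv] by linarith
      ultimately show False using e(1) by (simp add: mult_le_0_iff)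
    qed
    then show "ext (int_vec m) \<in> interior_vecs" using mm unfolding interior_vecs_def omega_neg_def by auto
  next
    assume int: "ext (int_vec m) \<in> interior_vecs"
    define D where "D = {x. \<exists>\<delta>>0. real_exponent m - \<delta> *\<^sub>R x \<in> real_cone}"
    have "real_exponent ` hibi_monoid P r \<subseteq> D"
    proof
      fix x assume "x \<in> real_exponent ` hibi_monoid P r"
      then obtain s where s: "s \<in> hibi_monoid P r" "x = real_exponent s" by blast
      obtain K where K: "0 \<le> K" "\<And>u v. (u, v) \<in> cov \<Longrightarrow> \<bar>ext (int_vec s) u - ext (int_vec s) v\<bar> \<le> K"
        using bounded_on_covers by blast
      define n where "n = K + 1"
      let ?x = "n *s int_vec m - int_vec s"
      have "ext ?x v \<le> ext ?x u" if "(u, v) \<in> cov" for u v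
      proof -
        have "ext (int_vec m) v - (-1) \<le> ext (int_vec m) u" using int that unfolding interior_vecs_def omega_neg_def by blast
        then have "n * 1 \<le> n * (ext (int_vec m) u - ext (int_vec m) v)"
          using K(1) unfolding n_def by (intro mult_left_mono) auto
        then show ?thesis using K(2)[OF that] unfolding ext_diff ext_smult n_def by (simp add: algebra_simps)
      qed
      moreover have "ext ?x \<in> lattice"
        using assms s(1) unfolding lattice_ext hibi_monoid_def by (simp add: int_vec_def)
      ultimately have "ext ?x \<in> omega_neg 0" unfolding omega_neg_def lattice_def by auto
      then obtain k where k: "k \<in> hibi_monoid P r" "?x = int_vec k" using int_vec_monoid_iff[of ?x] by auto
      have n0: "0 < real_of_int n" using K(1) unfolding n_def by simp
      have "real_exponent k = real_of_int n *\<^sub>R real_exponent m - x"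
      proof -
        have "n * int (m $ i) - int (s $ i) = int (k $ i)" for i
          using arg_cong[OF k(2), of "\<lambda>z. z $ i"] by (simp add: int_vec_def)
        then have "real_of_int (n * int (m $ i) - int (s $ i)) = real (k $ i)" for i by simp
        then show ?thesis unfolding s real_exponent_def by (simp add: vec_eq_iff)
      qed
      then have "real_exponent m - (1 / real_of_int n) *\<^sub>R x = (1 / real_of_int n) *\<^sub>R real_exponent k"
        using n0 by (simp add: scaleR_diff_right)
      also have "\<dots> \<in> real_cone" using n0 by (intro scale gen k) auto
      finally show "x \<in> D" unfolding D_def using n0 by (auto intro!: exI[of _ "1 / real_of_int n"])
    qed
    moreover have "convex_cone D" unfolding convex_cone_iff
    proof (intro conjI ballI allI impI)
      show "0 \<in> D" unfolding D_def using gen[OF assms] by (auto intro!: exI[of _ 1])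
      fix x y assume "x \<in> D" "y \<in> D"
      then obtain a b where ab: "a > 0" "b > 0" "real_exponent m - a *\<^sub>R x \<in> real_cone" "real_exponent m - b *\<^sub>R y \<in> real_cone"
        unfolding D_def by blast
      \<comment> \<open>chosen so that the new point is a convex combination of the two given ones\<close>
      define c where "c = a * b / (a + b)"
      have "c > 0" unfolding c_def using ab by simp
      have s1: "b / (a + b) + a / (a + b) = 1"
        unfolding add_divide_distrib[symmetric] using ab by simp
      have "real_exponent m - c *\<^sub>R (x + y) =
        (b / (a + b)) *\<^sub>R (real_exponent m - a *\<^sub>R x) + (a / (a + b)) *\<^sub>R (real_exponent m - b *\<^sub>R y)"
      proof -
        have "(b / (a + b)) *\<^sub>R (real_exponent m - a *\<^sub>R x) + (a / (a + b)) *\<^sub>R (real_exponent m - b *\<^sub>R y) =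
          (b / (a + b) + a / (a + b)) *\<^sub>R real_exponent m - c *\<^sub>R x - c *\<^sub>R y"
          unfolding c_def by (simp add: algebra_simps)
        then show ?thesis unfolding s1 by (simp add: scaleR_add_right)
      qed
      also have "\<dots> \<in> real_cone" using ab by (intro add scale) auto
      finally show "x + y \<in> D" unfolding D_def using \<open>c > 0\<close> by blast
    next
      fix x and c :: real assume x: "x \<in> D" and c: "0 \<le> c"
      then obtain a where a: "a > 0" "real_exponent m - a *\<^sub>R x \<in> real_cone" unfolding D_def by blast
      show "c *\<^sub>R x \<in> D"
      proof (cases "c = 0")
        case True then show ?thesis unfolding D_def using gen[OF assms] by (auto intro!: exI[of _ 1])
      next
        case False
        then have "real_exponent m - (a / c) *\<^sub>R (c *\<^sub>R x) \<in> real_cone" "a / c > 0" using a c by auto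
        then show ?thesis unfolding D_def by blast
      qed
    qed
    ultimately have CD: "real_cone \<subseteq> D" unfolding real_cone_def by (rule hull_minimal)
    show "real_exponent m \<in> rel_interior real_cone"
      unfolding convex_rel_interior_iff[OF conv]
    proof
      fix x assume "x \<in> real_cone"
      then obtain d where d: "d > 0" "real_exponent m - d *\<^sub>R x \<in> real_cone" using CD unfolding D_def by blast
      have "(1 - (1 + d)) *\<^sub>R x + (1 + d) *\<^sub>R real_exponent m = (real_exponent m - d *\<^sub>R x) + d *\<^sub>R real_exponent m"
        by (simp add: algebra_simps)
      also have "\<dots> \<in> real_cone" using d gen[OF assms] by (intro add scale) auto
      finally show "\<exists>e>1. (1 - e) *\<^sub>R x + e *\<^sub>R real_exponent m \<in> real_cone"
        using d(1) by (intro exI[of _ "1 + d"]) auto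
    qed
  qed
qed

end

section \<open>The level condition on exponents\<close>

context hibi_fp
begin

abbreviation "K \<equiv> residue_ring (int p)"
abbreviation "\<omega> \<equiv> hibi_omega K P r"

lemma K_zero: "\<zero>\<^bsub>K\<^esub> = 0" and K_one: "\<one>\<^bsub>K\<^esub> = 1"
  unfolding residue_ring_def by simp_all

lemma hibi_monomials_eq: "hibi_monomials K P r = hibi_monoid P r"
proof -
  have "mterm K \<one>\<^bsub>K\<^esub> m = mon 1 m" for m :: "nat ^ 'v option"
    unfolding mterm_def mon_def K_zero K_one ..
  moreover have "mon 1 m \<in> carrier RR \<longleftrightarrow> m \<in> hibi_monoid P r" for m
    using R.mon_1_carrier[of m] R.carrier_D(3)[of "mon 1 m" m] by (auto simp: mon_def)
  ultimately show ?thesis unfolding hibi_monomials_def by auto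
qed

lemma hibi_cone_eq: "hibi_cone K P r = real_cone"
  unfolding hibi_cone_def real_cone_def hibi_monomials_eq ..

definition omega_exponents :: "(nat ^ 'v option) set" where
  "omega_exponents = {w \<in> hibi_monoid P r. ext (int_vec w) \<in> interior_vecs}"

lemma omega_iff: "f \<in> \<omega> \<longleftrightarrow> f \<in> carrier RR \<and> (\<forall>m. f m \<noteq> 0 \<longrightarrow> m \<in> omega_exponents)"
proof -
  interpret amb: fp_monoid_ring p "hibi_ambient_ring K P" "{m. \<forall>i. m $ i \<noteq> 0 \<longrightarrow> i \<in> insert None (Some ` P)}"
    unfolding hibi_ambient_ring_def by (rule mpoly_ring_fp[OF pp])
  have V: "i \<in> insert None (Some ` P)" if "m \<in> hibi_monoid P r" "m $ i \<noteq> 0" for m i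
    using that unfolding hibi_monoid_def by (cases i) auto
  have mem: "(m \<in> hibi_monoid P r \<and> real_exponent m \<in> rel_interior real_cone) \<longleftrightarrow> m \<in> omega_exponents" for m
    unfolding omega_exponents_def using rel_interior_iff by auto
  show ?thesis unfolding hibi_omega_def K_zero hibi_monomials_eq hibi_cone_eq mem
    unfolding amb.carrier_R R.carrier_R using V unfolding omega_exponents_def by auto
qed

lemma omega_carrier: "f \<in> \<omega> \<Longrightarrow> f \<in> carrier RR" using omega_iff by simp

lemma mon_omega: "w \<in> omega_exponents \<Longrightarrow> mon 1 w \<in> \<omega>"
  unfolding omega_iff using R.mon_1_carrier by (auto simp: omega_exponents_def mon_def)

lemma omega_exponents_add: "w \<in> omega_exponents \<Longrightarrow> s \<in> hibi_monoid P r \<Longrightarrow> s + w \<in> omega_exponents"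
proof -
  assume w: "w \<in> omega_exponents" and s: "s \<in> hibi_monoid P r"
  have "ext (int_vec s) \<in> omega_neg 0" "ext (int_vec w) \<in> omega_neg (-1)"
    using s w monoid_iff unfolding omega_exponents_def interior_vecs_def by auto
  then have "(\<lambda>h. ext (int_vec s) h + ext (int_vec w) h) \<in> omega_neg (0 + -1)" by (rule omega_neg_add)
  moreover have "(\<lambda>h. ext (int_vec s) h + ext (int_vec w) h) = ext (int_vec (s + w))" by (simp add: fun_eq_iff int_vec_add ext_add)
  ultimately show ?thesis using w s hibi_monoid_add unfolding omega_exponents_def interior_vecs_def by auto
qed

lemma omega_add: assumes "f \<in> \<omega>" "g \<in> \<omega>" shows "f \<oplus>\<^bsub>RR\<^esub> g \<in> \<omega>"
proof -
  have fg: "f \<in> carrier RR" "g \<in> carrier RR" using assms omega_carrier by auto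
  have "f m \<noteq> 0 \<or> g m \<noteq> 0" if "(f \<oplus>\<^bsub>RR\<^esub> g) m \<noteq> 0" for m
    using that R.add_eval[OF fg, of m] by auto
  then show ?thesis using assms R.a_closed[OF fg] unfolding omega_iff by blast
qed

lemma omega_mult: assumes "a \<in> carrier RR" "f \<in> \<omega>" shows "a \<otimes>\<^bsub>RR\<^esub> f \<in> \<omega>"
proof -
  have f: "f \<in> carrier RR" using assms omega_carrier by auto
  have "m \<in> omega_exponents" if nz: "(a \<otimes>\<^bsub>RR\<^esub> f) m \<noteq> 0" for m
  proof -
    obtain k j where kj: "m = k + j" "a k \<noteq> 0" "f j \<noteq> 0" using R.mult_support[OF assms(1) f nz] by blast
    then show ?thesis using omega_exponents_add R.carrier_D(3)[OF assms(1)] assms(2) unfolding omega_iff by auto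
  qed
  then show ?thesis using R.m_closed[OF assms(1) f] unfolding omega_iff by blast
qed

lemma omega_exponents_ex: "\<exists>w. w \<in> omega_exponents"
proof -
  obtain y where y: "y \<in> lattice" "\<And>a b. (a, b) \<in> cov \<Longrightarrow> y b + 1 \<le> y a" using ex_steep[of 1] by auto
  have "y \<in> interior_vecs" "y \<in> omega_neg 0"
    using y unfolding interior_vecs_def omega_neg_def lattice_def by fastforce+
  then show ?thesis using int_vec_monoid_iff[of "unext y"] lattice_unext[OF y(1)] unfolding omega_exponents_def by force
qed

abbreviation "M \<equiv> hibi_omega_inv K P r"

lemma M_eq: "M = hom_module RR (ideal_module RR \<omega>) (ideal_module RR (carrier RR))"
  unfolding hibi_omega_inv_def by (simp add: Let_def)

lemma M_carrier: "\<phi> \<in> carrier M \<longleftrightarrow> \<phi> \<in> \<omega> \<rightarrow>\<^sub>E carrier RR \<and>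
    (\<forall>x\<in>\<omega>. \<forall>y\<in>\<omega>. \<phi> (x \<oplus>\<^bsub>RR\<^esub> y) = \<phi> x \<oplus>\<^bsub>RR\<^esub> \<phi> y) \<and>
    (\<forall>a\<in>carrier RR. \<forall>x\<in>\<omega>. \<phi> (a \<otimes>\<^bsub>RR\<^esub> x) = a \<otimes>\<^bsub>RR\<^esub> \<phi> x)"
  unfolding M_eq hom_module_def module_homs_def ideal_module_def by simp
lemma M_add: "\<phi> \<oplus>\<^bsub>M\<^esub> \<psi> = (\<lambda>x\<in>\<omega>. \<phi> x \<oplus>\<^bsub>RR\<^esub> \<psi> x)"
  unfolding M_eq hom_module_def ideal_module_def by simp
lemma M_zero: "\<zero>\<^bsub>M\<^esub> = (\<lambda>x\<in>\<omega>. \<zero>\<^bsub>RR\<^esub>)"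
  unfolding M_eq hom_module_def ideal_module_def by simp
lemma M_smult: "a \<odot>\<^bsub>M\<^esub> \<phi> = (\<lambda>x\<in>\<omega>. a \<otimes>\<^bsub>RR\<^esub> \<phi> x)"
  unfolding M_eq hom_module_def ideal_module_def by simp

lemma M_D:
  assumes "\<phi> \<in> carrier M"
  shows "x \<in> \<omega> \<Longrightarrow> \<phi> x \<in> carrier RR" "x \<notin> \<omega> \<Longrightarrow> \<phi> x = undefined"
    "x \<in> \<omega> \<Longrightarrow> y \<in> \<omega> \<Longrightarrow> \<phi> (x \<oplus>\<^bsub>RR\<^esub> y) = \<phi> x \<oplus>\<^bsub>RR\<^esub> \<phi> y"
    "a \<in> carrier RR \<Longrightarrow> x \<in> \<omega> \<Longrightarrow> \<phi> (a \<otimes>\<^bsub>RR\<^esub> x) = a \<otimes>\<^bsub>RR\<^esub> \<phi> x"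
  using assms unfolding M_carrier by (auto simp: PiE_def extensional_def)

lemma M_I:
  assumes "\<phi> \<in> extensional \<omega>" "\<And>x. x \<in> \<omega> \<Longrightarrow> \<phi> x \<in> carrier RR"
    "\<And>x y. x \<in> \<omega> \<Longrightarrow> y \<in> \<omega> \<Longrightarrow> \<phi> (x \<oplus>\<^bsub>RR\<^esub> y) = \<phi> x \<oplus>\<^bsub>RR\<^esub> \<phi> y"
    "\<And>a x. a \<in> carrier RR \<Longrightarrow> x \<in> \<omega> \<Longrightarrow> \<phi> (a \<otimes>\<^bsub>RR\<^esub> x) = a \<otimes>\<^bsub>RR\<^esub> \<phi> x"
  shows "\<phi> \<in> carrier M"
  using assms unfolding M_carrier by (auto simp: PiE_def)

lemma M_add_closed: assumes "\<phi> \<in> carrier M" "\<psi> \<in> carrier M" shows "\<phi> \<oplus>\<^bsub>M\<^esub> \<psi> \<in> carrier M"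
  unfolding M_add
  by (rule M_I) (use M_D[OF assms(1)] M_D[OF assms(2)] omega_add omega_mult
      in \<open>auto simp: R.r_distr R.a_ac\<close>)

lemma M_neg_closed: assumes "\<phi> \<in> carrier M" shows "(\<lambda>x\<in>\<omega>. \<ominus>\<^bsub>RR\<^esub> \<phi> x) \<in> carrier M"
  by (rule M_I) (use M_D[OF assms] omega_add omega_mult in \<open>auto simp: R.minus_add R.r_minus\<close>)

lemma M_zero_closed: "\<zero>\<^bsub>M\<^esub> \<in> carrier M"
  unfolding M_zero by (rule M_I) (use omega_add omega_mult in auto)

lemma M_smult_closed: assumes "a \<in> carrier RR" "\<phi> \<in> carrier M" shows "a \<odot>\<^bsub>M\<^esub> \<phi> \<in> carrier M"
  unfolding M_smult
  by (rule M_I) (use assms(1) M_D[OF assms(2)] omega_add omega_mult in \<open>auto simp: R.r_distr R.m_lcomm\<close>)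

lemma abelian_group_M: "abelian_group M"
proof (rule abelian_groupI)
  fix f g h assume "f \<in> carrier M" "g \<in> carrier M" "h \<in> carrier M"
  then show "f \<oplus>\<^bsub>M\<^esub> g \<oplus>\<^bsub>M\<^esub> h = f \<oplus>\<^bsub>M\<^esub> (g \<oplus>\<^bsub>M\<^esub> h)"
    unfolding M_add using M_D(1) by (auto intro!: restrict_ext simp: R.a_assoc)
next
  fix f g assume fg: "f \<in> carrier M" "g \<in> carrier M"
  then show "f \<oplus>\<^bsub>M\<^esub> g \<in> carrier M" by (rule M_add_closed)
  show "f \<oplus>\<^bsub>M\<^esub> g = g \<oplus>\<^bsub>M\<^esub> f"
    unfolding M_add using M_D(1) fg by (auto intro!: restrict_ext simp: R.a_comm)
next
  show "\<zero>\<^bsub>M\<^esub> \<in> carrier M" by (rule M_zero_closed)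
next
  fix f assume f: "f \<in> carrier M"
  show "\<zero>\<^bsub>M\<^esub> \<oplus>\<^bsub>M\<^esub> f = f"
    unfolding M_add M_zero using M_D(1,2)[OF f] by (auto simp: fun_eq_iff)
  have "(\<lambda>x\<in>\<omega>. \<ominus>\<^bsub>RR\<^esub> f x) \<oplus>\<^bsub>M\<^esub> f = \<zero>\<^bsub>M\<^esub>"
    unfolding M_add M_zero using M_D(1)[OF f] by (auto intro!: restrict_ext simp: R.l_neg)
  then show "\<exists>g\<in>carrier M. g \<oplus>\<^bsub>M\<^esub> f = \<zero>\<^bsub>M\<^esub>" using M_neg_closed[OF f] by blast
qed

lemma M_inv: assumes "f \<in> carrier M" shows "\<ominus>\<^bsub>M\<^esub> f = (\<lambda>x\<in>\<omega>. \<ominus>\<^bsub>RR\<^esub> f x)"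
proof -
  interpret M: abelian_group M by (rule abelian_group_M)
  have "(\<lambda>x\<in>\<omega>. \<ominus>\<^bsub>RR\<^esub> f x) \<oplus>\<^bsub>M\<^esub> f = \<zero>\<^bsub>M\<^esub>"
    unfolding M_add M_zero using M_D(1)[OF assms] by (auto intro!: restrict_ext simp: R.l_neg)
  then show ?thesis using M.minus_equality M_neg_closed[OF assms] assms by blast
qed

text \<open>All monomials that occur in \<open>\<phi> (x\<^sup>w)\<close> differ from \<open>w\<close> by an
  exponent of \<open>\<omega>\<^sup>(\<^sup>-\<^sup>1\<^sup>)\<close>: compare \<open>x\<^sup>v *
  \<phi> (x\<^sup>w) = x\<^sup>w * \<phi> (x\<^sup>v)\<close> for interior \<open>v\<close>.\<close>
lemma M_support:
  assumes \<phi>: "\<phi> \<in> carrier M" and w: "w \<in> omega_exponents" and nz: "\<phi> (mon 1 w) m \<noteq> 0"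
  shows "ext (int_vec m - int_vec w) \<in> omega_neg 1"
proof -
  have c: "\<phi> (mon 1 w) \<in> carrier RR" using M_D(1)[OF \<phi>] mon_omega[OF w] .
  have m: "m \<in> hibi_monoid P r" using R.carrier_D(3)[OF c nz] .
  have wS: "w \<in> hibi_monoid P r" using w unfolding omega_exponents_def by simp
  have lat: "ext (int_vec m - int_vec w) \<in> lattice" using m wS exponent_group_iff unfolding R.exponent_group_def by blast
  show ?thesis unfolding omega_inverse_support[OF lat]
  proof
    fix x assume x: "x \<in> interior_vecs"
    have xl: "x \<in> lattice" using x omega_neg_lattice unfolding interior_vecs_def by blast
    have "x \<in> omega_neg 0" using x unfolding interior_vecs_def omega_neg_def by fastforce
    then obtain v where v: "v \<in> hibi_monoid P r" "unext x = int_vec v"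
      using int_vec_monoid_iff[of "unext x"] lattice_unext[OF xl] by auto
    then have ev: "ext (int_vec v) = x" using lattice_unext[OF xl] by simp
    then have vW: "v \<in> omega_exponents" using v x unfolding omega_exponents_def by simp
    have cv: "\<phi> (mon 1 v) \<in> carrier RR" using M_D(1)[OF \<phi>] mon_omega[OF vW] .
    have "mon 1 v \<otimes>\<^bsub>RR\<^esub> \<phi> (mon 1 w) = \<phi> (mon 1 v \<otimes>\<^bsub>RR\<^esub> mon 1 w)"
      using M_D(4)[OF \<phi> R.mon_1_carrier[OF v(1)] mon_omega[OF w]] by simp
    also have "mon 1 v \<otimes>\<^bsub>RR\<^esub> mon 1 w = mon 1 w \<otimes>\<^bsub>RR\<^esub> mon 1 v"
      by (rule R.m_comm[OF R.mon_1_carrier[OF v(1)] R.mon_1_carrier[OF wS]])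
    also have "\<phi> (mon 1 w \<otimes>\<^bsub>RR\<^esub> mon 1 v) = mon 1 w \<otimes>\<^bsub>RR\<^esub> \<phi> (mon 1 v)"
      by (rule M_D(4)[OF \<phi> R.mon_1_carrier[OF wS] mon_omega[OF vW]])
    finally have eq: "mon 1 v \<otimes>\<^bsub>RR\<^esub> \<phi> (mon 1 w) = mon 1 w \<otimes>\<^bsub>RR\<^esub> \<phi> (mon 1 v)" .
    have one: "(1 :: int) \<in> {0..<int p}" using R.p_gt_1 by simp
    have "(mon 1 v \<otimes>\<^bsub>RR\<^esub> \<phi> (mon 1 w)) (v + m) \<noteq> 0"
      using R.mon_mult(1)[OF one v(1) c, of m] R.carrier_D(4)[OF c] nz by simp
    then have nz': "(mon 1 w \<otimes>\<^bsub>RR\<^esub> \<phi> (mon 1 v)) (v + m) \<noteq> 0" unfolding eq .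
    obtain k where k: "v + m = w + k" using R.mon_mult(2)[OF one wS cv, of "v + m"] nz' by blast
    have "\<phi> (mon 1 v) k \<noteq> 0" using R.mon_mult(1)[OF one wS cv, of k] nz' unfolding k by auto
    then have kS: "k \<in> hibi_monoid P r" using R.carrier_D(3)[OF cv] by simp
    have "int_vec k = int_vec v + (int_vec m - int_vec w)"
      using arg_cong[OF k, of int_vec] unfolding int_vec_add by (simp add: algebra_simps)
    then have "ext (int_vec k) = (\<lambda>h. x h + ext (int_vec m - int_vec w) h)"
      by (auto simp: fun_eq_iff ext_add ev)
    then show "(\<lambda>h. x h + ext (int_vec m - int_vec w) h) \<in> omega_neg 0" using kS monoid_iff by metis
  qed
qed

lemma shift_hom:
  assumes a: "ext a \<in> omega_neg 1"
  shows "restrict (R.monomial_map 1 a) \<omega> \<in> carrier M"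
proof (rule M_I)
  show "restrict (R.monomial_map 1 a) \<omega> \<in> extensional \<omega>" by simp
  fix x assume x: "x \<in> \<omega>"
  then have xc: "x \<in> carrier RR" using omega_carrier by simp
  show "restrict (R.monomial_map 1 a) \<omega> x \<in> carrier RR" using x R.monomial_map_closed[OF _ xc, of 1 a] by simp
  show "restrict (R.monomial_map 1 a) \<omega> (x \<oplus>\<^bsub>RR\<^esub> y) = restrict (R.monomial_map 1 a) \<omega> x \<oplus>\<^bsub>RR\<^esub> restrict (R.monomial_map 1 a) \<omega> y" if y: "y \<in> \<omega>" for y
    using R.monomial_map_additive[of 1 a] x y omega_add omega_carrier unfolding R.additive_def by simp
  fix s assume s: "s \<in> carrier RR"
  have "R.monomial_map (p ^ 0) a (s [^]\<^bsub>RR\<^esub> (p ^ 0) \<otimes>\<^bsub>RR\<^esub> x) = s \<otimes>\<^bsub>RR\<^esub> R.monomial_map (p ^ 0) a x"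
  proof (rule R.monomial_map_linear[OF xc s])
    fix j n assume j: "x j \<noteq> 0" and n: "int (p ^ 0) *s n = int_vec j + a"
    have nj: "n = int_vec j + a" using n by (simp add: vec_eq_iff)
    have "ext (int_vec j) \<in> interior_vecs" using x j unfolding omega_iff omega_exponents_def by blast
    then have "(\<lambda>h. ext (int_vec j) h + ext a h) \<in> omega_neg 0"
      using omega_inverse_support[OF omega_neg_lattice[OF a]] a by blast
    moreover have "(\<lambda>h. ext (int_vec j) h + ext a h) = ext n" unfolding nj by (simp add: fun_eq_iff ext_add)
    ultimately show "n \<in> int_vec ` hibi_monoid P r" using int_vec_monoid_iff by simp
  qed
  then show "restrict (R.monomial_map 1 a) \<omega> (s \<otimes>\<^bsub>RR\<^esub> x) = s \<otimes>\<^bsub>RR\<^esub> restrict (R.monomial_map 1 a) \<omega> x"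
    using x s omega_mult[OF s x] by simp
qed

text \<open>The homomorphisms for which all exponents occurring in \<open>\<phi> (x\<^sup>w)\<close> arise
  from \<open>w\<close> by adding an element of \<open>omega_neg 1\<close> of degree
  \<open>d\<close> and an exponent of the ring form a submodule. It contains the given generators
  of degree \<open>d\<close>, and therefore multiplication by \<open>x\<^sup>a\<close> for every
  \<open>a\<close> in \<open>omega_neg 1\<close>. Applied to \<open>lo\<close> this determines
  \<open>d\<close>.\<close>
lemma level_of_hibi_omega_inv_level:
  assumes "hibi_omega_inv_level K P r"
  shows level
proof -
  obtain d S where S: "S \<subseteq> hibi_omega_inv_degree K P r d" and gen: "generates_module RR M S"
    using assms unfolding hibi_omega_inv_level_def by blast
  have SM: "S \<subseteq> carrier M" using gen unfolding generates_module_def by simp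
  interpret M: abelian_group M by (rule abelian_group_M)
  define good where "good w m \<longleftrightarrow> (\<exists>b s. ext b \<in> omega_neg 1 \<and> b $ None = d \<and> s \<in> hibi_monoid P r \<and> int_vec m = int_vec w + b + int_vec s)"
    for w m :: "nat ^ 'v option"
  define N where "N = {\<phi> \<in> carrier M. \<forall>w\<in>omega_exponents. \<forall>m. \<phi> (mon 1 w) m \<noteq> 0 \<longrightarrow> good w m}"
  have "submodule N RR M"
  proof (intro submodule.intro subgroup.intro submodule_axioms.intro)
    show "N \<subseteq> carrier (add_monoid M)" unfolding N_def by auto
    show "\<one>\<^bsub>add_monoid M\<^esub> \<in> N"
      using M_zero_closed mon_omega unfolding N_def by (simp add: M_zero R.zero_R)
    fix \<phi> assume \<phi>: "\<phi> \<in> N"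
    then have c: "\<phi> \<in> carrier M" unfolding N_def by simp
    have "(\<ominus>\<^bsub>M\<^esub> \<phi>) \<in> N"
    proof -
      have "\<phi> (mon 1 w) m \<noteq> 0" if w: "w \<in> omega_exponents" and nz: "(\<ominus>\<^bsub>M\<^esub> \<phi>) (mon 1 w) m \<noteq> 0" for w m
      proof -
        have "(\<ominus>\<^bsub>RR\<^esub> \<phi> (mon 1 w)) m \<noteq> 0" using nz mon_omega[OF w] unfolding M_inv[OF c] by simp
        then show ?thesis using R.minus_eval[OF M_D(1)[OF c mon_omega[OF w]]] by blast
      qed
      then show ?thesis using \<phi> M.a_inv_closed[OF c] unfolding N_def by blast
    qed
    then show "inv\<^bsub>add_monoid M\<^esub> \<phi> \<in> N" unfolding a_inv_def .
    show "\<phi> \<otimes>\<^bsub>add_monoid M\<^esub> \<psi> \<in> N" if \<psi>: "\<psi> \<in> N" for \<psi>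
    proof -
      have c': "\<psi> \<in> carrier M" using \<psi> unfolding N_def by simp
      have "good w m" if w: "w \<in> omega_exponents" and nz: "(\<phi> \<oplus>\<^bsub>M\<^esub> \<psi>) (mon 1 w) m \<noteq> 0" for w m
      proof -
        have "\<phi> (mon 1 w) m \<noteq> 0 \<or> \<psi> (mon 1 w) m \<noteq> 0"
          using nz mon_omega[OF w] R.add_eval[OF M_D(1)[OF c mon_omega[OF w]] M_D(1)[OF c' mon_omega[OF w]], of m]
          unfolding M_add by auto
        then show ?thesis using \<phi> \<psi> w unfolding N_def by blast
      qed
      then have "\<phi> \<oplus>\<^bsub>M\<^esub> \<psi> \<in> N" using M_add_closed[OF c c'] unfolding N_def by blast
      then show ?thesis by simp
    qed
    fix a assume a: "a \<in> carrier RR"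
    show "a \<odot>\<^bsub>M\<^esub> \<phi> \<in> N"
    proof -
      have "good w m" if w: "w \<in> omega_exponents" and nz: "(a \<odot>\<^bsub>M\<^esub> \<phi>) (mon 1 w) m \<noteq> 0" for w m
      proof -
        have "(a \<otimes>\<^bsub>RR\<^esub> \<phi> (mon 1 w)) m \<noteq> 0" using nz mon_omega[OF w] unfolding M_smult by simp
        then obtain k j where kj: "m = k + j" "a k \<noteq> 0" "\<phi> (mon 1 w) j \<noteq> 0"
          using R.mult_support[OF a M_D(1)[OF c mon_omega[OF w]]] by blast
        then have "good w j" using \<phi> w unfolding N_def by blast
        then obtain b s where bs: "ext b \<in> omega_neg 1" "b $ None = d" "s \<in> hibi_monoid P r" "int_vec j = int_vec w + b + int_vec s"
          unfolding good_def by blast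
        have "int_vec m = int_vec w + b + int_vec (k + s)" unfolding kj int_vec_add bs(4) by (simp add: algebra_simps)
        then show ?thesis unfolding good_def
          using bs hibi_monoid_add[OF R.carrier_D(3)[OF a kj(2)] bs(3)] by blast
      qed
      then show ?thesis using M_smult_closed[OF a c] unfolding N_def by blast
    qed
  qed
  moreover have "S \<subseteq> N"
  proof
    fix \<phi> assume \<phi>: "\<phi> \<in> S"
    then have c: "\<phi> \<in> carrier M" using SM by auto
    have "good w m" if w: "w \<in> omega_exponents" and nz: "\<phi> (mon 1 w) m \<noteq> 0" for w m
    proof -
      have "t_homogeneous K (int (w $ None)) (mon 1 w)" unfolding t_homogeneous_def K_zero mon_def by simp
      then have "t_homogeneous K (int (w $ None) + d) (\<phi> (mon 1 w))"
        using S \<phi> mon_omega[OF w] unfolding hibi_omega_inv_degree_def by blast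
      then have "int (m $ None) = int (w $ None) + d" using nz unfolding t_homogeneous_def K_zero by blast
      then have "(int_vec m - int_vec w) $ None = d" by (simp add: int_vec_def)
      moreover have "int_vec m = int_vec w + (int_vec m - int_vec w) + int_vec 0" by simp
      ultimately show ?thesis unfolding good_def using M_support[OF c w nz] hibi_monoid_zero by blast
    qed
    then show "\<phi> \<in> N" using c unfolding N_def by blast
  qed
  ultimately have NM: "N = carrier M" using gen unfolding generates_module_def by blast
  have dec: "\<exists>b s. ext b \<in> omega_neg 1 \<and> b $ None = d \<and> s \<in> hibi_monoid P r \<and> a = b + int_vec s"
    if a: "ext a \<in> omega_neg 1" for a
  proof -
    obtain w where w: "w \<in> omega_exponents" using omega_exponents_ex by blast
    have wS: "w \<in> hibi_monoid P r" using w unfolding omega_exponents_def by simp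
    have "(\<lambda>h. ext (int_vec w) h + ext a h) \<in> omega_neg 0"
      using omega_inverse_support[OF omega_neg_lattice[OF a]] a w unfolding omega_exponents_def by blast
    moreover have "(\<lambda>h. ext (int_vec w) h + ext a h) = ext (int_vec w + a)" by (simp add: fun_eq_iff ext_add)
    ultimately obtain n where n: "n \<in> hibi_monoid P r" "int_vec w + a = int_vec n" using int_vec_monoid_iff[of "int_vec w + a"] by auto
    have "a = map_exponent 1 w n" unfolding map_exponent_def n(2)[symmetric] by (simp add: vec_eq_iff)
    then have "R.monomial_map 1 a (mon 1 w) n = 1" using R.monomial_map_mon[OF wS n(1), of 1 a] by simp
    then have nz: "restrict (R.monomial_map 1 a) \<omega> (mon 1 w) n \<noteq> 0" using mon_omega[OF w] by simp
    have "restrict (R.monomial_map 1 a) \<omega> \<in> N" using shift_hom[OF a] unfolding NM .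
    then have "good w n" using w nz unfolding N_def by blast
    then obtain b s where "ext b \<in> omega_neg 1" "b $ None = d" "s \<in> hibi_monoid P r" "int_vec n = int_vec w + b + int_vec s"
      unfolding good_def by blast
    moreover from this have "a = b + int_vec s" using n(2) by (simp add: algebra_simps)
    ultimately show ?thesis by blast
  qed
  have lower: "- rank \<le> b $ None" if "ext b \<in> omega_neg 1" for b
    using omega_neg_lo[OF that bot_in] lo_bot by simp
  have "lo \<in> min_gens 1" using lo_mult_mem[of 1] by simp
  then have lo: "lo \<in> omega_neg 1" "lo (Some None) = - rank" unfolding min_gens_def by auto
  then have elo: "ext (unext lo) = lo" using omega_neg_lattice lattice_unext by blast
  obtain b s where bs: "ext b \<in> omega_neg 1" "b $ None = d" "unext lo = b + int_vec s"
    using dec[of "unext lo"] lo(1) elo by auto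
  have "unext lo $ None = - rank" using lo(2) unfolding unext_def by simp
  then have "- rank = d + int (s $ None)" using bs by (simp add: int_vec_def)
  moreover have "- rank \<le> d" using lower[OF bs(1)] bs(2) by simp
  ultimately have d: "d = - rank" by simp
  show level unfolding level_def
  proof
    fix a assume a: "a \<in> omega_neg 1"
    then have ea: "ext (unext a) = a" using omega_neg_lattice lattice_unext by blast
    obtain b s where bs: "ext b \<in> omega_neg 1" "b $ None = d" "s \<in> hibi_monoid P r" "unext a = b + int_vec s"
      using dec[of "unext a"] a ea by auto
    have "a h = ext b h + ext (int_vec s) h" for h using arg_cong[OF bs(4), of ext] ea ext_add by metis
    moreover have "ext b \<in> min_gens 1" using bs d unfolding min_gens_def by simp
    moreover have "ext (int_vec s) \<in> omega_neg 0" using bs(3) monoid_iff by simp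
    ultimately show "\<exists>b\<in>min_gens 1. \<exists>s\<in>omega_neg 0. \<forall>h. a h = b h + s h" by blast
  qed
qed

end

section \<open>The limit of the Frobenius complexities\<close>

context hibi_fp
begin

lemma cx_fold: "frobenius_complexity p RR = (INF \<alpha>\<in>{\<alpha>::real. \<alpha> > 0 \<and>
    (\<exists>B::real. \<forall>\<^sub>F e in sequentially. ereal_of_enat (cx e) \<le> ereal (B * real p powr (\<alpha> * real e)))}. ereal \<alpha>)"
  unfolding frobenius_complexity_def cx_def ..

lemma frobenius_complexity_le:
  assumes level
  shows "frobenius_complexity p RR \<le> ereal (real (card free))"
proof (rule ereal_le_epsilon2)
  let ?N = "card free"
  let ?h = "card (hat_set P)"
  fix \<epsilon> :: real assume \<epsilon>: "0 < \<epsilon>"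
    let ?\<alpha> = "real ?N + \<epsilon>"
    have "ereal_of_enat (cx e) \<le> ereal (real (2 * ?h + 1) ^ ?N * real p powr (?\<alpha> * real e))" for e
    proof -
      have p1: "1 \<le> real p ^ e" using R.p_gt_1 by (simp add: one_le_power)
      have "real (nat (2 * (int p ^ e - 1) * int ?h + 1)) = 2 * (real p ^ e - 1) * real ?h + 1"
      proof -
        have "(1::int) \<le> int p ^ e" using R.p_gt_1 by (simp add: one_le_power)
        then have "0 \<le> 2 * (int p ^ e - 1) * int ?h + 1" by simp
        then show ?thesis by simp
      qed
      also have "\<dots> \<le> real (2 * ?h + 1) * real p ^ e" using p1 by (simp add: algebra_simps)
      finally have "real (nat (2 * (int p ^ e - 1) * int ?h + 1)) ^ ?N \<le> (real (2 * ?h + 1) * real p ^ e) ^ ?N"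
        by (rule power_mono) simp
      also have "\<dots> = real (2 * ?h + 1) ^ ?N * real p powr (real ?N * real e)"
        using R.p_gt_1 by (simp add: power_mult_distrib powr_realpow power_mult[symmetric] mult.commute flip: of_nat_mult)
      also have "\<dots> \<le> real (2 * ?h + 1) ^ ?N * real p powr (?\<alpha> * real e)"
        using R.p_gt_1 \<epsilon> by (intro mult_left_mono powr_mono mult_right_mono) auto
      finally have "ereal (real (nat (2 * (int p ^ e - 1) * int ?h + 1) ^ ?N)) \<le>
        ereal (real (2 * ?h + 1) ^ ?N * real p powr (?\<alpha> * real e))" by simp
      moreover have "ereal_of_enat (cx e) \<le> ereal (real (nat (2 * (int p ^ e - 1) * int ?h + 1) ^ ?N))"
      proof -
        have "ereal_of_enat (cx e) \<le> ereal_of_enat (enat (nat (2 * (int p ^ e - 1) * int ?h + 1) ^ ?N))"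
          unfolding ereal_of_enat_le_iff by (rule cx_upper[OF assms])
        then show ?thesis by (simp only: ereal_of_enat_simps)
      qed
      ultimately show ?thesis by (rule order_trans[rotated])
    qed
    then have "frobenius_complexity p RR \<le> ereal ?\<alpha>"
      unfolding cx_fold using \<epsilon> by (intro INF_lower) (auto intro!: exI[of _ "real (2 * ?h + 1) ^ ?N"])
    then show "frobenius_complexity p RR \<le> ereal (real ?N) + ereal \<epsilon>" by simp
qed

lemma frobenius_complexity_nonneg: "0 \<le> frobenius_complexity p RR"
  unfolding cx_fold by (rule INF_greatest) auto

text \<open>If the growth exponent \<open>\<alpha>\<close> is admissible, then \<open>(s ^ N / p ^ \<alpha>)
  ^ J\<close> is bounded in \<open>J\<close>, so the base is at most \<open>1\<close>.\<close>
lemma frobenius_complexity_ge: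
  assumes level "free \<noteq> {}" "p = 2 * k + 1" "2 * card (hat_set P) + 1 \<le> k"
    "s = p div (card (hat_set P) + 1)" "card (hat_set P) \<le> s"
  shows "ereal (real (card free) * ln (real s) / ln (real p)) \<le> frobenius_complexity p RR"
  unfolding cx_fold
proof (rule INF_greatest)
  let ?N = "card free"
  fix \<alpha> assume "\<alpha> \<in> {\<alpha>::real. \<alpha> > 0 \<and>
    (\<exists>B::real. \<forall>\<^sub>F e in sequentially. ereal_of_enat (cx e) \<le> ereal (B * real p powr (\<alpha> * real e)))}"
  then obtain B where B: "\<forall>\<^sub>F e in sequentially. ereal_of_enat (cx e) \<le> ereal (B * real p powr (\<alpha> * real e))" by blast
  have p1: "1 < real p" using R.p_gt_1 by simp
  have "0 < card (hat_set P)" unfolding hat_set_def by (simp add: card_gt_0_iff)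
  then have s0: "0 < real s" using assms(6) by simp
  define \<rho> where "\<rho> = real s ^ ?N / real p powr \<alpha>"
  have "\<forall>\<^sub>F J in sequentially. \<rho> ^ J \<le> B * real p powr \<alpha>"
  proof -
    have "\<forall>\<^sub>F J in sequentially. ereal_of_enat (cx (Suc J)) \<le> ereal (B * real p powr (\<alpha> * real (Suc J)))"
      by (rule eventually_compose_filterlim[OF B filterlim_Suc])
    then show ?thesis
    proof (rule eventually_mono)
      fix J assume J: "ereal_of_enat (cx (Suc J)) \<le> ereal (B * real p powr (\<alpha> * real (Suc J)))"
      have "ereal_of_enat (enat (s ^ (J * ?N))) \<le> ereal_of_enat (cx (Suc J))"
        unfolding ereal_of_enat_le_iff by (rule cx_lower[OF assms])
      then have "ereal (real (s ^ (J * ?N))) \<le> ereal (B * real p powr (\<alpha> * real (Suc J)))"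
        using J by (simp only: ereal_of_enat_simps)
      then have "(real s ^ ?N) ^ J \<le> B * real p powr (\<alpha> * real (Suc J))"
        by (simp add: power_mult[symmetric] mult.commute)
      also have "real p powr (\<alpha> * real (Suc J)) = (real p powr \<alpha>) ^ J * real p powr \<alpha>"
      proof -
        have "(real p powr \<alpha>) ^ J = real p powr (\<alpha> * real J)"
          using p1 by (simp add: powr_powr flip: powr_realpow)
        then show ?thesis by (simp add: powr_add[symmetric] algebra_simps)
      qed
      finally show "\<rho> ^ J \<le> B * real p powr \<alpha>"
        unfolding \<rho>_def power_divide using p1 by (simp add: divide_le_eq mult.assoc mult.commute)
    qed
  qed
  have "\<rho> \<le> 1"
  proof (rule ccontr)
    assume "\<not> \<rho> \<le> 1"
    then obtain n where n: "B * real p powr \<alpha> < \<rho> ^ n" using real_arch_pow[of \<rho>] by auto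
    obtain J where "\<rho> ^ (n + J) \<le> B * real p powr \<alpha>"
      using \<open>\<forall>\<^sub>F J in sequentially. \<rho> ^ J \<le> B * real p powr \<alpha>\<close>
      unfolding eventually_sequentially by (meson le_add2)
    moreover have "\<rho> ^ n \<le> \<rho> ^ (n + J)" using \<open>\<not> \<rho> \<le> 1\<close> by (intro power_increasing) auto
    ultimately show False using n by linarith
  qed
  then have "real s ^ ?N \<le> real p powr \<alpha>" unfolding \<rho>_def using p1 by (simp add: divide_le_eq)
  then have "ln (real s ^ ?N) \<le> ln (real p powr \<alpha>)" using s0 p1 by (subst ln_le_cancel_iff) auto
  then have "real ?N * ln (real s) \<le> \<alpha> * ln (real p)" using s0 p1 by (simp add: ln_realpow ln_powr)
  then show "ereal (real ?N * ln (real s) / ln (real p)) \<le> ereal \<alpha>" using p1 by (simp add: divide_le_eq)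
qed

lemma frobenius_complexity_bound:
  assumes level "4 * (card (hat_set P) + 1) ^ 2 \<le> p"
  shows "ereal (real (card free) * (1 - ln (real (2 * (card (hat_set P) + 1))) / ln (real p))) \<le> frobenius_complexity p RR"
proof (cases "free = {}")
  case True
  then show ?thesis using frobenius_complexity_nonneg by (simp add: zero_ereal_def)
next
  case False
  define h where "h = card (hat_set P) + 1"
  define s where "s = p div h"
  have h1: "1 \<le> h" unfolding h_def by simp
  have ph: "4 * h * h \<le> p" using assms(2) unfolding h_def by (simp add: power2_eq_square algebra_simps)
  have hh: "h \<le> h * h" using h1 by simp
  have "odd p" using prime_odd_nat[OF pp] ph hh h1 by linarith
  then obtain k where k: "p = 2 * k + 1" by (metis oddE)
  have k2: "2 * card (hat_set P) + 1 \<le> k" using ph hh k h1 unfolding h_def by linarith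
  have hs: "h \<le> s"
  proof -
    have "h * h \<le> p" using ph by linarith
    then have "h * h div h \<le> p div h" by (rule div_le_mono)
    then show ?thesis unfolding s_def using h1 by simp
  qed
  have ps: "real p \<le> 2 * real h * real s"
  proof -
    have "p = h * s + p mod h" unfolding s_def by simp
    moreover have "p mod h < h" using h1 by simp
    moreover have "h \<le> h * s" using hs h1 by (cases s) auto
    ultimately have "p \<le> 2 * (h * s)" by linarith
    then have "real p \<le> real (2 * (h * s))" by (simp only: of_nat_le_iff)
    then show ?thesis by simp
  qed
  have p1: "1 < real p" using R.p_gt_1 by simp
  have s0: "0 < real s" "0 < real h" using hs h1 by auto
  have "ln (real p) \<le> ln (real (2 * h) * real s)" using ps p1 s0 by (subst ln_le_cancel_iff) auto
  also have "\<dots> = ln (real (2 * h)) + ln (real s)" using s0 by (subst ln_mult) auto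
  finally have "ln (real p) - ln (real (2 * h)) \<le> ln (real s)" by simp
  then have "(ln (real p) - ln (real (2 * h))) / ln (real p) \<le> ln (real s) / ln (real p)"
    using p1 by (intro divide_right_mono) auto
  then have "1 - ln (real (2 * h)) / ln (real p) \<le> ln (real s) / ln (real p)"
    using p1 by (simp add: diff_divide_distrib)
  then have "real (card free) * (1 - ln (real (2 * h)) / ln (real p)) \<le> real (card free) * (ln (real s) / ln (real p))"
    by (intro mult_left_mono) auto
  then have "ereal (real (card free) * (1 - ln (real (2 * h)) / ln (real p))) \<le> ereal (real (card free) * ln (real s) / ln (real p))"
    by simp
  also have "\<dots> \<le> frobenius_complexity p RR"
    by (rule frobenius_complexity_ge[OF assms(1) False k k2]) (use hs in \<open>auto simp: s_def h_def\<close>)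
  finally show ?thesis unfolding h_def .
qed

end

theorem mainTheorem1:
  fixes P :: "'v::finite set" and r :: "('v \<times> 'v) set"
  assumes "partial_order_on P r"
    and "\<And>p::nat. Factorial_Ring.prime p \<Longrightarrow> hibi_omega_inv_level (residue_ring (int p)) P r"
    and "\<And>p::nat. Factorial_Ring.prime p \<Longrightarrow> \<not> gorenstein_ring (hibi_ring (residue_ring (int p)) P r)"
  shows "((\<lambda>p::nat. frobenius_complexity p (hibi_ring (residue_ring (int p)) P r))
           \<longlongrightarrow> ereal (real (card {v \<in> P. \<forall>C \<in> minimal_length_maximal_chains P r. v \<notin> C})))
         (inf at_top (principal {p. Factorial_Ring.prime p}))"
proof -
  interpret hibi_poset P r by unfold_locales (rule assms(1))
  have fp: "hibi_fp P r p" if "Factorial_Ring.prime p" for p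
    by unfold_locales (rule that)
  have level: level
    using hibi_fp.level_of_hibi_omega_inv_level[OF fp[OF two_is_prime_nat] assms(2)[OF two_is_prime_nat]] .
  let ?F = "\<lambda>p. frobenius_complexity p (hibi_ring (residue_ring (int p)) P r)"
  let ?filt = "inf at_top (principal {p::nat. Factorial_Ring.prime p})"
  let ?c = "real (2 * (card (hat_set P) + 1))"
  let ?N = "real (card free)"
  have "(?F \<longlongrightarrow> ereal ?N) ?filt"
  proof (rule tendsto_sandwich)
    show "\<forall>\<^sub>F p in ?filt. ereal (?N * (1 - ln ?c / ln (real p))) \<le> ?F p"
      unfolding eventually_inf_principal
      by (rule eventually_mono[OF eventually_ge_at_top[of "4 * (card (hat_set P) + 1) ^ 2"]])
        (use hibi_fp.frobenius_complexity_bound[OF fp level] in blast)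
    show "\<forall>\<^sub>F p in ?filt. ?F p \<le> ereal ?N"
      unfolding eventually_inf_principal
      by (rule always_eventually) (use hibi_fp.frobenius_complexity_le[OF fp level] in blast)
    have "((\<lambda>p::nat. ?N * (1 - ln ?c / ln (real p))) \<longlongrightarrow> ?N * (1 - 0)) at_top"
    proof (intro tendsto_mult tendsto_const tendsto_diff)
      have "filterlim (\<lambda>p::nat. ln (real p)) at_infinity at_top"
        by (rule filterlim_at_top_imp_at_infinity[OF filterlim_compose[OF ln_at_top filterlim_real_sequentially]])
      then show "((\<lambda>p::nat. ln ?c / ln (real p)) \<longlongrightarrow> 0) at_top"
        by (rule tendsto_divide_0[OF tendsto_const])
    qed
    then have "((\<lambda>p::nat. ereal (?N * (1 - ln ?c / ln (real p)))) \<longlongrightarrow> ereal ?N) at_top"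
      by (simp only: tendsto_ereal diff_zero mult_1_right)
    then show "((\<lambda>p::nat. ereal (?N * (1 - ln ?c / ln (real p)))) \<longlongrightarrow> ereal ?N) ?filt"
      by (rule tendsto_mono[OF inf_le1])
  qed (rule tendsto_const)
  then show ?thesis unfolding card_free .
qed

end
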